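(* Let $m\le n$ be positive integers, let $r\le\min\{m,n-1\}$ be a positive integer, let $d_1\mid d_2\mid\cdots\mid d_r$ be positive integers with $d_r=\prod_{j=1}^{\infty}p_j^{s_j}$, and let $$\mathcal{S}=\{D=(D_{i,j})_{n\times m}\in\mathbb{S}:\ D_{i,i}=d_i\ \text{for all } i\le r\}.$$ For $(p,s)=(p_j,s_j)$, $j=1,2,\dots$, let $\tilde a_i$ $(0\le i\le s)$ be the number of elements among $d_1,\dots,d_r$ that are not multiples of $p^i$ (thus $\tilde a_0=0$ and $\tilde a_s\le r-1$). Then $$\mu_{p^{s+1}}(\mathcal{S})=p^{-\sum_{i=1}^{s}(n-\tilde a_i)(m-\tilde a_i)}\cdot\frac{[p,n][p,m]}{[p,n-\tilde a_s][p,m-\tilde a_s]\prod_{i=1}^{s}[p,\tilde a_i-\tilde a_{i-1}]}$$ $$\qquad-\sum_{\ell=\tilde a_s}^{r-1}p^{-(n-\ell)(m-\ell)-\sum_{i=1}^{s}(n-\tilde a_i)(m-\tilde a_i)}\cdot\frac{[p,n][p,m]}{[p,n-\ell][p,m-\ell][p,\ell-\tilde a_s]\prod_{i=1}^{s}[p,\tilde a_i-\tilde a_{i-1}]}.$$ In particular, when $s=0$ (which holds for all but finitely many $j$), $$\mu_p(\mathcal{S})=1-\sum_{\ell=0}^{r-1}p^{-(n-\ell)(m-\ell)}\cdot\frac{[p,n][p,m]}{[p,n-\ell][p,m-\ell][p,\ell]}.$$ The density $\mu(\mathcal{S})$ is then given by $\mu(\mathcal{S})=\prod_{j=1}^{\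infty}\mu_{p_j^{s_j+1}}(\mathcal{S})$.
   Context: $p_j$ is the $j$-th smallest prime. $[p,0]=1$ and $[p,\ell]=\prod_{j=1}^{\ell}(1-p^{-j})$ for $\ell\ge1$. For a positive integer $k$, $\mathbb{Z}_{(k)}=\{-k,\dots,k\}$. The Smith normal form (SNF) of an $n\times m$ matrix $M$ over $\mathbb{Z}$ or $\mathbb{Z}/q\mathbb{Z}$ is the diagonal matrix $PMQ$ ($P,Q$ invertible) with diagonal entries $d_1\mid d_2\mid\cdots\mid d_m$ (trailing entries may be $0$); the entries are unique up to units, and are taken nonnegative over $\mathbb{Z}$. The SNF of the zero matrix is itself. $\mathbb{S}$ is the set of $n\times m$ diagonal integer matrices whose diagonal entries $(d_1,\dots,d_m)$ are nonnegative with $d_{i+1}$ a multiple of $d_i$ for $1\le i\le m-1$. For $\mathcal{S}\subseteq\mathbb{S}$, $\mu^{(k)}(\mathcal{S})$ is the probability that $\mathrm{SNF}(M)\in\mathcal{S}$ for a random $n\times m$ matrix $M$ with independent entries uniform on $\mathbb{Z}_{(k)}$, and $\mu(\mathcal{S})=\lim_{k\to\infty}\mu^{(k)}(\mathcal{S})$ if the limit exists. For a prime $p$ and positive integer $s$, $\mu_{p^s}(\mathcal{S})$ is the probability, for an $n\times m$ matrix $M$ with independent entries uniform on $\mathbb{Z}/p^s\mathbb{Z}$, that $\mathrm{SNF}(M)\in\mathcal{S}\ (\mathrm{mod}\ p^s)$, i.e. that some $D\in\mathcal{S}$ has, mod $p^s$, the same diagonal entries as $\mathrm{SNF}(M)$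 up to multiplication of each entry by a unit of $\mathbb{Z}/p^s\mathbb{Z}$. *)

theory Defs
  imports "HOL-Analysis.Analysis" "HOL-Probability.Probability"
    "HOL-Number_Theory.Number_Theory" "Jordan_Normal_Form.Matrix"
begin

(* Primes are indexed from 0, so nth_prime j is the prime written p_(j+1) when counting from 1. *)
definition nth_prime :: "nat \<Rightarrow> nat" where
  "nth_prime j = enumerate {p. prime p} j"

definition pbracket :: "nat \<Rightarrow> nat \<Rightarrow> real" where
  "pbracket p l = (\<Prod>j=1..l. 1 - 1 / real p ^ j)"

(* The set of integer n x m matrices in Smith form.  Matrices have 0-based indices, and
   m \<le> n is intended throughout, so that the diagonal has m entries. *)
definition smith_mats :: "nat \<Rightarrow> nat \<Rightarrow> int mat set" where
  "smith_mats n m = {D \<in> carrier_mat n m. diagonal_mat D \<and>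
     (\<forall>i<m. 0 \<le> D $$ (i, i)) \<and>
     (\<forall>i. Suc i < m \<longrightarrow> D $$ (i, i) dvd D $$ (Suc i, Suc i))}"

definition is_SNF :: "nat \<Rightarrow> nat \<Rightarrow> int mat \<Rightarrow> int mat \<Rightarrow> bool" where
  "is_SNF n m M D \<longleftrightarrow> D \<in> smith_mats n m \<and>
     (\<exists>P \<in> carrier_mat n n. \<exists>Q \<in> carrier_mat m m.
        invertible_mat P \<and> invertible_mat Q \<and> D = P * M * Q)"

(* Matrices over Z/qZ are represented by integer matrices, with entrywise congruence modulo q
   playing the role of equality. *)
definition mat_cong :: "nat \<Rightarrow> int mat \<Rightarrow> int mat \<Rightarrow> bool" where
  "mat_cong q A B \<longleftrightarrow> dim_row A = dim_row B \<and> dim_col A = dim_col B \<and>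
     (\<forall>i<dim_row A. \<forall>j<dim_col A. [A $$ (i, j) = B $$ (i, j)] (mod int q))"

definition invertible_mod :: "nat \<Rightarrow> nat \<Rightarrow> int mat \<Rightarrow> bool" where
  "invertible_mod q n P \<longleftrightarrow> P \<in> carrier_mat n n \<and>
     (\<exists>P' \<in> carrier_mat n n. mat_cong q (P * P') (1\<^sub>m n) \<and> mat_cong q (P' * P) (1\<^sub>m n))"

(* The third conjunct is divisibility of consecutive diagonal entries in the ring Z/qZ. *)
definition is_SNF_mod :: "nat \<Rightarrow> nat \<Rightarrow> nat \<Rightarrow> int mat \<Rightarrow> int mat \<Rightarrow> bool" where
  "is_SNF_mod q n m M E \<longleftrightarrow> E \<in> carrier_mat n m \<and>
     (\<forall>i<n. \<forall>j<m. i \<noteq> j \<longrightarrow> [E $$ (i, j) = 0] (mod int q)) \<and>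
     (\<forall>i. Suc i < m \<longrightarrow> (\<exists>c. [E $$ (Suc i, Suc i) = c * E $$ (i, i)] (mod int q))) \<and>
     (\<exists>P Q. invertible_mod q n P \<and> invertible_mod q m Q \<and> mat_cong q E (P * M * Q))"

definition random_mat :: "nat \<Rightarrow> nat \<Rightarrow> int set \<Rightarrow> int mat pmf" where
  "random_mat n m A =
     map_pmf (mat n m) (Pi_pmf ({..<n} \<times> {..<m}) 0 (\<lambda>_. pmf_of_set A))"

(* An integer matrix has exactly one Smith normal form, so the event below says SNF(M) \<in> S. *)
definition mu_box :: "nat \<Rightarrow> nat \<Rightarrow> int mat set \<Rightarrow> nat \<Rightarrow> real" where
  "mu_box n m S k =
     measure_pmf.prob (random_mat n m {- int k..int k}) {M. \<exists>D\<in>S. is_SNF n m M D}"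

(* Meaningful only if the limit exists. *)
definition mu :: "nat \<Rightarrow> nat \<Rightarrow> int mat set \<Rightarrow> real" where
  "mu n m S = lim (mu_box n m S)"

(* A Smith normal form E over Z/qZ is determined only up to units u of Z/qZ on the diagonal;
   the residues {0..<q} represent the elements of Z/qZ. *)
definition mu_mod :: "nat \<Rightarrow> nat \<Rightarrow> nat \<Rightarrow> int mat set \<Rightarrow> real" where
  "mu_mod q n m S =
     measure_pmf.prob (random_mat n m {0..<int q})
       {M. \<exists>D\<in>S. \<exists>E. is_SNF_mod q n m M E \<and>
          (\<forall>i<m. \<exists>u. coprime u (int q) \<and> [D $$ (i, i) = u * E $$ (i, i)] (mod int q))}"

(* The divisors d 1, ..., d r are indexed from 1, matrix positions from 0. *)
definition prescribed :: "nat \<Rightarrow> nat \<Rightarrow> nat \<Rightarrow> (nat \<Rightarrow> nat) \<Rightarrow> int mat set" where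
  "prescribed n m r d = {D \<in> smith_mats n m. \<forall>i\<in>{1..r}. D $$ (i - 1, i - 1) = int (d i)}"

definition a_tilde :: "nat \<Rightarrow> (nat \<Rightarrow> nat) \<Rightarrow> nat \<Rightarrow> nat \<Rightarrow> nat" where
  "a_tilde r d p i = card {t \<in> {1..r}. \<not> p ^ i dvd d t}"

end

theory Submission
  imports Defs "Jordan_Normal_Form.Determinant" "HOL-Real_Asymp.Real_Asymp"
begin

text \<open>Locally, at a prime power $p^{s+1}$, the event depends only on the numbers of solutions of $Mx \equiv 0$ modulo
  the powers of $p$. These numbers are invariant under equivalence, drop by a known factor when a unit pivot is eliminated, and
  shift when $M$ is divisible by $p$. Eliminating a uniform random matrix entry by entry keeps it uniform, up to factors
  $p$ on the entries found to be non-units, so the local densities satisfy a recursion that the product formula solves.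

  Globally, an integer matrix has the prescribed invariants if and only if it has them at every prime. Finitely many primes
  are independent by the Chinese remainder theorem. The remaining primes matter only if they divide all $r \times r$
  minors, and since $r < n$ this happens for some prime above $N$ with probability $O(1/N + 1/k)$.\<close>

section \<open>Smith normal form over the integers\<close>

text \<open>Counting solutions instead of following diagonal entries makes every local reduction an
  operation on index sets. The modulus \<open>q\<close> and the sample space stay fixed during the
  recursion: elimination shrinks the index sets, and dividing by \<open>p\<close> lowers
  \<open>s\<close>, because the event for \<open>s\<close> makes sense under any
  \<open>q = p ^ e\<close> with \<open>s < e\<close>. A non-unit entry is no longer uniform, but it
  is \<open>p\<close> times a uniform one. Since a column is finished before the next is begun,
  these factors fill whole columns outside the current one, so they are common to the rows that a
  pivot combines. Globally the obstacle is to exchange the limit in \<open>k\<close> with infinitely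
  many primes. Rank \<open>r - 1\<close> modulo \<open>p\<close> has probability about
  \<open>p ^ - ((n - r + 1) * (m - r + 1))\<close>; for \<open>r < n\<close> the exponent is at
  least 2 and the sum over primes converges, whereas \<open>1 / p\<close> would diverge. Primes
  above \<open>k\<close> are not equidistributed in the box and are controlled by the size of one
  minor.\<close>

definition mat_unit :: "nat \<Rightarrow> int mat \<Rightarrow> bool" where
  "mat_unit n P \<longleftrightarrow> P \<in> carrier_mat n n \<and> (\<exists>P' \<in> carrier_mat n n. P * P' = 1\<^sub>m n \<and> P' * P = 1\<^sub>m n)"

lemma mat_unit_iff_invertible_mat: "mat_unit n P \<longleftrightarrow> P \<in> carrier_mat n n \<and> invertible_mat P"
proof -
  \<comment> \<open>\<open>inverts_mat\<close> does not fix the size of the inverse; the dimensions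
    of the two products force it to be \<open>n\<close> by \<open>n\<close>.\<close>
  have "B \<in> carrier_mat n n" if "P \<in> carrier_mat n n" "P * B = 1\<^sub>m n" "B * P = 1\<^sub>m (dim_row B)" for B
    using that
    by (metis carrier_matD carrier_matI index_mult_mat(2,3) index_one_mat(2,3))
  then show ?thesis
    unfolding mat_unit_def invertible_mat_def inverts_mat_def square_mat.simps
    by (metis carrier_matD)
qed

lemma mat_unitI:
  "\<lbrakk>P \<in> carrier_mat n n; P' \<in> carrier_mat n n; P * P' = 1\<^sub>m n; P' * P = 1\<^sub>m n\<rbrakk> \<Longrightarrow> mat_unit n P"
  unfolding mat_unit_def by blast

lemma mat_unit_one: "mat_unit n (1\<^sub>m n)"
  by (rule mat_unitI[of _ _ "1\<^sub>m n"]) auto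

lemma mat_unit_mult:
  assumes "mat_unit n P" "mat_unit n Q"
  shows "mat_unit n (P * Q)"
proof -
  obtain P' Q' where PQ: "P \<in> carrier_mat n n" "P' \<in> carrier_mat n n" "P * P' = 1\<^sub>m n" "P' * P = 1\<^sub>m n"
    "Q \<in> carrier_mat n n" "Q' \<in> carrier_mat n n" "Q * Q' = 1\<^sub>m n" "Q' * Q = 1\<^sub>m n"
    using assms unfolding mat_unit_def by blast
  have cancel: "X * Y * (Y' * X') = 1\<^sub>m n"
    if "X \<in> carrier_mat n n" "Y \<in> carrier_mat n n" "Y' \<in> carrier_mat n n" "X' \<in> carrier_mat n n"
      "X * X' = 1\<^sub>m n" "Y * Y' = 1\<^sub>m n" for X Y Y' X' :: "int mat"
  proof -
    have "X * Y * (Y' * X') = X * (Y * (Y' * X'))"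
      by (rule assoc_mult_mat[of _ n n _ n _ n]) (use that in auto)
    also have "Y * (Y' * X') = (Y * Y') * X'"
      by (rule assoc_mult_mat[of _ n n _ n _ n, symmetric]) (use that in auto)
    finally show ?thesis using that by simp
  qed
  show ?thesis
    by (rule mat_unitI[of _ _ "Q' * P'"]) (use PQ cancel[of P Q Q' P'] cancel[of Q' P' P Q] in auto)
qed

lemma mat_unit_transpose:
  assumes "mat_unit n P"
  shows "mat_unit n (P\<^sup>T)"
proof -
  obtain P' where P: "P \<in> carrier_mat n n" "P' \<in> carrier_mat n n" "P * P' = 1\<^sub>m n" "P' * P = 1\<^sub>m n"
    using assms unfolding mat_unit_def by blast
  have "P\<^sup>T * P'\<^sup>T = 1\<^sub>m n" "P'\<^sup>T * P\<^sup>T = 1\<^sub>m n"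
    using P transpose_mult[OF P(1,2)] transpose_mult[OF P(2,1)] by (metis transpose_one)+
  then show ?thesis using P by (intro mat_unitI[of _ _ "P'\<^sup>T"]) auto
qed

section \<open>Equivalence of integer matrices and elementary operations\<close>

definition mat_equiv :: "nat \<Rightarrow> nat \<Rightarrow> int mat \<Rightarrow> int mat \<Rightarrow> bool" where
  "mat_equiv n m A B \<longleftrightarrow> A \<in> carrier_mat n m \<and>
     (\<exists>P Q. mat_unit n P \<and> mat_unit m Q \<and> B = P * A * Q)"

lemma mat_unit_carrier: "mat_unit n P \<Longrightarrow> P \<in> carrier_mat n n"
  unfolding mat_unit_def by blast

lemma mat_equiv_carrier:
  assumes "mat_equiv n m A B"
  shows "A \<in> carrier_mat n m" "B \<in> carrier_mat n m"
  using assms unfolding mat_equiv_def by (auto dest!: mat_unit_carrier)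

lemma mat_equiv_refl: "A \<in> carrier_mat n m \<Longrightarrow> mat_equiv n m A A"
  unfolding mat_equiv_def
  by (intro conjI exI[of _ "1\<^sub>m n"] exI[of _ "1\<^sub>m m"]) (auto simp: mat_unit_one)

lemma mat_equiv_trans [trans]:
  assumes "mat_equiv n m A B" "mat_equiv n m B C"
  shows "mat_equiv n m A C"
proof -
  obtain P Q P2 Q2 where h: "mat_unit n P" "mat_unit m Q" "B = P * A * Q"
    "mat_unit n P2" "mat_unit m Q2" "C = P2 * B * Q2" and A: "A \<in> carrier_mat n m"
    using assms unfolding mat_equiv_def by blast
  note c = h(1,2,4,5)[THEN mat_unit_carrier]
  have "C = (P2 * P) * A * (Q * Q2)"
    using c A unfolding h(3,6)
    by (simp add: assoc_mult_mat[of _ n n _ n _ m] assoc_mult_mat[of _ n n _ m _ m] assoc_mult_mat[of _ n m _ m _ m])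
  then show ?thesis using A mat_unit_mult h unfolding mat_equiv_def by blast
qed

lemma mat_equiv_transpose:
  assumes "mat_equiv n m A B"
  shows "mat_equiv m n (A\<^sup>T) (B\<^sup>T)"
proof -
  obtain P Q where h: "mat_unit n P" "mat_unit m Q" "B = P * A * Q" and A: "A \<in> carrier_mat n m"
    using assms unfolding mat_equiv_def by blast
  note c = h(1,2)[THEN mat_unit_carrier]
  have "B\<^sup>T = Q\<^sup>T * A\<^sup>T * P\<^sup>T"
    unfolding h(3) using c A
    by (simp add: transpose_mult[of _ n m _ m] transpose_mult[of _ n n _ m] assoc_mult_mat[of _ m m _ n _ n])
  then show ?thesis using A h mat_unit_transpose unfolding mat_equiv_def
    by (auto simp: transpose_carrier_mat)
qed

lemma mat_equiv_addrow:
  assumes A: "A \<in> carrier_mat n m" and kl: "k < n" "l < n" "k \<noteq> l"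
  shows "mat_equiv n m A (addrow a k l A)"
proof -
  have "mat_unit n (addrow_mat n a k l)"
    using addrow_mat_inv[OF kl, of a] addrow_mat_inv[OF kl, of "-a"]
    by (intro mat_unitI[of _ _ "addrow_mat n (-a) k l"]) auto
  then show ?thesis unfolding mat_equiv_def
    using A mat_unit_one addrow_mat[OF A kl(2), of a k]
    by (intro conjI exI[of _ "addrow_mat n a k l"] exI[of _ "1\<^sub>m m"]) auto
qed

lemma mat_equiv_swaprows:
  assumes A: "A \<in> carrier_mat n m" and kl: "k < n" "l < n"
  shows "mat_equiv n m A (swaprows k l A)"
proof -
  have "mat_unit n (swaprows_mat n k l)"
    using swaprows_mat_inv[OF kl] by (intro mat_unitI[of _ _ "swaprows_mat n k l"]) auto
  then show ?thesis unfolding mat_equiv_def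
    using A mat_unit_one swaprows_mat[OF A kl]
    by (intro conjI exI[of _ "swaprows_mat n k l"] exI[of _ "1\<^sub>m m"]) auto
qed

lemma mat_equiv_uminus:
  assumes A: "A \<in> carrier_mat n m"
  shows "mat_equiv n m A (- A)"
proof -
  have "mat_unit n (- 1\<^sub>m n)"
    by (intro mat_unitI[of _ _ "- 1\<^sub>m n"]) auto
  moreover have "- A = (- 1\<^sub>m n) * A * 1\<^sub>m m" using A by auto
  ultimately show ?thesis unfolding mat_equiv_def
    using A mat_unit_one by blast
qed

lemma mat_equiv_add_row:
  assumes A: "A \<in> carrier_mat n m" and kl: "k < n" "l < n" "k \<noteq> l"
  obtains B where "mat_equiv n m A B"
    "\<And>i j. i < n \<Longrightarrow> j < m \<Longrightarrow> B $$ (i,j) = (if i = k then a * A $$ (l,j) + A $$ (i,j) else A $$ (i,j))"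
  using mat_equiv_addrow[OF A kl, of a] that[of "addrow a k l A"] A by auto

lemma mat_equiv_add_col:
  assumes A: "A \<in> carrier_mat n m" and kl: "k < m" "l < m" "k \<noteq> l"
  obtains B where "mat_equiv n m A B"
    "\<And>i j. i < n \<Longrightarrow> j < m \<Longrightarrow> B $$ (i,j) = (if j = k then a * A $$ (i,l) + A $$ (i,j) else A $$ (i,j))"
proof -
  have "A\<^sup>T \<in> carrier_mat m n" using A by simp
  from mat_equiv_add_row[OF this kl, of a] obtain B where B: "mat_equiv m n (A\<^sup>T) B"
    "\<And>i j. i < m \<Longrightarrow> j < n \<Longrightarrow> B $$ (i,j) = (if i = k then a * A\<^sup>T $$ (l,j) + A\<^sup>T $$ (i,j) else A\<^sup>T $$ (i,j))"
    by blast
  have "mat_equiv n m A (B\<^sup>T)" using mat_equiv_transpose[OF B(1)] by simp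
  then show thesis
    using B(2) A kl mat_equiv_carrier[OF B(1)] by (intro that[of "B\<^sup>T"]) auto
qed

lemma mat_equiv_move_to_corner:
  assumes A: "A \<in> carrier_mat n m" and ij: "i < n" "j < m"
  obtains B where "mat_equiv n m A B" "B $$ (0,0) = A $$ (i,j)"
proof -
  define B where "B = swaprows 0 i A"
  have B: "mat_equiv n m A B" unfolding B_def using A ij by (intro mat_equiv_swaprows) auto
  have BT: "B\<^sup>T \<in> carrier_mat m n" using mat_equiv_carrier(2)[OF B] by simp
  define C where "C = (swaprows 0 j (B\<^sup>T))\<^sup>T"
  have "mat_equiv m n (B\<^sup>T) (swaprows 0 j (B\<^sup>T))"
    using BT ij by (intro mat_equiv_swaprows) auto
  from mat_equiv_transpose[OF this] have "mat_equiv n m B C" unfolding C_def by simp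
  moreover have "C $$ (0,0) = A $$ (i,j)"
    using A ij unfolding C_def B_def by simp
  ultimately show thesis using that B mat_equiv_trans by blast
qed

text \<open>Among all entries of all matrices equivalent to \<open>M\<close>, take a nonzero one of
  least absolute value \<open>d\<close>. A nonzero remainder modulo \<open>d\<close> in its row or
  column would be a smaller entry, so \<open>d\<close> divides these and they can be
  cleared.\<close>

lemma exists_pivot:
  assumes M: "M \<in> carrier_mat n m" and nz: "M \<noteq> 0\<^sub>m n m"
  obtains d B where "mat_equiv n m M B" "d > 0" "B $$ (0,0) = d"
    "\<And>i. 0 < i \<Longrightarrow> i < n \<Longrightarrow> B $$ (i,0) = 0" "\<And>j. 0 < j \<Longrightarrow> j < m \<Longrightarrow> B $$ (0,j) = 0"
    "\<And>i j. i < n \<Longrightarrow> j < m \<Longrightarrow> d dvd B $$ (i,j)"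
proof -
  define S where "S = {k. \<exists>B i j. mat_equiv n m M B \<and> i < n \<and> j < m \<and> B $$ (i,j) \<noteq> 0 \<and> k = nat \<bar>B $$ (i,j)\<bar>}"
  define k where "k = (LEAST k. k \<in> S)"
  obtain i0 j0 where ij0: "i0 < n" "j0 < m" "M $$ (i0,j0) \<noteq> 0"
    using M nz by (auto simp: mat_eq_iff)
  then have "nat \<bar>M $$ (i0,j0)\<bar> \<in> S" unfolding S_def using mat_equiv_refl[OF M] by blast
  then have kS: "k \<in> S" unfolding k_def by (rule LeastI)
  have n0: "0 < n" "0 < m" using ij0 by auto
  define d where "d = int k"
  have least: "d \<le> \<bar>B $$ (i,j)\<bar>" if "mat_equiv n m M B" "i < n" "j < m" "B $$ (i,j) \<noteq> 0" for B i j
  proof -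
    have "nat \<bar>B $$ (i,j)\<bar> \<in> S" unfolding S_def using that by blast
    then have "k \<le> nat \<bar>B $$ (i,j)\<bar>" unfolding k_def by (rule Least_le)
    then show ?thesis unfolding d_def by simp
  qed
  obtain B1 i1 j1 where B1: "mat_equiv n m M B1" "i1 < n" "j1 < m" "B1 $$ (i1,j1) \<noteq> 0"
    "k = nat \<bar>B1 $$ (i1,j1)\<bar>" using kS unfolding S_def by blast
  have dpos: "d > 0" using B1 unfolding d_def by simp
  obtain B2 where B2: "mat_equiv n m B1 B2" "B2 $$ (0,0) = B1 $$ (i1,j1)"
    using mat_equiv_move_to_corner[OF mat_equiv_carrier(2)[OF B1(1)] B1(2,3)] by blast
  obtain B3 where B3: "mat_equiv n m M B3" "B3 $$ (0,0) = d"
  proof (cases "B1 $$ (i1,j1) > 0")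
    case True
    show thesis
      by (rule that[OF mat_equiv_trans[OF B1(1) B2(1)]]) (use True B1(5) B2(2) in \<open>simp add: d_def\<close>)
  next
    case False
    have c: "B2 \<in> carrier_mat n m" by (rule mat_equiv_carrier(2)[OF B2(1)])
    have "mat_equiv n m M (- B2)"
      by (rule mat_equiv_trans[OF mat_equiv_trans[OF B1(1) B2(1)] mat_equiv_uminus[OF c]])
    moreover have "(- B2) $$ (0,0) = d" using c n0 False B1(4,5) B2(2) unfolding d_def by simp
    ultimately show thesis by (rule that)
  qed
  have col0: "d dvd B $$ (i,0)" if B: "mat_equiv n m M B" "B $$ (0,0) = d" "i < n" for B i
  proof (cases "i = 0")
    case False
    obtain C where C: "mat_equiv n m B C"
      "\<And>a b. a < n \<Longrightarrow> b < m \<Longrightarrow> C $$ (a,b) = (if a = i then (- (B $$ (i,0) div d)) * B $$ (0,b) + B $$ (a,b) else B $$ (a,b))"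
      using mat_equiv_add_row[OF mat_equiv_carrier(2)[OF B(1)] \<open>i < n\<close> n0(1) False] by blast
    have "C $$ (i,0) = B $$ (i,0) mod d"
      using C(2)[OF \<open>i < n\<close> n0(2)] B minus_div_mult_eq_mod[of "B $$ (i,0)" d] by simp
    then show ?thesis
      using least[OF mat_equiv_trans[OF B(1) C(1)] \<open>i < n\<close> n0(2)] dpos pos_mod_bound[OF dpos, of "B $$ (i,0)"] pos_mod_sign[OF dpos, of "B $$ (i,0)"]
      by (auto simp: dvd_eq_mod_eq_0)
  qed (use B in simp)
  have row0: "d dvd B $$ (0,j)" if B: "mat_equiv n m M B" "B $$ (0,0) = d" "j < m" for B j
  proof (cases "j = 0")
    case False
    obtain C where C: "mat_equiv n m B C"
      "\<And>a b. a < n \<Longrightarrow> b < m \<Longrightarrow> C $$ (a,b) = (if b = j then (- (B $$ (0,j) div d)) * B $$ (a,0) + B $$ (a,b) else B $$ (a,b))"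
      using mat_equiv_add_col[OF mat_equiv_carrier(2)[OF B(1)] \<open>j < m\<close> n0(2) False] by blast
    have "C $$ (0,j) = B $$ (0,j) mod d"
      using C(2)[OF n0(1) \<open>j < m\<close>] B minus_div_mult_eq_mod[of "B $$ (0,j)" d] by simp
    then show ?thesis
      using least[OF mat_equiv_trans[OF B(1) C(1)] n0(1) \<open>j < m\<close>] dpos pos_mod_bound[OF dpos, of "B $$ (0,j)"] pos_mod_sign[OF dpos, of "B $$ (0,j)"]
      by (auto simp: dvd_eq_mod_eq_0)
  qed (use B in simp)
  have "\<exists>B. mat_equiv n m M B \<and> B $$ (0,0) = d \<and> (\<forall>i. 0 < i \<and> i < t \<longrightarrow> B $$ (i,0) = 0)" if "t \<le> n" for t
    using that
  proof (induction t)
    case (Suc t)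
    then obtain B where B: "mat_equiv n m M B" "B $$ (0,0) = d" "\<And>i. 0 < i \<Longrightarrow> i < t \<Longrightarrow> B $$ (i,0) = 0" by auto
    show ?case
    proof (cases "t = 0")
      case False
      then have t: "t < n" "t \<noteq> 0" using Suc by auto
      obtain c where c: "B $$ (t,0) = d * c" using col0[OF B(1,2) t(1)] by blast
      obtain C where C: "mat_equiv n m B C"
        "\<And>a b. a < n \<Longrightarrow> b < m \<Longrightarrow> C $$ (a,b) = (if a = t then (- c) * B $$ (0,b) + B $$ (a,b) else B $$ (a,b))"
        using mat_equiv_add_row[OF mat_equiv_carrier(2)[OF B(1)] t(1) n0(1) t(2)] by blast
      show ?thesis
        using C(2) n0 t B c mat_equiv_trans[OF B(1) C(1)] by (intro exI[of _ C]) (auto simp: less_Suc_eq)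
    qed (use B in auto)
  qed (use B3 in auto)
  from this[of n] obtain B4 where B4: "mat_equiv n m M B4" "B4 $$ (0,0) = d"
    "\<And>i. 0 < i \<Longrightarrow> i < n \<Longrightarrow> B4 $$ (i,0) = 0" by auto
  \<comment> \<open>Column 0 is already zero below the corner, so subtracting multiples of it from
    other columns changes row 0 only.\<close>
  have "\<exists>B. mat_equiv n m M B \<and> B $$ (0,0) = d \<and> (\<forall>i. 0 < i \<and> i < n \<longrightarrow> B $$ (i,0) = 0) \<and>
    (\<forall>j. 0 < j \<and> j < t \<longrightarrow> B $$ (0,j) = 0)" if "t \<le> m" for t
    using that
  proof (induction t)
    case (Suc t)
    then obtain B where B: "mat_equiv n m M B" "B $$ (0,0) = d" "\<And>i. 0 < i \<Longrightarrow> i < n \<Longrightarrow> B $$ (i,0) = 0"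
      "\<And>j. 0 < j \<Longrightarrow> j < t \<Longrightarrow> B $$ (0,j) = 0" by auto
    show ?case
    proof (cases "t = 0")
      case False
      then have t: "t < m" "t \<noteq> 0" using Suc by auto
      obtain c where c: "B $$ (0,t) = d * c" using row0[OF B(1,2) t(1)] by blast
      obtain C where C: "mat_equiv n m B C"
        "\<And>a b. a < n \<Longrightarrow> b < m \<Longrightarrow> C $$ (a,b) = (if b = t then (- c) * B $$ (a,0) + B $$ (a,b) else B $$ (a,b))"
        using mat_equiv_add_col[OF mat_equiv_carrier(2)[OF B(1)] t(1) n0(2) t(2)] by blast
      show ?thesis
        using C(2) n0 t B c mat_equiv_trans[OF B(1) C(1)] by (intro exI[of _ C]) (auto simp: less_Suc_eq)
    qed (use B in auto)
  qed (use B4 in auto)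
  from this[of m] obtain B where B: "mat_equiv n m M B" "B $$ (0,0) = d"
    "\<And>i. 0 < i \<Longrightarrow> i < n \<Longrightarrow> B $$ (i,0) = 0" "\<And>j. 0 < j \<Longrightarrow> j < m \<Longrightarrow> B $$ (0,j) = 0" by auto
  \<comment> \<open>Adding row \<open>i\<close> to row 0 brings its entries into the pivot row
    without changing the corner, since column 0 is clear; minimality then applies there.\<close>
  have "d dvd B $$ (i,j)" if ij: "i < n" "j < m" for i j
  proof (cases "i = 0")
    case True
    then show ?thesis using row0[OF B(1,2) ij(2)] by simp
  next
    case False
    obtain C where C: "mat_equiv n m B C"
      "\<And>a b. a < n \<Longrightarrow> b < m \<Longrightarrow> C $$ (a,b) = (if a = 0 then 1 * B $$ (i,b) + B $$ (a,b) else B $$ (a,b))"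
      using mat_equiv_add_row[OF mat_equiv_carrier(2)[OF B(1)] n0(1) ij(1) False[symmetric]] by blast
    have "C $$ (0,0) = d" using C(2)[OF n0] B(2) B(3)[of i] False ij by simp
    from row0[OF mat_equiv_trans[OF B(1) C(1)] this ij(2)] show ?thesis
      using C(2)[OF n0(1) ij(2)] B(2) B(4)[of j] col0[OF B(1,2) ij(1)] ij by (cases "j = 0") auto
  qed
  from that[OF B(1) dpos B(2-4) this] show thesis .
qed

text \<open>Entries of \<open>B\<close> are integer combinations of those of \<open>A\<close>. Hence
  a pivot dividing a block also divides any Smith form of that block.\<close>

lemma mat_equiv_dvd:
  assumes "mat_equiv n m A B" "\<And>i j. i < n \<Longrightarrow> j < m \<Longrightarrow> d dvd A $$ (i,j)" "i < n" "j < m"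
  shows "d dvd B $$ (i,j)"
proof -
  obtain P Q where h: "mat_unit n P" "mat_unit m Q" "B = P * A * Q" and A: "A \<in> carrier_mat n m"
    using assms unfolding mat_equiv_def by blast
  note c = h(1,2)[THEN mat_unit_carrier]
  have 1: "d dvd (P * A) $$ (i,j)" if "i < n" "j < m" for i j
    using that c A assms(2) by (auto simp: scalar_prod_def intro!: dvd_sum dvd_mult)
  have "B $$ (i,j) = (\<Sum>k = 0..<m. (P * A) $$ (i,k) * Q $$ (k,j))"
    unfolding h(3) using c A assms(3,4)
    by (subst index_mult_mat) (auto simp: scalar_prod_def intro!: sum.cong)
  also have "d dvd \<dots>" using 1 assms by (auto intro!: dvd_sum dvd_mult2)
  finally show ?thesis .
qed

lemma mat_equiv_four_block:
  assumes N: "mat_equiv n m N N'"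
  shows "mat_equiv (1 + n) (1 + m) (four_block_mat (mat 1 1 (\<lambda>_. d)) (0\<^sub>m 1 m) (0\<^sub>m n 1) N)
     (four_block_mat (mat 1 1 (\<lambda>_. d)) (0\<^sub>m 1 m) (0\<^sub>m n 1) N')"
proof -
  obtain P Q where h: "mat_unit n P" "mat_unit m Q" "N' = P * N * Q" and A: "N \<in> carrier_mat n m"
    using assms unfolding mat_equiv_def by blast
  note c = h(1,2)[THEN mat_unit_carrier]
  have blk: "mat_unit (1 + k) (four_block_mat (1\<^sub>m 1) (0\<^sub>m 1 k) (0\<^sub>m k 1) X)" if "mat_unit k X" for k X
  proof -
    obtain Y where Y: "X \<in> carrier_mat k k" "Y \<in> carrier_mat k k" "X * Y = 1\<^sub>m k" "Y * X = 1\<^sub>m k"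
      using \<open>mat_unit k X\<close> unfolding mat_unit_def by blast
    let ?B = "\<lambda>Z. four_block_mat (1\<^sub>m 1) (0\<^sub>m 1 k) (0\<^sub>m k 1) Z :: int mat"
    have mult: "?B Z * ?B Z' = ?B (Z * Z')" if "Z \<in> carrier_mat k k" "Z' \<in> carrier_mat k k" for Z Z'
      using that by (subst mult_four_block_mat[of _ 1 1 _ k _ k _ _ 1 _ k]) auto
    have one: "?B (1\<^sub>m k) = 1\<^sub>m (1 + k)" by (rule four_block_one_mat)
    show ?thesis
      by (rule mat_unitI[of _ _ "?B Y"]) (use Y in \<open>simp_all only: mult one four_block_carrier_mat one_carrier_mat\<close>)
  qed
  let ?D = "mat 1 1 (\<lambda>_. d)"
  let ?L = "four_block_mat (1\<^sub>m 1) (0\<^sub>m 1 n) (0\<^sub>m n 1) P"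
  let ?M = "\<lambda>X. four_block_mat ?D (0\<^sub>m 1 m) (0\<^sub>m n 1) X"
  let ?R = "four_block_mat (1\<^sub>m 1) (0\<^sub>m 1 m) (0\<^sub>m m 1) Q"
  have "?L * ?M N = ?M (P * N)"
    using c A by (subst mult_four_block_mat[of _ 1 1 _ n _ n _ _ 1 _ m]) auto
  moreover have "?M (P * N) * ?R = ?M (P * N * Q)"
    using c A by (subst mult_four_block_mat[of _ 1 1 _ m _ n _ _ 1 _ m]) auto
  ultimately have "?M N' = ?L * ?M N * ?R" using h(3) by simp
  then show ?thesis unfolding mat_equiv_def using blk[OF h(1)] blk[OF h(2)] A by auto
qed

text \<open>Induction on the columns. The pivot split off divides the whole remaining block, hence
  the first diagonal entry of its Smith form, which is the missing link of the chain. The bound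
  \<open>m \<le> n\<close> passes to the block and keeps a row available for each column.\<close>

lemma smith_form_exists:
  assumes "M \<in> carrier_mat n m" "m \<le> n"
  shows "\<exists>D \<in> smith_mats n m. mat_equiv n m M D"
  using assms
proof (induction m arbitrary: n M)
  case 0
  then show ?case
    using mat_equiv_refl[OF 0(1)] unfolding smith_mats_def diagonal_mat_def by auto
next
  case (Suc m)
  show ?case
  proof (cases "M = 0\<^sub>m n (Suc m)")
    case True
    then show ?thesis
      using mat_equiv_refl[OF Suc.prems(1)] Suc.prems unfolding smith_mats_def diagonal_mat_def
      by (intro bexI[of _ M]) auto
  next
    case False
    obtain n' where n: "n = Suc n'" using Suc.prems by (cases n) auto
    obtain d B where B: "mat_equiv n (Suc m) M B" "d > 0" "B $$ (0,0) = d"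
      "\<And>i. 0 < i \<Longrightarrow> i < n \<Longrightarrow> B $$ (i,0) = 0" "\<And>j. 0 < j \<Longrightarrow> j < Suc m \<Longrightarrow> B $$ (0,j) = 0"
      "\<And>i j. i < n \<Longrightarrow> j < Suc m \<Longrightarrow> d dvd B $$ (i,j)"
      by (rule exists_pivot[OF Suc.prems(1) False]) (rule that)
    define N where "N = mat n' m (\<lambda>(i,j). B $$ (Suc i, Suc j))"
    have N: "N \<in> carrier_mat n' m" unfolding N_def by simp
    obtain D' where D': "D' \<in> smith_mats n' m" "mat_equiv n' m N D'"
      using Suc.IH[OF N] Suc.prems n by auto
    define D where "D = four_block_mat (mat 1 1 (\<lambda>_. d)) (0\<^sub>m 1 m) (0\<^sub>m n' 1) D'"
    have Beq: "B = four_block_mat (mat 1 1 (\<lambda>_. d)) (0\<^sub>m 1 m) (0\<^sub>m n' 1) N"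
      using mat_equiv_carrier(2)[OF B(1)] B(3-5) unfolding N_def n
      by (intro eq_matI) auto
    have "mat_equiv n (Suc m) B D"
      using mat_equiv_four_block[OF D'(2), of d] unfolding Beq D_def n by simp
    then have MD: "mat_equiv n (Suc m) M D" using B(1) mat_equiv_trans by blast
    have c: "D' \<in> carrier_mat n' m" using D'(1) unfolding smith_mats_def by blast
    have ddvd: "d dvd D' $$ (i,j)" if "i < n'" "j < m" for i j
      by (rule mat_equiv_dvd[OF D'(2) _ that]) (use B(6) n in \<open>auto simp: N_def\<close>)
    have Dii: "D $$ (i,j) = (if i = 0 then if j = 0 then d else 0 else if j = 0 then 0 else D' $$ (i - 1, j - 1))"
      if "i < n" "j < Suc m" for i j
      using that c unfolding D_def n by (auto)
    have "D \<in> smith_mats n (Suc m)"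
      unfolding smith_mats_def
    proof (intro CollectI conjI allI impI)
      show "D \<in> carrier_mat n (Suc m)" using MD mat_equiv_carrier by blast
      then show "diagonal_mat D"
        using D'(1) c n unfolding diagonal_mat_def smith_mats_def by (auto simp: Dii)
    next
      fix i assume "i < Suc m"
      then show "0 \<le> D $$ (i,i)"
        using Dii[of i i] Suc.prems D'(1) B(2) unfolding smith_mats_def by (cases i) auto
    next
      fix i assume i: "Suc i < Suc m"
      then have "d dvd D' $$ (i,i)" using ddvd Suc.prems n by simp
      then show "D $$ (i,i) dvd D $$ (Suc i, Suc i)"
        using Dii[of i i] Dii[of "Suc i" "Suc i"] i Suc.prems D'(1) unfolding smith_mats_def
        by (cases i) auto
    qed
    then show ?thesis using MD by blast
  qed
qed

lemma is_SNF_iff: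
  assumes "M \<in> carrier_mat n m"
  shows "is_SNF n m M D \<longleftrightarrow> D \<in> smith_mats n m \<and> mat_equiv n m M D"
  using assms unfolding is_SNF_def mat_equiv_def mat_unit_iff_invertible_mat by blast

section \<open>Kernel counts\<close>

text \<open>The value 0 outside \<open>A\<close> makes functions equal once they agree on
  \<open>A\<close>, and it is the default used by the \<open>Pi_pmf\<close> in
  \<open>random_mat\<close>.\<close>

abbreviation funs :: "'a set \<Rightarrow> int set \<Rightarrow> ('a \<Rightarrow> int) set" where
  "funs A V \<equiv> PiE_dflt A 0 (\<lambda>_. V)"

definition res_vecs :: "nat \<Rightarrow> nat set \<Rightarrow> (nat \<Rightarrow> int) set" where
  "res_vecs q J = funs J {0..<int q}"

text \<open>The unknowns are always residues modulo \<open>q\<close>, the congruences are modulo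
  \<open>k\<close>. For \<open>k\<close> dividing \<open>q\<close> and finite \<open>J\<close> this
  is the size of the kernel modulo \<open>k\<close> times \<open>(q / k) ^ card J\<close>, so the
  counts for different powers of \<open>p\<close> live on one space. Index sets instead of
  dimensions let elimination delete an arbitrary row and column.\<close>

definition kcount :: "nat \<Rightarrow> nat \<Rightarrow> nat set \<Rightarrow> nat set \<Rightarrow> (nat \<Rightarrow> nat \<Rightarrow> int) \<Rightarrow> nat" where
  "kcount q k I J M = card {x \<in> res_vecs q J. \<forall>a\<in>I. int k dvd (\<Sum>b\<in>J. M a b * x b)}"

lemma finite_res_vecs: "finite J \<Longrightarrow> finite (res_vecs q J)"
  unfolding res_vecs_def by (intro finite_PiE_dflt) auto

lemma kcount_pos: "finite J \<Longrightarrow> 0 < q \<Longrightarrow> 0 < kcount q k I J M"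
proof -
  assume J: "finite J" and q: "0 < q"
  have "(\<lambda>_. 0) \<in> {x \<in> res_vecs q J. \<forall>a\<in>I. int k dvd (\<Sum>b\<in>J. M a b * x b)}"
    using q by (auto simp: res_vecs_def PiE_dflt_def)
  then show ?thesis unfolding kcount_def using finite_res_vecs[OF J] by (subst card_gt_0_iff) auto
qed

lemma kcount_cong:
  assumes "\<And>a b. a \<in> I \<Longrightarrow> b \<in> J \<Longrightarrow> [M a b = N a b] (mod int k)"
  shows "kcount q k I J M = kcount q k I J N"
proof -
  have "int k dvd (\<Sum>b\<in>J. M a b * x b) \<longleftrightarrow> int k dvd (\<Sum>b\<in>J. N a b * x b)" if "a \<in> I" for a x
    by (rule cong_dvd_iff, intro cong_sum cong_mult) (use assms that in auto)
  then have "{x \<in> res_vecs q J. \<forall>a\<in>I. int k dvd (\<Sum>b\<in>J. M a b * x b)} =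
      {x \<in> res_vecs q J. \<forall>a\<in>I. int k dvd (\<Sum>b\<in>J. N a b * x b)}" by blast
  then show ?thesis unfolding kcount_def by simp
qed

lemma sum_mat_assoc:
  fixes A :: "nat \<Rightarrow> int"
  shows "(\<Sum>b\<in>J. (\<Sum>c\<in>I. A c * B c b) * x b) = (\<Sum>c\<in>I. A c * (\<Sum>b\<in>J. B c b * x b))"
  unfolding sum_distrib_left sum_distrib_right
  by (subst sum.swap) (simp add: mult.assoc)

lemma sum_delta_cong:
  fixes x :: "nat \<Rightarrow> int"
  assumes "finite J" "j \<in> J" "\<And>b. b \<in> J \<Longrightarrow> [A b = (if j = b then 1 else 0)] (mod q)"
  shows "[(\<Sum>b\<in>J. A b * x b) = x j] (mod q)"
proof -
  have "[(\<Sum>b\<in>J. A b * x b) = (\<Sum>b\<in>J. (if j = b then 1 else 0) * x b)] (mod q)"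
    by (intro cong_sum cong_mult) (use assms in auto)
  also have "(\<Sum>b\<in>J. (if j = b then 1 else 0) * x b) = (\<Sum>b\<in>J. if j = b then x b else 0)"
    by (intro sum.cong) auto
  also have "\<dots> = x j"
    using assms by (simp add: sum.delta')
  finally show ?thesis .
qed

text \<open>The map sending \<open>x\<close> to \<open>Q x\<close>, reduced modulo \<open>q\<close>,
  injects the kernel of \<open>E = P M Q\<close> into that of \<open>M\<close>: \<open>Q'\<close>
  recovers \<open>x\<close>, and \<open>P'\<close> removes \<open>P\<close> from the congruences.
  Since \<open>k\<close> divides \<open>q\<close>, inverses modulo \<open>q\<close> also work modulo
  \<open>k\<close>.\<close>

lemma kcount_le:
  assumes fin: "finite I" "finite J" and kq: "k dvd q" "0 < q"
    and E: "\<And>a b. a \<in> I \<Longrightarrow> b \<in> J \<Longrightarrow>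
       [E a b = (\<Sum>c\<in>I. P a c * (\<Sum>d\<in>J. M c d * Q d b))] (mod int q)"
    and P: "\<And>a b. a \<in> I \<Longrightarrow> b \<in> I \<Longrightarrow> [(\<Sum>c\<in>I. P' a c * P c b) = (if a = b then 1 else 0)] (mod int q)"
    and Q: "\<And>a b. a \<in> J \<Longrightarrow> b \<in> J \<Longrightarrow> [(\<Sum>c\<in>J. Q' a c * Q c b) = (if a = b then 1 else 0)] (mod int q)"
  shows "kcount q k I J E \<le> kcount q k I J M"
proof -
  define f where "f x = (\<lambda>d. if d \<in> J then (\<Sum>b\<in>J. Q d b * x b) mod int q else 0)" for x :: "nat \<Rightarrow> int"
  have kd: "int k dvd int q" using kq by simp
  have "inj_on f {x \<in> res_vecs q J. \<forall>a\<in>I. int k dvd (\<Sum>b\<in>J. E a b * x b)}"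
  proof (rule inj_onI, elim CollectE conjE)
    fix x y assume x: "x \<in> res_vecs q J" and y: "y \<in> res_vecs q J" and fxy: "f x = f y"
    have c: "[(\<Sum>b\<in>J. Q d b * x b) = (\<Sum>b\<in>J. Q d b * y b)] (mod int q)" if "d \<in> J" for d
      using fun_cong[OF fxy, of d] that unfolding f_def cong_def by simp
    have inv: "[(\<Sum>d\<in>J. Q' a d * (\<Sum>b\<in>J. Q d b * z b)) = z a] (mod int q)" if "a \<in> J" for a z
      unfolding sum_mat_assoc[symmetric] by (rule sum_delta_cong) (use that fin Q in auto)
    show "x = y"
    proof
      fix a
      show "x a = y a"
      proof (cases "a \<in> J")
        case True
        have "[x a = y a] (mod int q)"
          using inv[OF True, of x] inv[OF True, of y]
            cong_sum[of J "\<lambda>d. Q' a d * (\<Sum>b\<in>J. Q d b * x b)" "\<lambda>d. Q' a d * (\<Sum>b\<in>J. Q d b * y b)" "int q"] c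
          by (meson cong_mult cong_refl cong_sym cong_trans)
        moreover have "x a \<in> {0..<int q}" "y a \<in> {0..<int q}"
          using x y True unfolding res_vecs_def PiE_dflt_def by auto
        ultimately show ?thesis unfolding cong_def by simp
      next
        case False
        then show ?thesis using x y unfolding res_vecs_def PiE_dflt_def by auto
      qed
    qed
  qed
  moreover have "f ` {x \<in> res_vecs q J. \<forall>a\<in>I. int k dvd (\<Sum>b\<in>J. E a b * x b)} \<subseteq>
     {x \<in> res_vecs q J. \<forall>a\<in>I. int k dvd (\<Sum>b\<in>J. M a b * x b)}"
  proof (rule image_subsetI, elim CollectE conjE, intro CollectI conjI ballI)
    fix x assume x: "x \<in> res_vecs q J" and dv: "\<forall>a\<in>I. int k dvd (\<Sum>b\<in>J. E a b * x b)"
    show "f x \<in> res_vecs q J" using kq unfolding f_def res_vecs_def PiE_dflt_def by auto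
    fix a assume a: "a \<in> I"
    define y where "y c = (\<Sum>d\<in>J. M c d * (\<Sum>b\<in>J. Q d b * x b))" for c
    have Ex: "[(\<Sum>b\<in>J. E c b * x b) = (\<Sum>c'\<in>I. P c c' * y c')] (mod int k)" if c: "c \<in> I" for c
    proof -
      have "[(\<Sum>b\<in>J. E c b * x b) = (\<Sum>b\<in>J. (\<Sum>c'\<in>I. P c c' * (\<Sum>d\<in>J. M c' d * Q d b)) * x b)] (mod int k)"
        by (intro cong_sum cong_mult cong_dvd_modulus[OF E kd]) (use c in auto)
      also have "(\<Sum>b\<in>J. (\<Sum>c'\<in>I. P c c' * (\<Sum>d\<in>J. M c' d * Q d b)) * x b) = (\<Sum>c'\<in>I. P c c' * y c')"
        unfolding y_def sum_mat_assoc by (rule refl)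
      finally show ?thesis .
    qed
    have "[(\<Sum>c\<in>I. P' a c * (\<Sum>c'\<in>I. P c c' * y c')) = y a] (mod int q)"
      unfolding sum_mat_assoc[symmetric] by (rule sum_delta_cong) (use a fin P in auto)
    then have "[(\<Sum>c\<in>I. P' a c * (\<Sum>c'\<in>I. P c c' * y c')) = y a] (mod int k)"
      using kd cong_dvd_modulus by blast
    moreover have "int k dvd (\<Sum>c\<in>I. P' a c * (\<Sum>c'\<in>I. P c c' * y c'))"
    proof (rule dvd_sum, rule dvd_mult)
      fix c assume c: "c \<in> I"
      show "int k dvd (\<Sum>c'\<in>I. P c c' * y c')" using cong_dvd_iff[OF Ex[OF c]] dv c by blast
    qed
    ultimately have "int k dvd y a" using cong_dvd_iff by blast
    moreover have "[(\<Sum>b\<in>J. M a b * f x b) = y a] (mod int k)"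
      unfolding y_def
    proof (intro cong_sum cong_mult cong_refl)
      fix d assume "d \<in> J"
      then have "[f x d = (\<Sum>b\<in>J. Q d b * x b)] (mod int q)" unfolding f_def cong_def by simp
      then show "[f x d = (\<Sum>b\<in>J. Q d b * x b)] (mod int k)" using kd cong_dvd_modulus by blast
    qed
    ultimately show "int k dvd (\<Sum>b\<in>J. M a b * f x b)" using cong_dvd_iff by blast
  qed
  ultimately show ?thesis
    unfolding kcount_def using finite_res_vecs[OF fin(2)] by (intro card_inj_on_le[of f]) auto
qed

lemma mat_cong_mult:
  assumes "mat_cong q A A'" "mat_cong q B B'" "A \<in> carrier_mat a b" "B \<in> carrier_mat b c"
  shows "mat_cong q (A * B) (A' * B')"
  using assms unfolding mat_cong_def
  by (auto simp: scalar_prod_def intro!: cong_sum cong_mult)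

lemma mat_cong_refl: "mat_cong q A A"
  unfolding mat_cong_def by simp

lemma mat_cong_sym: "mat_cong q A B \<Longrightarrow> mat_cong q B A"
  unfolding mat_cong_def by (auto intro: cong_sym)

lemma mat_cong_trans: "mat_cong q A B \<Longrightarrow> mat_cong q B C \<Longrightarrow> mat_cong q A C"
  unfolding mat_cong_def by (metis cong_trans)

lemma mat_cong_carrier: "mat_cong q A B \<Longrightarrow> A \<in> carrier_mat n m \<longleftrightarrow> B \<in> carrier_mat n m"
  unfolding mat_cong_def carrier_mat_def by auto

lemma kcount_mat_le:
  assumes M: "M \<in> carrier_mat n m" and kq: "k dvd q" "0 < q"
    and P: "P \<in> carrier_mat n n" "P' \<in> carrier_mat n n" "mat_cong q (P' * P) (1\<^sub>m n)"
    and Q: "Q \<in> carrier_mat m m" "Q' \<in> carrier_mat m m" "mat_cong q (Q' * Q) (1\<^sub>m m)"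
    and E: "mat_cong q E (P * M * Q)"
  shows "kcount q k {..<n} {..<m} (\<lambda>a b. E $$ (a,b)) \<le> kcount q k {..<n} {..<m} (\<lambda>a b. M $$ (a,b))"
proof (rule kcount_le[where P = "\<lambda>a b. P $$ (a,b)" and Q = "\<lambda>a b. Q $$ (a,b)"
      and P' = "\<lambda>a b. P' $$ (a,b)" and Q' = "\<lambda>a b. Q' $$ (a,b)"])
  fix a b assume ab: "a \<in> {..<n}" "b \<in> {..<m}"
  have "(P * M * Q) = P * (M * Q)" using P M Q by simp
  also have "\<dots> $$ (a,b) = (\<Sum>c\<in>{..<n}. P $$ (a,c) * (M * Q) $$ (c,b))"
    using ab P M Q by (subst index_mult_mat) (auto simp: scalar_prod_def atLeast0LessThan)
  also have "\<dots> = (\<Sum>c\<in>{..<n}. P $$ (a,c) * (\<Sum>d\<in>{..<m}. M $$ (c,d) * Q $$ (d,b)))"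
    using ab P M Q by (intro sum.cong) (auto simp: scalar_prod_def atLeast0LessThan)
  finally have *: "(P * M * Q) $$ (a,b) = (\<Sum>c\<in>{..<n}. P $$ (a,c) * (\<Sum>d\<in>{..<m}. M $$ (c,d) * Q $$ (d,b)))" .
  have "E \<in> carrier_mat n m" using mat_cong_carrier[OF E] P M Q by auto
  then show "[E $$ (a,b) = (\<Sum>c\<in>{..<n}. P $$ (a,c) * (\<Sum>d\<in>{..<m}. M $$ (c,d) * Q $$ (d,b)))] (mod int q)"
    unfolding *[symmetric] using E ab unfolding mat_cong_def by auto
next
  fix a b assume "a \<in> {..<n}" "b \<in> {..<n}"
  then show "[(\<Sum>c\<in>{..<n}. P' $$ (a,c) * P $$ (c,b)) = (if a = b then 1 else 0)] (mod int q)"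
    using P unfolding mat_cong_def by (auto simp: scalar_prod_def atLeast0LessThan)
next
  fix a b assume "a \<in> {..<m}" "b \<in> {..<m}"
  then show "[(\<Sum>c\<in>{..<m}. Q' $$ (a,c) * Q $$ (c,b)) = (if a = b then 1 else 0)] (mod int q)"
    using Q unfolding mat_cong_def by (auto simp: scalar_prod_def atLeast0LessThan)
qed (use kq in auto)

text \<open>\<open>M\<close> is congruent to \<open>P' E Q'\<close>, so the inequality applies in
  both directions, with the matrices and their inverses exchanged.\<close>

lemma kcount_mat_eq:
  assumes M: "M \<in> carrier_mat n m" and kq: "k dvd q" "0 < q"
    and P: "invertible_mod q n P" and Q: "invertible_mod q m Q"
    and E: "mat_cong q E (P * M * Q)"
  shows "kcount q k {..<n} {..<m} (\<lambda>a b. E $$ (a,b)) = kcount q k {..<n} {..<m} (\<lambda>a b. M $$ (a,b))"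
proof -
  obtain P' where P': "P \<in> carrier_mat n n" "P' \<in> carrier_mat n n" "mat_cong q (P' * P) (1\<^sub>m n)" "mat_cong q (P * P') (1\<^sub>m n)"
    using P unfolding invertible_mod_def by blast
  obtain Q' where Q': "Q \<in> carrier_mat m m" "Q' \<in> carrier_mat m m" "mat_cong q (Q' * Q) (1\<^sub>m m)" "mat_cong q (Q * Q') (1\<^sub>m m)"
    using Q unfolding invertible_mod_def by blast
  have Ec: "E \<in> carrier_mat n m" using mat_cong_carrier[OF E] P' M Q' by auto
  have "mat_cong q (P' * E) (P' * (P * M * Q))"
    by (rule mat_cong_mult[OF mat_cong_refl E P'(2) Ec])
  then have "mat_cong q (P' * E * Q') (P' * (P * M * Q) * Q')"
    by (rule mat_cong_mult[OF _ mat_cong_refl _ Q'(2)]) (use P' Ec in auto)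
  also have "P' * (P * M * Q) * Q' = ((P' * P) * M) * (Q * Q')"
    using P'(1,2) Q'(1,2) M
    by (simp add: assoc_mult_mat[of _ n n _ n _ m] assoc_mult_mat[of _ n n _ m _ m] assoc_mult_mat[of _ n m _ m _ m])
  finally have 1: "mat_cong q (P' * E * Q') (((P' * P) * M) * (Q * Q'))" .
  have "mat_cong q ((P' * P) * M) (1\<^sub>m n * M)"
    by (rule mat_cong_mult[OF P'(3) mat_cong_refl _ M]) (use P' in auto)
  then have "mat_cong q (((P' * P) * M) * (Q * Q')) ((1\<^sub>m n * M) * 1\<^sub>m m)"
    by (rule mat_cong_mult[OF _ Q'(4), of _ _ n m]) (use P' Q' M in auto)
  from mat_cong_trans[OF 1 this] have "mat_cong q M (P' * E * Q')"
    using M mat_cong_sym by simp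
  from kcount_mat_le[OF Ec kq P'(2,1,4) Q'(2,1,4) this]
    kcount_mat_le[OF M kq P'(1-3) Q'(1-3) E] show ?thesis by simp
qed

section \<open>Kernel counts of diagonal matrices modulo prime powers\<close>

lemma card_multiples_power:
  fixes p :: nat
  assumes "0 < p" "w \<le> e"
  shows "card {y \<in> {0..<int (p ^ e)}. int (p ^ w) dvd y} = p ^ (e - w)"
proof -
  have pe: "int (p ^ e) = int (p ^ w) * int (p ^ (e - w))"
    using assms by (simp flip: power_add of_nat_mult)
  have "{y \<in> {0..<P * K}. P dvd y} = (\<lambda>z. P * z) ` {0..<K}" if "P > 0" for P K :: int
    using that by (auto simp: dvd_def image_iff zero_le_mult_iff)
  then have "{y \<in> {0..<int (p ^ e)}. int (p ^ w) dvd y} = (\<lambda>z. int (p ^ w) * z) ` {0..<int (p ^ (e - w))}"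
    unfolding pe using assms by simp
  also have "card \<dots> = card {0..<int (p ^ (e - w))}"
    using assms by (intro card_image inj_onI) auto
  also have "\<dots> = p ^ (e - w)"
    by (simp del: of_nat_power)
  finally show ?thesis .
qed

lemma prime_power_split:
  fixes p :: nat and g :: int
  assumes "prime p" "\<not> int (p ^ t) dvd g"
  obtains v u where "v < t" "g = int (p ^ v) * u" "\<not> int p dvd u"
proof -
  have g0: "g \<noteq> 0" using assms(2) by auto
  have pp: "prime (int p)" using assms(1) by simp
  have "\<not> is_unit (int p)" using pp not_prime_unit by blast
  then obtain u where u: "g = int p ^ multiplicity (int p) g * u" "\<not> int p dvd u"
    using multiplicity_decompose'[OF g0] by metis
  have "multiplicity (int p) g < t"
  proof (rule ccontr)
    assume "\<not> ?thesis"
    then have "int p ^ t dvd g" by (intro multiplicity_dvd') auto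
    then show False using assms by simp
  qed
  then show thesis using that[of "multiplicity (int p) g" u] u by simp
qed

lemma prime_power_dvd_mult_iff:
  fixes p :: nat and u y :: int
  assumes "prime p" "\<not> int p dvd u" "v \<le> t"
  shows "int (p ^ t) dvd int (p ^ v) * u * y \<longleftrightarrow> int (p ^ (t - v)) dvd y"
proof -
  have pt: "int (p ^ t) = int (p ^ v) * int (p ^ (t - v))"
    using assms by (simp flip: power_add of_nat_mult)
  have "coprime (int (p ^ (t - v))) u"
    using assms prime_imp_coprime[of "int p" u] by simp
  then have "int (p ^ (t - v)) dvd u * y \<longleftrightarrow> int (p ^ (t - v)) dvd y"
    by (simp add: coprime_dvd_mult_right_iff)
  then show ?thesis unfolding pt mult.assoc
    using prime_gt_0_nat[OF assms(1)] by (subst dvd_mult_cancel_left) simp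
qed

text \<open>Write \<open>g = p ^ v * u\<close> with \<open>u\<close> prime to \<open>p\<close> and
  \<open>v < t\<close>. The residues killing \<open>g\<close> modulo \<open>p ^ t\<close> are the
  multiples of \<open>p ^ (t - v)\<close>, and lowering \<open>t\<close> by one makes them
  \<open>p\<close> times as many. If \<open>p ^ t\<close> divides \<open>g\<close>, every residue
  qualifies in both cases.\<close>

lemma card_annihilators_step:
  fixes p :: nat and g :: int
  assumes p: "prime p" and t: "1 \<le> t" "t \<le> e"
  shows "card {y \<in> {0..<int (p ^ e)}. int (p ^ (t - 1)) dvd g * y} =
     (if int (p ^ t) dvd g then 1 else p) * card {y \<in> {0..<int (p ^ e)}. int (p ^ t) dvd g * y}"
proof (cases "int (p ^ t) dvd g")
  case True
  moreover have "int (p ^ (t - 1)) dvd g"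
    using True by (meson dvd_trans diff_le_self le_imp_power_dvd of_nat_dvd_iff)
  ultimately show ?thesis by simp
next
  case False
  obtain v u where vu: "v < t" "g = int (p ^ v) * u" "\<not> int p dvd u"
    using prime_power_split[OF p False] by blast
  have "card {y \<in> {0..<int (p ^ e)}. int (p ^ (t - 1)) dvd g * y} = p ^ (e - (t - 1 - v))"
    unfolding vu(2) using prime_power_dvd_mult_iff[OF p vu(3), of v "t - 1"] vu(1) t prime_gt_0_nat[OF p]
    by (subst card_multiples_power[symmetric]) auto
  moreover have "card {y \<in> {0..<int (p ^ e)}. int (p ^ t) dvd g * y} = p ^ (e - (t - v))"
    unfolding vu(2) using prime_power_dvd_mult_iff[OF p vu(3), of v "t"] vu(1) t prime_gt_0_nat[OF p]
    by (subst card_multiples_power[symmetric]) auto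
  moreover have "e - (t - 1 - v) = Suc (e - (t - v))" using vu(1) t by simp
  ultimately show ?thesis using False by (simp only: if_False power_Suc)
qed

text \<open>For a diagonal matrix the congruences decouple, and rows from \<open>m\<close> on impose
  nothing. The solution set is a product over the columns, and each column contributes its own
  factor 1 or \<open>p\<close>.\<close>

lemma kcount_diagonal_step:
  assumes p: "prime p" and t: "1 \<le> t" "t \<le> e" and mn: "m \<le> n" and q: "q = p ^ e"
    and offdiag: "\<And>i j. i < n \<Longrightarrow> j < m \<Longrightarrow> i \<noteq> j \<Longrightarrow> [E i j = 0] (mod int q)"
  shows "kcount q (p ^ (t - 1)) {..<n} {..<m} E =
    p ^ card {i. i < m \<and> \<not> int (p ^ t) dvd E i i} * kcount q (p ^ t) {..<n} {..<m} E"
proof -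
  have form: "kcount q (p ^ w) {..<n} {..<m} E =
    (\<Prod>b<m. card {y \<in> {0..<int (p ^ e)}. int (p ^ w) dvd E b b * y})" if w: "w \<le> e" for w
  proof -
    have dq: "int (p ^ w) dvd int q" unfolding q using w by (simp add: le_imp_power_dvd)
    have row: "int (p ^ w) dvd (\<Sum>b<m. E a b * x b) \<longleftrightarrow> (a < m \<longrightarrow> int (p ^ w) dvd E a a * x a)"
      if a: "a < n" for a x
    proof -
      have "[(\<Sum>b<m. E a b * x b) = (\<Sum>b<m. if a = b then E a a * x a else 0)] (mod int (p ^ w))"
      proof (rule cong_sum)
        fix b assume b: "b \<in> {..<m}"
        show "[E a b * x b = (if a = b then E a a * x a else 0)] (mod int (p ^ w))"
        proof (cases "a = b")
          case False
          then have "[E a b = 0] (mod int (p ^ w))" using offdiag[of a b] a b dq cong_dvd_modulus by auto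
          then have "[E a b * x b = 0 * x b] (mod int (p ^ w))" by (intro cong_mult) auto
          then show ?thesis using False by simp
        qed simp
      qed
      then show ?thesis by (subst cong_dvd_iff) (auto simp: sum.delta')
    qed
    have rows: "(\<forall>a\<in>{..<n}. int (p ^ w) dvd (\<Sum>b<m. E a b * x b)) \<longleftrightarrow>
        (\<forall>a<m. int (p ^ w) dvd E a a * x a)" for x
      using row[of _ x] mn by (metis lessThan_iff order_less_le_trans)
    have "{x \<in> res_vecs q {..<m}. \<forall>a\<in>{..<n}. int (p ^ w) dvd (\<Sum>b<m. E a b * x b)} =
       PiE_dflt {..<m} 0 (\<lambda>b. {y \<in> {0..<int (p ^ e)}. int (p ^ w) dvd E b b * y})"
      unfolding rows res_vecs_def PiE_dflt_def q by (auto simp del: of_nat_power)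
    moreover have "finite {y \<in> {0..<int (p ^ e)}. int (p ^ w) dvd E b b * y}" for b
      by (rule finite_subset[of _ "{0..<int (p ^ e)}"]) auto
    ultimately show ?thesis unfolding kcount_def by (simp only: card_PiE_dflt finite_lessThan)
  qed
  have "kcount q (p ^ (t - 1)) {..<n} {..<m} E =
     (\<Prod>b<m. (if int (p ^ t) dvd E b b then 1 else p) * card {y \<in> {0..<int (p ^ e)}. int (p ^ t) dvd E b b * y})"
    using t by (subst form, simp) (rule prod.cong[OF refl], rule card_annihilators_step[OF p t])
  also have "\<dots> = (\<Prod>b<m. (if int (p ^ t) dvd E b b then 1 else p)) * kcount q (p ^ t) {..<n} {..<m} E"
    using t by (subst form, simp) (rule prod.distrib)
  also have "(\<Prod>b<m. (if int (p ^ t) dvd E b b then 1 else p)) = p ^ card {i. i < m \<and> \<not> int (p ^ t) dvd E i i}"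
    by (subst prod.If_cases) (auto simp: Int_def intro!: arg_cong[of _ _ "\<lambda>A. p ^ card A"])
  finally show ?thesis .
qed

section \<open>Smith normal forms modulo prime powers\<close>

text \<open>For a Smith form with diagonal \<open>E\<close> modulo a power of \<open>p\<close>, the quotient of the kernel counts for
  \<open>p ^ (t - 1)\<close> and \<open>p ^ t\<close> is \<open>p\<close> to the number of entries of \<open>E\<close> not divisible by \<open>p ^ t\<close>. So the following
  event says that \<open>a t\<close> entries are not divisible by \<open>p ^ t\<close>, for each \<open>t \<le> s\<close>, and that at least \<open>r\<close> entries
  are not divisible by \<open>p ^ (s + 1)\<close>.\<close>

definition kernel_event :: "nat \<Rightarrow> nat \<Rightarrow> nat \<Rightarrow> (nat \<Rightarrow> nat) \<Rightarrow> nat \<Rightarrow> nat set \<Rightarrow> nat set \<Rightarrow> (nat \<Rightarrow> nat \<Rightarrow> int) \<Rightarrow> bool" where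
  "kernel_event q p s a r I J M \<longleftrightarrow>
     (\<forall>t\<in>{1..s}. kcount q (p ^ (t - 1)) I J M = p ^ a t * kcount q (p ^ t) I J M) \<and>
     p ^ r * kcount q (p ^ Suc s) I J M \<le> kcount q (p ^ s) I J M"

text \<open>A set of positions closed downwards is an initial segment, so its size determines it.
  This turns counts of diagonal entries into statements about single positions.\<close>

lemma card_initial_segment:
  fixes m :: nat
  assumes "\<And>i. Suc i < m \<Longrightarrow> P (Suc i) \<Longrightarrow> P i" "i < m"
  shows "P i \<longleftrightarrow> i < card {i. i < m \<and> P i}"
proof -
  have down: "P i" if "P j" "i \<le> j" "j < m" for i j
    using that(2,1,3)
  proof (induction j rule: dec_induct)
    case (step k)
    then show ?case using assms(1)[of k] by auto
  qed auto
  show ?thesis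
  proof
    assume "P i"
    then have "{..i} \<subseteq> {i. i < m \<and> P i}" using down[of i] assms(2) by auto
    then have "card {..i} \<le> card {i. i < m \<and> P i}" by (intro card_mono) auto
    then show "i < card {i. i < m \<and> P i}" by simp
  next
    assume i: "i < card {i. i < m \<and> P i}"
    show "P i"
    proof (rule ccontr)
      assume "\<not> P i"
      then have "{i. i < m \<and> P i} \<subseteq> {..<i}" using down[of _ i] by (force simp: not_less)
      then have "card {i. i < m \<and> P i} \<le> card {..<i}" by (intro card_mono) auto
      then show False using i by simp
    qed
  qed
qed

lemma a_tilde_shift: "a_tilde r d p t = card {i. i < r \<and> \<not> p ^ t dvd d (Suc i)}"
proof -
  have "{t' \<in> {1..r}. \<not> p ^ t dvd d t'} = Suc ` {i. i < r \<and> \<not> p ^ t dvd d (Suc i)}"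
    by (auto simp: image_iff Suc_le_eq dest: gr0_implies_Suc)
  then show ?thesis unfolding a_tilde_def by (simp add: card_image)
qed

text \<open>In both chains the entries not divisible by \<open>p ^ t\<close> come first, so a count
  is the place where divisibility begins. For \<open>t \<le> s\<close> that place lies among the
  first \<open>r\<close> positions on the prescribed side, as \<open>p ^ s\<close> divides
  \<open>d r\<close>. For \<open>t = Suc s\<close> no prescribed entry is divisible, which asks for
  at least \<open>r\<close> such entries in \<open>E\<close>.\<close>

lemma kernel_event_diagonal:
  assumes p: "prime p" and q: "q = p ^ Suc s" and rmn: "1 \<le> r" "r \<le> m" "m \<le> n"
    and d: "\<And>i. i \<in> {1..<r} \<Longrightarrow> d i dvd d (Suc i)" and dr: "p ^ s dvd d r" "\<not> p ^ Suc s dvd d r"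
    and offdiag: "\<And>i j. i < n \<Longrightarrow> j < m \<Longrightarrow> i \<noteq> j \<Longrightarrow> [E i j = 0] (mod int q)"
    and chain: "\<And>i. Suc i < m \<Longrightarrow> \<exists>c. [E (Suc i) (Suc i) = c * E i i] (mod int q)"
  shows "kernel_event q p s (a_tilde r d p) r {..<n} {..<m} E \<longleftrightarrow>
    (\<forall>t\<in>{1..Suc s}. \<forall>i<r. int (p ^ t) dvd E i i \<longleftrightarrow> p ^ t dvd d (Suc i))"
proof -
  define b where "b t = card {i. i < m \<and> \<not> int (p ^ t) dvd E i i}" for t
  have q0: "0 < q" unfolding q using prime_gt_0_nat[OF p] by simp
  have p1: "1 < p" using prime_gt_1_nat[OF p] .
  have Eb: "\<not> int (p ^ t) dvd E i i \<longleftrightarrow> i < b t" if t: "t \<le> Suc s" and i: "i < m" for t i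
    unfolding b_def
  proof (rule card_initial_segment[OF _ i])
    fix j assume j: "Suc j < m" and nd: "\<not> int (p ^ t) dvd E (Suc j) (Suc j)"
    obtain c where c: "[E (Suc j) (Suc j) = c * E j j] (mod int q)" using chain[OF j] by blast
    have "int (p ^ t) dvd int q" unfolding q of_nat_dvd_iff using t by (rule le_imp_power_dvd)
    then have "[E (Suc j) (Suc j) = c * E j j] (mod int (p ^ t))" using c cong_dvd_modulus by blast
    then show "\<not> int (p ^ t) dvd E j j" using nd cong_dvd_iff dvd_mult by blast
  qed
  have da: "\<not> p ^ t dvd d (Suc i) \<longleftrightarrow> i < a_tilde r d p t" if i: "i < r" for t i
    unfolding a_tilde_shift
  proof (rule card_initial_segment[OF _ i])
    fix j assume j: "Suc j < r" "\<not> p ^ t dvd d (Suc (Suc j))"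
    then show "\<not> p ^ t dvd d (Suc j)" using d[of "Suc j"] dvd_trans by auto
  qed
  have ar: "a_tilde r d p t < r" if t: "t \<le> s" for t
  proof -
    have "p ^ t dvd d r" using dr(1) t by (meson dvd_trans le_imp_power_dvd)
    then show ?thesis using da[of "r - 1" t] rmn by auto
  qed
  have pos: "0 < kcount q k {..<n} {..<m} E" for k using kcount_pos[OF _ q0] by simp
  have step: "kcount q (p ^ (t - 1)) {..<n} {..<m} E = p ^ b t * kcount q (p ^ t) {..<n} {..<m} E"
    if "t \<in> {1..Suc s}" for t
    unfolding b_def by (rule kcount_diagonal_step[OF p _ _ rmn(3) q offdiag]) (use that in auto)
  have "kcount q (p ^ (t - 1)) {..<n} {..<m} E = p ^ a_tilde r d p t * kcount q (p ^ t) {..<n} {..<m} E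
     \<longleftrightarrow> (\<forall>i<r. int (p ^ t) dvd E i i \<longleftrightarrow> p ^ t dvd d (Suc i))" (is "?L = ?R") if t: "t \<in> {1..s}" for t
  proof -
    have "?L \<longleftrightarrow> b t = a_tilde r d p t"
      using pos[of "p ^ t"] step[of t] t p1 by (simp add: power_inject_exp)
    \<comment> \<open>If the two counts differed, the smaller one would be a position below
      \<open>r\<close> where exactly one side is divisible, because
      \<open>a_tilde r d p t < r\<close>.\<close>
    also have "\<dots> \<longleftrightarrow> (\<forall>i<r. i < b t \<longleftrightarrow> i < a_tilde r d p t)"
      using ar[of t] t by (metis atLeastAtMost_iff linorder_neqE_nat order_less_irrefl order_less_trans)
    also have "\<dots> \<longleftrightarrow> ?R"
    proof -
      have "(i < b t \<longleftrightarrow> i < a_tilde r d p t) \<longleftrightarrow> (int (p ^ t) dvd E i i \<longleftrightarrow> p ^ t dvd d (Suc i))" if "i < r" for i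
        using Eb[of t i] da[of i t] t that rmn by (auto simp del: of_nat_power)
      then show ?thesis by blast
    qed
    finally show ?thesis .
  qed
  moreover have "p ^ r * kcount q (p ^ Suc s) {..<n} {..<m} E \<le> kcount q (p ^ s) {..<n} {..<m} E
     \<longleftrightarrow> (\<forall>i<r. int (p ^ Suc s) dvd E i i \<longleftrightarrow> p ^ Suc s dvd d (Suc i))" (is "?L = ?R")
  proof -
    have "?L \<longleftrightarrow> p ^ r * kcount q (p ^ Suc s) {..<n} {..<m} E \<le> p ^ b (Suc s) * kcount q (p ^ Suc s) {..<n} {..<m} E"
      using step[of "Suc s"] by (simp del: power_Suc)
    also have "\<dots> \<longleftrightarrow> r \<le> b (Suc s)"
      using pos[of "p ^ Suc s"] p1 by (simp del: power_Suc)
    also have "\<dots> \<longleftrightarrow> (\<forall>i<r. i < b (Suc s))"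
      using rmn by (metis less_le_trans linorder_not_less order_less_irrefl)
    also have "\<dots> \<longleftrightarrow> ?R"
    proof -
      have all: "\<not> p ^ Suc s dvd d (Suc i)" if "i < r" for i
        using da[OF that, of "Suc s"] da[of "r - 1" "Suc s"] dr(2) rmn that by auto
      have "i < b (Suc s) \<longleftrightarrow> (int (p ^ Suc s) dvd E i i \<longleftrightarrow> p ^ Suc s dvd d (Suc i))" if "i < r" for i
        using Eb[of "Suc s" i] all[OF that] that rmn by (auto simp del: of_nat_power power_Suc)
      then show ?thesis by blast
    qed
    finally show ?thesis .
  qed
  ultimately show ?thesis
    unfolding kernel_event_def
    by (auto simp: atLeastAtMostSuc_conv simp del: of_nat_power power_Suc)
qed

lemma kernel_event_SNF_mod:
  assumes p: "prime p" and q: "q = p ^ Suc s" and M: "M \<in> carrier_mat n m" and E: "is_SNF_mod q n m M E"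
  shows "kernel_event q p s a r {..<n} {..<m} (\<lambda>i j. M $$ (i,j)) \<longleftrightarrow>
    kernel_event q p s a r {..<n} {..<m} (\<lambda>i j. E $$ (i,j))"
proof -
  obtain P Q where PQ: "invertible_mod q n P" "invertible_mod q m Q" "mat_cong q E (P * M * Q)"
    using E unfolding is_SNF_mod_def by blast
  have q0: "0 < q" unfolding q using prime_gt_0_nat[OF p] by simp
  have eq: "kcount q (p ^ t) {..<n} {..<m} (\<lambda>a b. E $$ (a,b)) = kcount q (p ^ t) {..<n} {..<m} (\<lambda>a b. M $$ (a,b))"
    if "t \<le> Suc s" for t
    by (rule kcount_mat_eq[OF M _ q0 PQ]) (unfold q, use that in \<open>rule le_imp_power_dvd\<close>)
  show ?thesis unfolding kernel_event_def
    by (intro conj_cong ball_cong refl) (auto simp del: power_Suc simp: eq)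
qed

lemma kernel_event_SNF_mod':
  assumes p: "prime p" and q: "q = p ^ Suc s" and rmn: "1 \<le> r" "r \<le> m" "m \<le> n"
    and d: "\<And>i. i \<in> {1..<r} \<Longrightarrow> d i dvd d (Suc i)" and dr: "p ^ s dvd d r" "\<not> p ^ Suc s dvd d r"
    and M: "M \<in> carrier_mat n m" and E: "is_SNF_mod q n m M E"
  shows "kernel_event q p s (a_tilde r d p) r {..<n} {..<m} (\<lambda>i j. M $$ (i,j)) \<longleftrightarrow>
    (\<forall>t\<in>{1..Suc s}. \<forall>i<r. int (p ^ t) dvd E $$ (i,i) \<longleftrightarrow> p ^ t dvd d (Suc i))"
  unfolding kernel_event_SNF_mod[OF p q M E]
  by (rule kernel_event_diagonal[OF p q rmn d dr]) (use E in \<open>auto simp: is_SNF_mod_def\<close>)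

lemma mat_unit_invertible_mod: "mat_unit n P \<Longrightarrow> invertible_mod q n P"
  unfolding mat_unit_def invertible_mod_def using mat_cong_refl by metis

text \<open>Integer matrices with integer inverses stay invertible modulo \<open>q\<close>, so a
  matrix of residues has a Smith form modulo \<open>q\<close>, namely that of an integer
  representative.\<close>

lemma smith_is_SNF_mod:
  assumes "D \<in> smith_mats n m" "mat_equiv n m M D" "m \<le> n"
  shows "is_SNF_mod q n m M D"
proof -
  obtain P Q where PQ: "mat_unit n P" "mat_unit m Q" "D = P * M * Q"
    using assms(2) unfolding mat_equiv_def by blast
  have "\<exists>P Q. invertible_mod q n P \<and> invertible_mod q m Q \<and> mat_cong q D (P * M * Q)"
    using PQ mat_unit_invertible_mod mat_cong_refl by blast
  moreover have "\<exists>c. [D $$ (Suc i, Suc i) = c * D $$ (i, i)] (mod int q)" if i: "Suc i < m" for i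
  proof -
    have "D $$ (i, i) dvd D $$ (Suc i, Suc i)" using assms(1) i unfolding smith_mats_def by blast
    then obtain c where "D $$ (Suc i, Suc i) = D $$ (i, i) * c" by (rule dvdE)
    then show ?thesis by (intro exI[of _ c]) (simp add: mult.commute)
  qed
  ultimately show ?thesis
    using assms(1) unfolding is_SNF_mod_def smith_mats_def diagonal_mat_def by auto
qed

text \<open>Modulo \<open>p ^ Suc s\<close> every nonzero element is a unit times a power of
  \<open>p\<close>, so the powers of \<open>p\<close> dividing an element fix it up to
  units.\<close>

lemma associated_mod_prime_power:
  fixes x y :: int
  assumes p: "prime p" and dv: "\<And>t. t \<in> {1..Suc s} \<Longrightarrow> int (p ^ t) dvd x \<longleftrightarrow> int (p ^ t) dvd y"
  shows "\<exists>u. coprime u (int (p ^ Suc s)) \<and> [x = u * y] (mod int (p ^ Suc s))"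
proof (cases "int (p ^ Suc s) dvd x")
  case True
  then have "[x = 0] (mod int (p ^ Suc s))" "[y = 0] (mod int (p ^ Suc s))"
    using dv[of "Suc s"] by (auto simp: cong_0_iff simp del: of_nat_power power_Suc)
  then have "[x = 1 * y] (mod int (p ^ Suc s))" by (metis cong_sym cong_trans mult_1)
  then show ?thesis by (intro exI[of _ 1]) auto
next
  case False
  have pp: "prime (int p)" using p by simp
  obtain v x' where x: "v < Suc s" "x = int (p ^ v) * x'" "\<not> int p dvd x'"
    using prime_power_split[OF p False] by blast
  have "\<not> int (p ^ Suc s) dvd y" using False dv[of "Suc s"] by auto
  then obtain w y' where y: "w < Suc s" "y = int (p ^ w) * y'" "\<not> int p dvd y'"
    using prime_power_split[OF p] by blast
  have val: "int (p ^ t) dvd int (p ^ v) * x' \<longleftrightarrow> t \<le> v" if np: "\<not> int p dvd x'" for t v x'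
  proof
    assume a: "int (p ^ t) dvd int (p ^ v) * x'"
    show "t \<le> v"
    proof (rule ccontr)
      assume "\<not> t \<le> v"
      then have "int (p ^ Suc v) dvd int (p ^ v) * x'"
        using a by (meson dvd_trans le_imp_power_dvd not_less_eq_eq of_nat_dvd_iff)
      then show False using np prime_gt_0_nat[OF p] by simp
    qed
  next
    assume "t \<le> v"
    then show "int (p ^ t) dvd int (p ^ v) * x'"
      by (intro dvd_mult2) (simp only: of_nat_dvd_iff le_imp_power_dvd)
  qed
  have "t \<le> v \<longleftrightarrow> t \<le> w" if "t \<in> {1..Suc s}" for t
    using dv[OF that] val[OF x(3)] val[OF y(3)] unfolding x(2) y(2) by blast
  \<comment> \<open>The hypothesis starts at \<open>t = 1\<close>, so an exponent 0 cannot be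
    inserted and is a separate case.\<close>
  from this[of v] this[of w] have vw: "v = w" using x(1) y(1) by (cases "v = 0"; cases "w = 0") auto
  have cop: "coprime z (int (p ^ Suc s))" if "\<not> int p dvd z" for z
    using prime_imp_coprime[OF pp that] by (metis coprime_commute coprime_power_right_iff of_nat_power)
  \<comment> \<open>The unit sought is the quotient of \<open>x'\<close> by \<open>y'\<close>;
    \<open>z\<close> is the inverse of \<open>y'\<close>.\<close>
  obtain z where z: "[y' * z = 1] (mod int (p ^ Suc s))"
    using cong_solve_coprime_int[OF cop[OF y(3)]] by blast
  have "coprime z (int (p ^ Suc s))"
    using z by (metis coprime_iff_invertible_int mult.commute)
  then have "coprime (x' * z) (int (p ^ Suc s))" using cop[OF x(3)] by (simp only: coprime_mult_left_iff)
  moreover have "[(x' * z) * y = x] (mod int (p ^ Suc s))"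
  proof -
    have "[x * (y' * z) = x * 1] (mod int (p ^ Suc s))" by (rule cong_mult[OF cong_refl z])
    moreover have "x * (y' * z) = (x' * z) * y" unfolding x(2) y(2) vw by simp
    ultimately show ?thesis by simp
  qed
  ultimately show ?thesis using cong_sym by blast
qed

text \<open>Divisibility by powers of \<open>p\<close> does not see units, which gives one
  direction. Conversely, the Smith form of an integer representative has the right divisibilities,
  but its entries need not be the \<open>d i\<close>; an integer matrix in \<open>prescribed\<close>
  with the same classes up to units has to be built.\<close>

lemma mod_event_iff:
  assumes p: "prime p" and q: "q = p ^ Suc s" and rmn: "1 \<le> r" "r \<le> m" "m \<le> n"
    and dpos: "\<And>i. i \<in> {1..r} \<Longrightarrow> 0 < d i"
    and d: "\<And>i. i \<in> {1..<r} \<Longrightarrow> d i dvd d (Suc i)" and dr: "p ^ s dvd d r" "\<not> p ^ Suc s dvd d r"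
    and M: "M \<in> carrier_mat n m"
  shows "(\<exists>D\<in>prescribed n m r d. \<exists>E. is_SNF_mod q n m M E \<and>
          (\<forall>i<m. \<exists>u. coprime u (int q) \<and> [D $$ (i, i) = u * E $$ (i, i)] (mod int q)))
     \<longleftrightarrow> kernel_event q p s (a_tilde r d p) r {..<n} {..<m} (\<lambda>i j. M $$ (i,j))" (is "?L \<longleftrightarrow> ?R")
proof
  assume ?L
  then obtain D E where D: "D \<in> prescribed n m r d" and E: "is_SNF_mod q n m M E"
    and u: "\<And>i. i < m \<Longrightarrow> \<exists>u. coprime u (int q) \<and> [D $$ (i, i) = u * E $$ (i, i)] (mod int q)" by blast
  have iff: "?R \<longleftrightarrow> (\<forall>t\<in>{1..Suc s}. \<forall>i<r. int (p ^ t) dvd E $$ (i,i) \<longleftrightarrow> p ^ t dvd d (Suc i))"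
    by (rule kernel_event_SNF_mod'[OF p q rmn d dr M E])
  show ?R
    unfolding iff
  proof (intro ballI allI impI)
    fix t i assume t: "t \<in> {1..Suc s}" and i: "i < r"
    obtain u where u: "coprime u (int q)" "[D $$ (i, i) = u * E $$ (i, i)] (mod int q)"
      using u[of i] i rmn by auto
    have tq: "int (p ^ t) dvd int q" unfolding q of_nat_dvd_iff using t by (intro le_imp_power_dvd) auto
    have "D $$ (i,i) = int (d (Suc i))" using D i unfolding prescribed_def by (auto dest!: bspec[of _ _ "Suc i"])
    moreover have "coprime (int (p ^ t)) u"
      using u(1) tq by (meson coprime_commute coprime_divisors dvd_refl)
    moreover have "int (p ^ t) dvd D $$ (i,i) \<longleftrightarrow> int (p ^ t) dvd u * E $$ (i,i)"
      using cong_dvd_iff cong_dvd_modulus tq u(2) by blast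
    ultimately show "int (p ^ t) dvd E $$ (i,i) \<longleftrightarrow> p ^ t dvd d (Suc i)"
      by (metis coprime_dvd_mult_right_iff of_nat_dvd_iff)
  qed
next
  assume R: ?R
  obtain D0 where D0: "D0 \<in> smith_mats n m" "mat_equiv n m M D0" using smith_form_exists[OF M rmn(3)] by blast
  have E: "is_SNF_mod q n m M D0" by (rule smith_is_SNF_mod[OF D0 rmn(3)])
  have "?R \<longleftrightarrow> (\<forall>t\<in>{1..Suc s}. \<forall>i<r. int (p ^ t) dvd D0 $$ (i,i) \<longleftrightarrow> p ^ t dvd d (Suc i))"
    by (rule kernel_event_SNF_mod'[OF p q rmn d dr M E])
  then have cond: "int (p ^ t) dvd D0 $$ (i,i) \<longleftrightarrow> p ^ t dvd d (Suc i)" if "t \<in> {1..Suc s}" "i < r" for t i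
    using R that by blast
  have D0chain: "D0 $$ (i,i) dvd D0 $$ (Suc i, Suc i)" if "Suc i < m" for i
    using D0(1) that unfolding smith_mats_def by blast
  \<comment> \<open>Past the first \<open>r\<close> entries the chain must continue over the
    integers with the classes of \<open>D0\<close>. There \<open>p ^ s\<close> divides
    \<open>D0 $$ (i,i)\<close>, so modulo \<open>p ^ Suc s\<close> and up to units only two classes
    occur: that of \<open>d r\<close>, divisible by \<open>p ^ s\<close> but not by
    \<open>p ^ Suc s\<close>, and 0. The zeros come last because \<open>D0\<close> is a
    chain.\<close>
  define D where "D = mat n m (\<lambda>(i,j). if i \<noteq> j then 0 else if i < r then int (d (Suc i))
     else if int (p ^ Suc s) dvd D0 $$ (i,i) then 0 else int (d r))"
  have Dii: "D $$ (i,i) = (if i < r then int (d (Suc i))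
     else if int (p ^ Suc s) dvd D0 $$ (i,i) then 0 else int (d r))" if "i < m" for i
    using that rmn unfolding D_def by auto
  have "D \<in> smith_mats n m"
    unfolding smith_mats_def
  proof (intro CollectI conjI allI impI)
    fix i assume i: "Suc i < m"
    consider "Suc i < r" | "Suc i = r" | "r \<le> i" by linarith
    then show "D $$ (i, i) dvd D $$ (Suc i, Suc i)"
    proof cases
      case 3
      then show ?thesis using i D0chain[OF i] dvd_trans
        by (simp del: of_nat_power power_Suc add: Dii) blast
    qed (use Dii[of i] Dii[of "Suc i"] i d[of "Suc i"] in auto)
  qed (use rmn in \<open>auto simp: D_def diagonal_mat_def\<close>)
  moreover have "D $$ (i - 1, i - 1) = int (d i)" if "i \<in> {1..r}" for i
    using Dii[of "i - 1"] that rmn by auto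
  ultimately have "D \<in> prescribed n m r d" unfolding prescribed_def by blast
  moreover have "\<exists>u. coprime u (int q) \<and> [D $$ (i, i) = u * D0 $$ (i, i)] (mod int q)" if i: "i < m" for i
    unfolding q
  proof (rule associated_mod_prime_power[OF p])
    fix t assume t: "t \<in> {1..Suc s}"
    show "int (p ^ t) dvd D $$ (i,i) \<longleftrightarrow> int (p ^ t) dvd D0 $$ (i,i)"
    proof (cases "i < r")
      case True
      then show ?thesis using Dii[OF i] cond[OF t] by (metis of_nat_dvd_iff)
    next
      case False
      have "D0 $$ (r - 1, r - 1) dvd D0 $$ (i,i)"
      proof -
        have "r - 1 \<le> i" using False by simp
        then show ?thesis using i
        proof (induction i rule: dec_induct)
          case (step k)
          then show ?case using D0chain[of k] dvd_trans by auto
        qed simp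
      qed
      moreover have "int (p ^ s) dvd D0 $$ (r - 1, r - 1)"
        using cond[of s "r - 1"] dr(1) rmn by (cases "s = 0") auto
      ultimately have ps: "int (p ^ s) dvd D0 $$ (i,i)" using dvd_trans by blast
      show ?thesis
      proof (cases "t = Suc s")
        case True
        then show ?thesis using Dii[OF i] False dr(2)
          by (simp del: of_nat_power power_Suc add: of_nat_dvd_iff)
      next
        case t': False
        have "p ^ t dvd p ^ s" using t t' by (intro le_imp_power_dvd) auto
        then have "int (p ^ t) dvd D0 $$ (i,i)" "int (p ^ t) dvd int (d r)"
          using ps dr(1) by (meson dvd_trans of_nat_dvd_iff)+
        then show ?thesis using Dii[OF i] False by auto
      qed
    qed
  qed
  ultimately show ?L using E by blast
qed

text \<open>At each prime the event fixes the exponents of the first \<open>r\<close> diagonal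
  entries, and a positive integer is determined by its exponents at all primes.\<close>

lemma int_event_iff:
  fixes v :: "nat \<Rightarrow> nat"
  assumes rmn: "1 \<le> r" "r \<le> m" "m \<le> n"
    and dpos: "\<And>i. i \<in> {1..r} \<Longrightarrow> 0 < d i"
    and d: "\<And>i. i \<in> {1..<r} \<Longrightarrow> d i dvd d (Suc i)"
    and v: "\<And>p. prime p \<Longrightarrow> p ^ v p dvd d r" "\<And>p. prime p \<Longrightarrow> \<not> p ^ Suc (v p) dvd d r"
    and M: "M \<in> carrier_mat n m"
  shows "(\<exists>D\<in>prescribed n m r d. is_SNF n m M D)
     \<longleftrightarrow> (\<forall>p. prime p \<longrightarrow> kernel_event (p ^ Suc (v p)) p (v p) (a_tilde r d p) r {..<n} {..<m} (\<lambda>i j. M $$ (i,j)))" (is "?L \<longleftrightarrow> ?R")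
proof
  assume ?L
  then obtain D where D: "D \<in> prescribed n m r d" "is_SNF n m M D" by blast
  then have D': "D \<in> smith_mats n m" "mat_equiv n m M D" using is_SNF_iff[OF M] by auto
  show ?R
  proof (intro allI impI)
    fix p :: nat assume p: "prime p"
    have E: "is_SNF_mod (p ^ Suc (v p)) n m M D" by (rule smith_is_SNF_mod[OF D' rmn(3)])
    have iff: "kernel_event (p ^ Suc (v p)) p (v p) (a_tilde r d p) r {..<n} {..<m} (\<lambda>i j. M $$ (i,j)) \<longleftrightarrow>
      (\<forall>t\<in>{1..Suc (v p)}. \<forall>i<r. int (p ^ t) dvd D $$ (i,i) \<longleftrightarrow> p ^ t dvd d (Suc i))"
      by (rule kernel_event_SNF_mod'[OF p refl rmn d v(1)[OF p] v(2)[OF p] M E])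
    show "kernel_event (p ^ Suc (v p)) p (v p) (a_tilde r d p) r {..<n} {..<m} (\<lambda>i j. M $$ (i,j))"
      unfolding iff
    proof (intro ballI allI impI)
      fix t i assume i: "i < r"
      have "D $$ (i,i) = int (d (Suc i))" using D i unfolding prescribed_def by (auto dest!: bspec[of _ _ "Suc i"])
      then show "int (p ^ t) dvd D $$ (i,i) \<longleftrightarrow> p ^ t dvd d (Suc i)" by (simp only: of_nat_dvd_iff)
    qed
  qed
next
  assume R: ?R
  obtain D where D: "D \<in> smith_mats n m" "mat_equiv n m M D" using smith_form_exists[OF M rmn(3)] by blast
  have cond: "int (p ^ t) dvd D $$ (i,i) \<longleftrightarrow> p ^ t dvd d (Suc i)"
    if p: "prime p" and t: "t \<in> {1..Suc (v p)}" and i: "i < r" for p t i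
  proof -
    have E: "is_SNF_mod (p ^ Suc (v p)) n m M D" by (rule smith_is_SNF_mod[OF D rmn(3)])
    have "kernel_event (p ^ Suc (v p)) p (v p) (a_tilde r d p) r {..<n} {..<m} (\<lambda>i j. M $$ (i,j)) \<longleftrightarrow>
      (\<forall>t\<in>{1..Suc (v p)}. \<forall>i<r. int (p ^ t) dvd D $$ (i,i) \<longleftrightarrow> p ^ t dvd d (Suc i))"
      by (rule kernel_event_SNF_mod'[OF p refl rmn d v(1)[OF p] v(2)[OF p] M E])
    then show ?thesis using R p t i by blast
  qed
  have ddvd: "d (Suc i) dvd d r" if "i < r" for i
  proof -
    have "Suc i \<le> r" using that by simp
    then show ?thesis
    proof (induction rule: inc_induct)
      case (step k)
      then show ?case using d[of k] dvd_trans by auto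
    qed simp
  qed
  have "D $$ (i,i) = int (d (Suc i))" if i: "i < r" for i
  proof -
    have nn: "0 \<le> D $$ (i,i)" using D(1) i rmn unfolding smith_mats_def by auto
    define x where "x = nat (D $$ (i,i))"
    have x: "D $$ (i,i) = int x" unfolding x_def using nn by simp
    have nd: "\<not> p ^ Suc (v p) dvd d (Suc i)" if "prime p" for p
      using v(2)[OF that] ddvd[OF i] dvd_trans by blast
    have cond': "p ^ t dvd x \<longleftrightarrow> p ^ t dvd d (Suc i)" if "prime p" "t \<in> {1..Suc (v p)}" for p t
      using cond[OF that i] unfolding x by (simp only: of_nat_dvd_iff)
    \<comment> \<open>0 is divisible by \<open>2 ^ Suc (v 2)\<close> while \<open>d (Suc i)\<close>
      is not; any prime would serve.\<close>
    have x0: "x \<noteq> 0"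
      using cond'[of 2 "Suc (v 2)"] nd[of 2] by (metis atLeastAtMost_iff dvd_0_right le_add1 order_refl plus_1_eq_Suc two_is_prime_nat)
    have d0: "d (Suc i) \<noteq> 0" using dpos[of "Suc i"] i by simp
    \<comment> \<open>Beyond \<open>Suc (v p)\<close> nothing has to be tested: divisibility by
      \<open>p ^ Suc (v p)\<close> already fails on both sides.\<close>
    have iff: "p ^ t dvd x \<longleftrightarrow> p ^ t dvd d (Suc i)" if p: "prime p" for p t
    proof (cases "t \<in> {1..Suc (v p)}")
      case False
      show ?thesis
      proof (cases "t = 0")
        case nz: False
        then have "p ^ Suc (v p) dvd p ^ t" using False by (intro le_imp_power_dvd) auto
        then show ?thesis using nd[OF p] cond'[OF p, of "Suc (v p)"] dvd_trans
          by (metis atLeastAtMost_iff le_add1 order_refl plus_1_eq_Suc)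
      qed simp
    qed (use cond'[OF p] in blast)
    have "x = d (Suc i)"
    proof (rule multiplicity_eq_nat)
      fix p :: nat assume p: "prime p"
      have "\<not> is_unit p" using p not_prime_unit by blast
      then show "multiplicity p x = multiplicity p (d (Suc i))"
        using iff[OF p] x0 d0 by (metis multiplicity_dvd multiplicity_geI dual_order.antisym)
    qed (use x0 d0 in auto)
    then show ?thesis using x by simp
  qed
  then have "D \<in> prescribed n m r d" using D(1) unfolding prescribed_def by auto
  then show ?L using D is_SNF_iff[OF M] by blast
qed

section \<open>Uniform probabilities and pivoting\<close>

text \<open>A quotient of cardinalities, so that changes of variables become bijections of finite
  sets and conditioning on one coordinate becomes a fibre count.\<close>

definition uprob :: "'a set \<Rightarrow> int set \<Rightarrow> (('a \<Rightarrow> int) \<Rightarrow> bool) \<Rightarrow> real" where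
  "uprob A V E = real (card {f \<in> funs A V. E f}) / real (card (funs A V))"

lemma finite_dflt: "finite A \<Longrightarrow> finite V \<Longrightarrow> finite (funs A V)"
  by (intro finite_PiE_dflt) auto

lemma card_dflt: "finite A \<Longrightarrow> finite V \<Longrightarrow> card (funs A V) = card V ^ card A"
  by (subst card_PiE_dflt) auto

text \<open>Swapping the coordinate \<open>f c\<close> with the extra value \<open>x\<close> is an
  involution on pairs. This is integration over one coordinate, cleared of denominators.\<close>

lemma card_fibre:
  fixes V :: "int set"
  assumes "finite A" "finite V" "c \<in> A"
  shows "card {f \<in> funs A V. E f} * card V =
    (\<Sum>f\<in>funs A V. card {x \<in> V. E (f(c := x))})"
proof -
  let ?Om = "funs A V"
  have upd: "f(c := x) \<in> ?Om" if "f \<in> ?Om" "x \<in> V" for f x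
    using that assms unfolding PiE_dflt_def by auto
  have mem: "f c \<in> V" if "f \<in> ?Om" for f
    using that assms unfolding PiE_dflt_def by auto
  have "bij_betw (\<lambda>(f, x). (f(c := x), f c)) ({f \<in> ?Om. E f} \<times> V) (SIGMA f : ?Om. {x \<in> V. E (f(c := x))})"
    by (rule bij_betw_byWitness[where f' = "\<lambda>(f, x). (f(c := x), f c)"]) (auto simp: upd mem)
  then have "card ({f \<in> ?Om. E f} \<times> V) = card (SIGMA f : ?Om. {x \<in> V. E (f(c := x))})"
    by (rule bij_betw_same_card)
  then show ?thesis
    using assms finite_dflt[of A V] by (simp add: card_cartesian_product)
qed

lemma card_indep_coordinate:
  fixes V :: "int set"
  assumes "finite A" "finite V" "c \<in> A" and indep: "\<And>f x. E (f(c := x)) = E f"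
  shows "card {f \<in> funs A V. u (f c) \<and> E f} * card V =
    card {x \<in> V. u x} * card {f \<in> funs A V. E f}"
proof -
  let ?Om = "funs A V"
  have "card {f \<in> ?Om. u (f c) \<and> E f} * card V = (\<Sum>f\<in>?Om. card {x \<in> V. u x \<and> E f})"
    by (subst card_fibre[OF assms(1-3)]) (simp add: indep)
  also have "\<dots> = (\<Sum>f\<in>?Om. if E f then card {x \<in> V. u x} else 0)"
    by (intro sum.cong) auto
  also have "\<dots> = card {x \<in> V. u x} * card {f \<in> ?Om. E f}"
    using finite_dflt[OF assms(1,2)] by (simp add: sum.If_cases Int_def)
  finally show ?thesis .
qed

lemma card_free_coordinate:
  fixes V :: "int set"
  assumes "finite A" "finite V" "c \<notin> A" and indep: "\<And>f x. E (f(c := x)) = E f"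
  shows "card {f \<in> funs (insert c A) V. E f} = card V * card {f \<in> funs A V. E f}"
proof -
  let ?Om = "funs A V" and ?Om' = "funs (insert c A) V"
  have fc: "f(c := 0) = f" if "f \<in> ?Om" for f
    using that assms(3) unfolding PiE_dflt_def by (intro fun_upd_idem) auto
  have up: "f(c := x) \<in> ?Om'" if "f \<in> ?Om" "x \<in> V" for f x
    using that unfolding PiE_dflt_def by auto
  have down: "f(c := 0) \<in> ?Om" "f c \<in> V" if "f \<in> ?Om'" for f
    using that assms(3) unfolding PiE_dflt_def by auto
  have "bij_betw (\<lambda>(x, f). f(c := x)) (V \<times> {f \<in> ?Om. E f}) {f \<in> ?Om'. E f}"
    by (rule bij_betw_byWitness[where f' = "\<lambda>f. (f c, f(c := 0))"]) (auto simp: fc up down indep)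
  then have "card (V \<times> {f \<in> ?Om. E f}) = card {f \<in> ?Om'. E f}" by (rule bij_betw_same_card)
  then show ?thesis by (simp add: card_cartesian_product)
qed

lemma uprob_bij:
  assumes "finite A" "finite V" and T: "\<And>f. f \<in> funs A V \<Longrightarrow> T f \<in> funs A V"
    and inj: "inj_on T (funs A V)"
    and E: "\<And>f. f \<in> funs A V \<Longrightarrow> E f \<longleftrightarrow> E' (T f)"
  shows "uprob A V E = uprob A V E'"
proof -
  let ?Om = "funs A V"
  have surj: "T ` ?Om = ?Om"
    by (rule endo_inj_surj[OF finite_dflt[OF assms(1,2)] _ inj]) (rule image_subsetI, rule T)
  have "T ` {f \<in> ?Om. E f} = {f \<in> ?Om. E' f}"
  proof
    show "{f \<in> ?Om. E' f} \<subseteq> T ` {f \<in> ?Om. E f}"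
    proof
      fix g assume g: "g \<in> {f \<in> ?Om. E' f}"
      then have "g \<in> T ` ?Om" unfolding surj by simp
      then obtain f where "f \<in> ?Om" "g = T f" by (rule imageE)
      then show "g \<in> T ` {f \<in> ?Om. E f}" using g E[of f] by simp
    qed
    show "T ` {f \<in> ?Om. E f} \<subseteq> {f \<in> ?Om. E' f}"
    proof (rule image_subsetI)
      fix f assume "f \<in> {f \<in> ?Om. E f}"
      then show "T f \<in> {f \<in> ?Om. E' f}" using T[of f] E[of f] by simp
    qed
  qed
  moreover have "inj_on T {f \<in> ?Om. E f}" by (rule inj_on_subset[OF inj]) auto
  ultimately have "card {f \<in> ?Om. E f} = card {f \<in> ?Om. E' f}" using card_image by fastforce
  then show ?thesis unfolding uprob_def by simp
qed

lemma uprob_split: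
  assumes "finite A" "finite V"
  shows "uprob A V E = uprob A V (\<lambda>f. F f \<and> E f) + uprob A V (\<lambda>f. \<not> F f \<and> E f)"
proof -
  let ?Om = "funs A V"
  have un: "{f \<in> ?Om. E f} = {f \<in> ?Om. F f \<and> E f} \<union> {f \<in> ?Om. \<not> F f \<and> E f}" by blast
  have fin: "finite {f \<in> ?Om. P f}" for P
    using finite_subset[OF _ finite_dflt[OF assms], of "{f \<in> ?Om. P f}"] by blast
  have "card {f \<in> ?Om. E f} = card {f \<in> ?Om. F f \<and> E f} + card {f \<in> ?Om. \<not> F f \<and> E f}"
    by (subst un, rule card_Un_disjoint[OF fin fin]) blast
  then show ?thesis unfolding uprob_def by (simp add: add_divide_distrib)
qed

lemma uprob_cong:
  assumes "\<And>f. f \<in> funs A V \<Longrightarrow> E f \<longleftrightarrow> E' f"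
  shows "uprob A V E = uprob A V E'"
proof -
  have "{f \<in> funs A V. E f} = {f \<in> funs A V. E' f}" using assms by blast
  then show ?thesis unfolding uprob_def by simp
qed

lemma uprob_indep_coordinate:
  assumes "finite A" "finite V" "c \<in> A" "V \<noteq> {}" and indep: "\<And>f x. E (f(c := x)) = E f"
  shows "uprob A V (\<lambda>f. u (f c) \<and> E f) = real (card {x \<in> V. u x}) / real (card V) * uprob A V E"
proof -
  have "real (card {f \<in> funs A V. u (f c) \<and> E f}) * real (card V) =
      real (card {x \<in> V. u x}) * real (card {f \<in> funs A V. E f})"
    using arg_cong[OF card_indep_coordinate[where E = E and u = u, OF assms(1-3) indep], of real]
    by (simp only: of_nat_mult)
  moreover have "card V \<noteq> 0" using assms by auto
  ultimately have "real (card {f \<in> funs A V. u (f c) \<and> E f}) =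
      real (card {x \<in> V. u x}) / real (card V) * real (card {f \<in> funs A V. E f})"
    by (simp add: field_simps)
  then show ?thesis unfolding uprob_def by simp
qed

lemma uprob_True: "finite A \<Longrightarrow> finite V \<Longrightarrow> V \<noteq> {} \<Longrightarrow> uprob A V (\<lambda>_. True) = 1"
  unfolding uprob_def by (simp add: card_dflt)

lemma uprob_False: "uprob A V (\<lambda>_. False) = 0"
  unfolding uprob_def by simp

lemma int_div_less:
  fixes x p q :: int
  assumes "0 < q" "x < p * q"
  shows "x div q < p"
proof (rule ccontr)
  assume "\<not> x div q < p"
  then have "p * q \<le> (x div q) * q" using assms(1) by (intro mult_right_mono) auto
  also have "\<dots> = x - x mod q" by (simp add: minus_mod_eq_div_mult)
  finally show False using assms pos_mod_sign[OF assms(1), of x] by simp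
qed

lemma card_residue_class:
  fixes k l :: nat and w :: int
  assumes "0 < k"
  shows "card {y \<in> {0..<int (k * l)}. [y = w] (mod int k)} = l"
proof -
  have "bij_betw (\<lambda>z. w mod int k + int k * z) {0..<int l} {y \<in> {0..<int (k * l)}. [y = w] (mod int k)}"
  proof (rule bij_betw_byWitness[where f' = "\<lambda>y. y div int k"])
    show "\<forall>z\<in>{0..<int l}. (w mod int k + int k * z) div int k = z" using assms by simp
    show "\<forall>y\<in>{y \<in> {0..<int (k * l)}. [y = w] (mod int k)}. w mod int k + int k * (y div int k) = y"
      by (auto simp: cong_def) (metis mod_mult_div_eq)
    show "(\<lambda>z. w mod int k + int k * z) ` {0..<int l} \<subseteq> {y \<in> {0..<int (k * l)}. [y = w] (mod int k)}"
    proof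
      fix y assume "y \<in> (\<lambda>z. w mod int k + int k * z) ` {0..<int l}"
      then obtain z where z: "0 \<le> z" "z < int l" "y = w mod int k + int k * z" by auto
      have "int k * z \<le> int k * (int l - 1)" using z by (intro mult_left_mono) auto
      moreover have "w mod int k < int k" "0 \<le> w mod int k" using assms by auto
      ultimately have "y < int (k * l)" "0 \<le> y" using z by (auto simp: algebra_simps)
      then show "y \<in> {y \<in> {0..<int (k * l)}. [y = w] (mod int k)}"
        using z by (simp add: cong_def)
    qed
    show "(\<lambda>y. y div int k) ` {y \<in> {0..<int (k * l)}. [y = w] (mod int k)} \<subseteq> {0..<int l}"
      using assms by (auto simp: pos_imp_zdiv_nonneg_iff mult.commute intro!: int_div_less)
  qed
  from bij_betw_same_card[OF this] show ?thesis by simp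
qed

text \<open>\<open>p * x\<close> modulo \<open>p * q'\<close> depends only on \<open>x\<close>
  modulo \<open>q'\<close>, so multiplication by \<open>p\<close> is a \<open>p\<close>-to-one map
  of the residues onto the multiples of \<open>p\<close>.\<close>

lemma card_mult_mod_fibre:
  fixes p q' :: nat and G :: "int \<Rightarrow> bool"
  assumes p: "0 < p" and q': "0 < q'"
  shows "card {x \<in> {0..<int (p * q')}. G (int p * x mod int (p * q'))} =
     p * card {x \<in> {0..<int (p * q')}. int p dvd x \<and> G x}"
proof -
  let ?X = "{0..<int (p * q')}"
  let ?W = "{w \<in> {0..<int q'}. G (int p * w)}"
  let ?F = "\<lambda>w. {x \<in> ?X. [x = w] (mod int q')}"
  have finW: "finite ?W" by (rule finite_subset[of _ "{0..<int q'}"]) auto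
  have finF: "finite (?F w)" for w by (rule finite_subset[of _ ?X]) auto
  have fibres: "{x \<in> ?X. G (int p * x mod int (p * q'))} = (\<Union>w\<in>?W. ?F w)"
  proof (intro equalityI subsetI)
    fix x assume "x \<in> {x \<in> ?X. G (int p * x mod int (p * q'))}"
    then have "x mod int q' \<in> ?W" "x \<in> ?F (x mod int q')"
      using q' by (simp_all add: mod_mult_mult1 cong_def)
    then show "x \<in> (\<Union>w\<in>?W. ?F w)" by blast
  next
    fix x assume "x \<in> (\<Union>w\<in>?W. ?F w)"
    then show "x \<in> {x \<in> ?X. G (int p * x mod int (p * q'))}"
      by (auto simp: mod_mult_mult1 cong_def)
  qed
  have "card (\<Union>w\<in>?W. ?F w) = (\<Sum>w\<in>?W. card (?F w))"
  proof (rule card_UN_disjoint[OF finW])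
    show "\<forall>w\<in>?W. finite (?F w)" using finF by blast
  qed (auto simp: cong_def)
  then have count: "card (\<Union>w\<in>?W. ?F w) = p * card ?W"
    using card_residue_class[OF q', of p] by (simp add: mult.commute)
  have img_card: "card ((*) (int p) ` ?W) = card ?W"
    using p by (intro card_image inj_onI) simp
  have img: "(*) (int p) ` ?W = {x \<in> ?X. int p dvd x \<and> G x}"
    using p by (auto simp: dvd_def image_iff zero_le_mult_iff)
  show ?thesis unfolding fibres count img[symmetric] img_card ..
qed

text \<open>A uniform residue conditioned on being a multiple of \<open>p\<close> is distributed
  like \<open>p\<close> times a uniform residue. This restores the uniform measure after an entry is
  found to be a non-unit.\<close>

lemma uprob_scale_coordinate:
  assumes "finite A" "c \<in> A" and q: "q = p * q'" "0 < p" "0 < q'"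
  shows "uprob A {0..<int q} (\<lambda>f. int p dvd f c \<and> E f) =
    1 / real p * uprob A {0..<int q} (\<lambda>f. E (f(c := int p * f c mod int q)))"
proof -
  let ?V = "{0..<int q}"
  let ?Om = "funs A ?V"
  have "card {f \<in> ?Om. E (f(c := int p * f c mod int q))} * card ?V =
     (\<Sum>f\<in>?Om. card {x \<in> ?V. E (f(c := int p * x mod int q))})"
    by (subst card_fibre[OF assms(1) _ assms(2)]) auto
  also have "\<dots> = (\<Sum>f\<in>?Om. p * card {x \<in> ?V. int p dvd x \<and> E (f(c := x))})"
    unfolding q(1) by (rule sum.cong[OF refl]) (rule card_mult_mod_fibre[OF q(2,3)])
  also have "\<dots> = p * (card {f \<in> ?Om. int p dvd f c \<and> E f} * card ?V)"
    by (subst card_fibre[OF assms(1) _ assms(2)]) (auto simp: sum_distrib_left)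
  finally have "card {f \<in> ?Om. E (f(c := int p * f c mod int q))} * card ?V =
    (p * card {f \<in> ?Om. int p dvd f c \<and> E f}) * card ?V" by (simp only: mult.assoc)
  moreover have "card ?V \<noteq> 0" using q by (simp del: of_nat_mult)
  ultimately have "card {f \<in> ?Om. E (f(c := int p * f c mod int q))} = p * card {f \<in> ?Om. int p dvd f c \<and> E f}"
    by (auto simp only: mult_cancel2)
  then show ?thesis unfolding uprob_def using q(2) by simp
qed

text \<open>Row \<open>i\<close> determines \<open>x j\<close> modulo \<open>k\<close> from the
  other coordinates, which leaves \<open>l = q / k\<close> residues modulo \<open>q\<close>.
  Substituting into the other rows gives their Schur complement.\<close>

lemma kcount_pivot:
  assumes fin: "finite J" and ij: "i \<in> I" "j \<in> J" and kq: "q = k * l" "0 < k" "0 < l"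
    and inv: "[c * M i j = 1] (mod int q)"
  shows "kcount q k I J M = l * kcount q k (I - {i}) (J - {j}) (\<lambda>a b. M a b - c * M a j * M i b)"
proof -
  define S where "S a b = M a b - c * M a j * M i b" for a b
  define J' where "J' = J - {j}"
  define w where "w x = - c * (\<Sum>b\<in>J'. M i b * x b)" for x :: "nat \<Rightarrow> int"
  define kerS where "kerS x \<longleftrightarrow> (\<forall>a\<in>I-{i}. int k dvd (\<Sum>b\<in>J'. S a b * x b))" for x
  have fin': "finite J'" and J: "J = insert j J'" "j \<notin> J'" unfolding J'_def using fin ij by auto
  have inv': "[c * M i j = 1] (mod int k)" by (rule cong_dvd_modulus[OF inv]) (simp add: kq)
  have sumJ: "(\<Sum>b\<in>J. M a b * x b) = M a j * x j + (\<Sum>b\<in>J'. M a b * x b)" for a x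
    unfolding J(1) using fin' J(2) by simp
  have rowi: "int k dvd (\<Sum>b\<in>J. M i b * x b) \<longleftrightarrow> [x j = w x] (mod int k)" for x
  proof -
    define z where "z = (\<Sum>b\<in>J'. M i b * x b)"
    obtain t where t: "c * M i j = 1 + int k * t"
      using inv'[THEN cong_sym] unfolding cong_iff_lin by blast
    have "coprime c (int k)" unfolding coprime_iff_invertible_int using inv' by blast
    then have cop: "coprime (int k) c" by (simp add: coprime_commute)
    have "int k dvd M i j * x j + z \<longleftrightarrow> int k dvd c * (M i j * x j + z)"
      using cop by (simp add: coprime_dvd_mult_right_iff)
    also have "c * (M i j * x j + z) = (c * M i j) * x j + c * z" by (simp add: algebra_simps)
    also have "\<dots> = (x j - (- c * z)) + int k * (t * x j)" unfolding t by (simp add: algebra_simps)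
    also have "int k dvd \<dots> \<longleftrightarrow> int k dvd x j - (- c * z)" by (simp add: dvd_add_left_iff)
    also have "\<dots> \<longleftrightarrow> [x j = - c * z] (mod int k)" by (simp add: cong_iff_dvd_diff)
    finally show ?thesis unfolding sumJ w_def z_def .
  qed
  have other: "int k dvd (\<Sum>b\<in>J. M a b * x b) \<longleftrightarrow> int k dvd (\<Sum>b\<in>J'. S a b * x b)"
    if "[x j = w x] (mod int k)" for a x
  proof -
    have "[M a j * x j + (\<Sum>b\<in>J'. M a b * x b) = M a j * w x + (\<Sum>b\<in>J'. M a b * x b)] (mod int k)"
      by (intro cong_add cong_mult cong_refl that)
    also have "M a j * w x + (\<Sum>b\<in>J'. M a b * x b) = (\<Sum>b\<in>J'. S a b * x b)"
      unfolding w_def S_def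
      by (simp add: sum_distrib_left sum_subtractf left_diff_distrib sum_negf algebra_simps)
    finally show ?thesis unfolding sumJ by (rule cong_dvd_iff)
  qed
  have iff: "(\<forall>a\<in>I. int k dvd (\<Sum>b\<in>J. M a b * x b)) \<longleftrightarrow> [x j = w x] (mod int k) \<and> kerS x" for x
    unfolding kerS_def using rowi[of x] other[of x] ij(1) by auto
  have indep: "w (x(j := y)) = w x" "kerS (x(j := y)) = kerS x" for x y
  proof -
    have "(\<Sum>b\<in>J'. f b * (x(j := y)) b) = (\<Sum>b\<in>J'. f b * x b)" for f
      using J(2) by (intro sum.cong) auto
    then show "w (x(j := y)) = w x" "kerS (x(j := y)) = kerS x" unfolding w_def kerS_def by simp_all
  qed
  let ?V = "{0..<int q}"
  let ?Om = "funs J ?V"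
  have "card {x \<in> ?Om. [x j = w x] (mod int k) \<and> kerS x} * card ?V =
     (\<Sum>x\<in>?Om. card {y \<in> ?V. [y = w x] (mod int k) \<and> kerS x})"
    by (subst card_fibre[OF fin _ ij(2)]) (auto simp: indep)
  also have "\<dots> = (\<Sum>x\<in>?Om. if kerS x then l else 0)"
    using card_residue_class[OF kq(2), of l] unfolding kq(1) by (intro sum.cong) auto
  also have "\<dots> = l * card {x \<in> ?Om. kerS x}"
    using finite_dflt[OF fin, of ?V] by (simp add: sum.If_cases Int_def)
  \<comment> \<open>\<open>kerS\<close> does not involve \<open>x j\<close>, so counting over all of
    \<open>J\<close> gives an extra factor \<open>card ?V\<close>, cancelled below.\<close>
  also have "card {x \<in> ?Om. kerS x} = card ?V * card {x \<in> funs J' ?V. kerS x}"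
    unfolding J(1) by (rule card_free_coordinate[OF fin' _ J(2) indep(2)]) simp
  finally have "card {x \<in> ?Om. [x j = w x] (mod int k) \<and> kerS x} * card ?V =
     (l * card {x \<in> funs J' ?V. kerS x}) * card ?V" by (simp only: ac_simps)
  moreover have "card ?V \<noteq> 0" using kq by (simp del: of_nat_mult)
  ultimately have "card {x \<in> ?Om. [x j = w x] (mod int k) \<and> kerS x} = l * card {x \<in> funs J' ?V. kerS x}"
    by (auto simp only: mult_cancel2)
  then show ?thesis unfolding kcount_def res_vecs_def iff kerS_def S_def J'_def .
qed

lemma kcount_antimono:
  assumes "finite J" "k dvd k'"
  shows "kcount q k' I J M \<le> kcount q k I J M"
proof -
  have "int k dvd int k'" using assms(2) by simp
  then have "{x \<in> res_vecs q J. \<forall>a\<in>I. int k' dvd (\<Sum>b\<in>J. M a b * x b)} \<subseteq>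
      {x \<in> res_vecs q J. \<forall>a\<in>I. int k dvd (\<Sum>b\<in>J. M a b * x b)}"
    using dvd_trans by blast
  then show ?thesis
    unfolding kcount_def using finite_res_vecs[OF assms(1), of q]
    by (intro card_mono) auto
qed

text \<open>The counts of \<open>M\<close> and of the complement differ by the factor
  \<open>p ^ (e - t)\<close>, so each quotient of consecutive counts loses exactly one factor
  \<open>p\<close>. The guard \<open>1 \<le> a t\<close> compensates for the truncation of
  \<open>a t - 1\<close> at 0.\<close>

lemma kernel_event_pivot:
  assumes p: "prime p" and q: "q = p ^ e" and s: "s < e" and fin: "finite J" and ij: "i \<in> I" "j \<in> J"
    and inv: "[c * M i j = 1] (mod int q)" and r: "1 \<le> r"
  shows "kernel_event q p s a r I J M \<longleftrightarrow> (\<forall>t\<in>{1..s}. 1 \<le> a t) \<and>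
     kernel_event q p s (\<lambda>t. a t - 1) (r - 1) (I - {i}) (J - {j}) (\<lambda>a b. M a b - c * M a j * M i b)"
proof -
  define S where "S = (\<lambda>a b. M a b - c * M a j * M i b)"
  define K where "K t = kcount q (p ^ t) I J M" for t
  define L where "L t = kcount q (p ^ t) (I - {i}) (J - {j}) S" for t
  have p0: "0 < p" and p1: "1 < p" using prime_gt_0_nat[OF p] prime_gt_1_nat[OF p] by auto
  have KL: "K t = p ^ (e - t) * L t" if "t \<le> e" for t
    unfolding K_def L_def S_def
    by (rule kcount_pivot[where l = "p ^ (e - t)"])
      (use that p0 q fin ij inv in \<open>auto simp flip: power_add\<close>)
  have pos: "0 < L t" for t unfolding L_def by (rule kcount_pos) (use fin q p0 in auto)
  have anti: "L t \<le> L (t - 1)" for t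
    unfolding L_def by (rule kcount_antimono) (use fin in \<open>auto intro: le_imp_power_dvd\<close>)
  have step: "K (t - 1) = p ^ a t * K t \<longleftrightarrow> 1 \<le> a t \<and> L (t - 1) = p ^ (a t - 1) * L t" if t: "t \<in> {1..s}" for t
  proof -
    have e: "e - (t - 1) = Suc (e - t)" using t s by auto
    have "K (t - 1) = p ^ a t * K t \<longleftrightarrow> p ^ (e - t) * (p * L (t - 1)) = p ^ (e - t) * (p ^ a t * L t)"
      using KL[of t] KL[of "t - 1"] t s unfolding e by (simp only: power_Suc ac_simps) auto
    also have "\<dots> \<longleftrightarrow> p * L (t - 1) = p ^ a t * L t" using p0 by simp
    also have "\<dots> \<longleftrightarrow> 1 \<le> a t \<and> L (t - 1) = p ^ (a t - 1) * L t"
    proof (cases "a t")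
      case 0
      \<comment> \<open>With a unit present, the quotient of consecutive counts is at least
        \<open>p\<close>, so \<open>a t = 0\<close> cannot occur.\<close>
      have "L (t - 1) < p * L (t - 1)" using pos[of "t - 1"] p1 by simp
      then have "L t < p * L (t - 1)" using anti[of t] by (rule order_le_less_trans[rotated])
      then show ?thesis using 0 by simp
    next
      case (Suc b)
      then show ?thesis using p0 by (simp add: mult.assoc)
    qed
    finally show ?thesis .
  qed
  have last: "p ^ r * K (Suc s) \<le> K s \<longleftrightarrow> p ^ (r - 1) * L (Suc s) \<le> L s"
  proof -
    have e: "e - s = Suc (e - Suc s)" using s by simp
    have "p ^ r * K (Suc s) = (p ^ (e - Suc s) * p) * (p ^ (r - 1) * L (Suc s))"
      using KL[of "Suc s"] s r by (simp add: power_eq_if)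
    moreover have "K s = (p ^ (e - Suc s) * p) * L s" using KL[of s] s unfolding e by simp
    ultimately show ?thesis using p0 by simp
  qed
  show ?thesis
    unfolding kernel_event_def K_def[symmetric] L_def[symmetric] S_def[symmetric] last
    using step by blast
qed

text \<open>\<open>p M x\<close> vanishes modulo \<open>p ^ Suc t\<close> exactly when
  \<open>M x\<close> vanishes modulo \<open>p ^ t\<close>, and it always vanishes modulo
  \<open>p\<close>. So the first quotient of counts is 1 and the others move down one place, with
  \<open>q\<close> unchanged. For \<open>s = 0\<close> the rank modulo \<open>p\<close> is 0, which
  meets the bound only if \<open>r = 0\<close>.\<close>

lemma kernel_event_scale:
  assumes p: "prime p" and q: "0 < q" and fin: "finite J"
  shows "kernel_event q p (Suc s) a r I J (\<lambda>i j. int p * M i j) \<longleftrightarrow>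
     a 1 = 0 \<and> kernel_event q p s (\<lambda>t. a (Suc t)) r I J M"
    and "kernel_event q p 0 a r I J (\<lambda>i j. int p * M i j) \<longleftrightarrow> r = 0"
proof -
  have p0: "0 < p" and p1: "1 < p" using prime_gt_0_nat[OF p] prime_gt_1_nat[OF p] by auto
  define K where "K t = kcount q (p ^ t) I J (\<lambda>i j. int p * M i j)" for t
  define L where "L t = kcount q (p ^ t) I J M" for t
  have KL: "K (Suc t) = L t" for t
    unfolding K_def L_def kcount_def using p0 by (simp add: mult.assoc flip: sum_distrib_left)
  have K0: "K 0 = L 0" unfolding K_def L_def kcount_def by simp
  have pos: "0 < L t" for t unfolding L_def by (rule kcount_pos[OF fin q])
  have split: "(\<forall>t\<in>{1..Suc s}. P t) \<longleftrightarrow> P 1 \<and> (\<forall>t\<in>{1..s}. P (Suc t))" for P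
  proof (intro iffI ballI)
    fix t assume *: "P 1 \<and> (\<forall>t\<in>{1..s}. P (Suc t))" and t: "t \<in> {1..Suc s}"
    show "P t"
    proof (cases "t = 1")
      case False
      then have "t - 1 \<in> {1..s}" "t = Suc (t - 1)" using t by auto
      then show ?thesis using * by metis
    qed (use * in simp)
  qed auto
  have "kernel_event q p (Suc s) a r I J (\<lambda>i j. int p * M i j) \<longleftrightarrow>
     L 0 = p ^ a 1 * L 0 \<and> (\<forall>t\<in>{1..s}. K t = p ^ a (Suc t) * L t) \<and> p ^ r * L (Suc s) \<le> L s"
    unfolding kernel_event_def K_def[symmetric] split
    by (simp only: diff_Suc_1 diff_Suc_Suc diff_zero KL K0 diff_self_eq_0 One_nat_def conj_assoc)
  moreover have "K t = L (t - 1)" if "t \<in> {1..s}" for t using that KL[of "t - 1"] by simp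
  moreover have "L 0 = p ^ a 1 * L 0 \<longleftrightarrow> a 1 = 0"
    using pos[of 0] one_less_power[OF p1, of "a 1"] by (cases "a 1 = 0") auto
  ultimately show "kernel_event q p (Suc s) a r I J (\<lambda>i j. int p * M i j) \<longleftrightarrow>
     a 1 = 0 \<and> kernel_event q p s (\<lambda>t. a (Suc t)) r I J M"
    unfolding kernel_event_def L_def[symmetric] by simp
  have "kernel_event q p 0 a r I J (\<lambda>i j. int p * M i j) \<longleftrightarrow> p ^ r * L 0 \<le> 1 * L 0"
    unfolding kernel_event_def K_def[symmetric] by (simp add: KL K0 del: power_Suc)
  also have "\<dots> \<longleftrightarrow> r = 0"
    using pos[of 0] one_less_power[OF p1, of r] by (cases "r = 0") auto
  finally show "kernel_event q p 0 a r I J (\<lambda>i j. int p * M i j) \<longleftrightarrow> r = 0" .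
qed

lemma kernel_event_cong:
  assumes "q = p ^ e" "s < e" "\<And>a b. a \<in> I \<Longrightarrow> b \<in> J \<Longrightarrow> [M a b = N a b] (mod int q)"
  shows "kernel_event q p s a r I J M \<longleftrightarrow> kernel_event q p s a r I J N"
proof -
  have eq: "kcount q (p ^ t) I J M = kcount q (p ^ t) I J N" if "t \<le> Suc s" for t
  proof (rule kcount_cong)
    fix a b assume ab: "a \<in> I" "b \<in> J"
    have "int (p ^ t) dvd int q" unfolding assms(1) of_nat_dvd_iff
      using that assms(2) by (intro le_imp_power_dvd) auto
    then show "[M a b = N a b] (mod int (p ^ t))" using assms(3)[OF ab] cong_dvd_modulus by blast
  qed
  show ?thesis unfolding kernel_event_def
    by (intro conj_cong ball_cong refl) (auto simp del: power_Suc simp: eq)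
qed

section \<open>The local densities\<close>

text \<open>The probability that a uniform $n \times u$ matrix over the field with $p$ elements has rank $l$.\<close>

definition rank_prob :: "nat \<Rightarrow> nat \<Rightarrow> nat \<Rightarrow> nat \<Rightarrow> real" where
  "rank_prob p n u l = (if l \<le> u then 1 / real p ^ ((n - l) * (u - l)) *
     (pbracket p n * pbracket p u / (pbracket p (n - l) * pbracket p (u - l) * pbracket p l)) else 0)"

lemma pbracket_0 [simp]: "pbracket p 0 = 1"
  unfolding pbracket_def by simp

lemma pbracket_Suc: "pbracket p (Suc l) = pbracket p l * (1 - 1 / real p ^ Suc l)"
  unfolding pbracket_def by (simp add: prod.nat_ivl_Suc')

lemma pbracket_pos: "1 < p \<Longrightarrow> 0 < pbracket p l"
  unfolding pbracket_def by (rule prod_pos) (auto simp: one_less_power)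

lemma rank_prob_0_columns: "1 < p \<Longrightarrow> rank_prob p n 0 l = (if l = 0 then 1 else 0)"
  using pbracket_pos[of p n] unfolding rank_prob_def by auto

lemma rank_prob_recurrence_0:
  assumes p: "1 < p" and un: "Suc u \<le> n"
  shows "rank_prob p n (Suc u) 0 = 1 / real p ^ n * rank_prob p n u 0"
  using pbracket_pos[OF p, of n] pbracket_pos[OF p, of u] pbracket_pos[OF p, of "Suc u"] p
  unfolding rank_prob_def by (simp add: power_add)

text \<open>The counterpart of inspecting one column of a uniform matrix modulo \<open>p\<close>: it
  is nonzero with probability \<open>1 - 1 / p ^ Suc n\<close>, and elimination then removes it with
  one row and lowers the rank by one.\<close>

lemma rank_prob_recurrence_Suc:
  assumes p: "1 < p" and un: "Suc u \<le> Suc n"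
  shows "rank_prob p (Suc n) (Suc u) (Suc l) =
    (1 - 1 / real p ^ Suc n) * rank_prob p n u l + 1 / real p ^ Suc n * rank_prob p (Suc n) u (Suc l)"
proof -
  define x where "x = 1 / real p"
  have x: "1 / real p ^ k = x ^ k" for k unfolding x_def by (simp add: power_divide)
  have x1: "0 < x" "x < 1" unfolding x_def using p by auto
  have br: "pbracket p (Suc k) = pbracket p k * (1 - x ^ Suc k)" for k
    unfolding pbracket_Suc x by simp
  have pos: "0 < pbracket p k" for k by (rule pbracket_pos[OF p])
  have xne: "1 - x ^ Suc k \<noteq> 0" for k
    using power_less_one_iff[of x "Suc k"] x1 by (simp del: power_Suc)
  consider "u < l" | "u = l" | "l < u" by linarith
  then show ?thesis
  proof cases
    \<comment> \<open>For \<open>u = l\<close> the last summand is 0, since \<open>rank_prob\<close>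
      vanishes once the rank exceeds the number of columns.\<close>
    case 2
    then show ?thesis unfolding rank_prob_def x
      using pos[of l] pos[of n] pos[of "n - l"] xne[of l] xne[of n] by (simp add: br field_simps)
  next
    case 3
    obtain k where k: "u = l + Suc k" using 3 by (metis less_iff_Suc_add add_Suc_right)
    obtain h where h: "n = u + h" using un by (metis Suc_le_mono le_iff_add)
    define A where "A = pbracket p n"
    define B where "B = pbracket p u"
    define C where "C = pbracket p (n - l)"
    define D where "D = pbracket p k"
    define F where "F = pbracket p l"
    define y where "y = x ^ Suc l"
    define z where "z = x ^ Suc k"
    define e where "e = (n - l) * (u - l)"
    have nz: "A \<noteq> 0" "B \<noteq> 0" "C \<noteq> 0" "D \<noteq> 0" "F \<noteq> 0" unfolding A_def B_def C_def D_def F_def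
      using pos less_irrefl by metis+
    have yz: "x ^ Suc u = y * z" unfolding y_def z_def k by (simp flip: power_add add: ac_simps)
    have "1 - y \<noteq> 0" "1 - z \<noteq> 0" "1 - y * z \<noteq> 0"
      unfolding yz[symmetric] unfolding y_def z_def by (rule xne)+
    note nz = nz this
    have B1: "pbracket p (Suc u) = B * (1 - y * z)" unfolding br yz B_def ..
    have ul: "u - l = Suc k" using k by simp
    have C1: "pbracket p (u - l) = D * (1 - z)" unfolding ul br D_def z_def ..
    have F1: "pbracket p (Suc l) = F * (1 - y)" unfolding br F_def y_def ..
    have A1: "pbracket p (Suc n) = A * (1 - x ^ Suc n)" unfolding br A_def ..
    have L: "rank_prob p (Suc n) (Suc u) (Suc l) = x ^ e * (A * (1 - x ^ Suc n) * (B * (1 - y * z)) / (C * (D * (1 - z)) * (F * (1 - y))))"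
      using 3 unfolding rank_prob_def x A1 B1 F1 by (simp add: e_def C1 C_def)
    have R1: "rank_prob p n u l = x ^ e * (A * B / (C * (D * (1 - z)) * F))"
      using 3 unfolding rank_prob_def x C1 by (simp add: e_def A_def B_def C_def F_def)
    have "x ^ Suc n * x ^ ((n - l) * k) = x ^ e * y"
    proof -
      have "Suc n + (n - l) * k = e + Suc l"
        unfolding e_def ul using k h by (simp add: algebra_simps)
      then show ?thesis unfolding y_def by (metis power_add)
    qed
    moreover have "rank_prob p (Suc n) u (Suc l) = x ^ ((n - l) * k) * (A * (1 - x ^ Suc n) * B / (C * D * (F * (1 - y))))"
      using 3 k unfolding rank_prob_def x A1 F1 by (simp add: C_def D_def B_def)
    ultimately have R2: "x ^ Suc n * rank_prob p (Suc n) u (Suc l) = x ^ e * y * (A * (1 - x ^ Suc n) * B / (C * D * (F * (1 - y))))"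
      by (metis mult.assoc)
    \<comment> \<open>After cancelling common factors this is
      \<open>1 - y * z = (1 - y) + y * (1 - z)\<close>.\<close>
    show ?thesis
      unfolding x R2 L R1 using nz by (simp add: divide_simps) (simp add: algebra_simps)
  qed (simp add: rank_prob_def)
qed

text \<open>The arguments \<open>n u w\<close> stand for a random matrix with \<open>n\<close> rows, \<open>u\<close> columns of uniform entries and \<open>w\<close>
  columns of entries that are \<open>p\<close> times uniform ones. When no uniform column is left, \<open>p\<close> is divided out and the
  columns become uniform again.\<close>

primrec snf_prob :: "nat \<Rightarrow> nat \<Rightarrow> (nat \<Rightarrow> nat) \<Rightarrow> nat \<Rightarrow> nat \<Rightarrow> nat \<Rightarrow> nat \<Rightarrow> real" where
  "snf_prob p 0 a r n u w = 1 - (\<Sum>l<r. rank_prob p n u l)"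
| "snf_prob p (Suc s) a r n u w = rank_prob p n u (a 1) *
     snf_prob p s (\<lambda>t. a (Suc t) - a 1) (r - a 1) (n - a 1) (u + w - a 1) 0"

lemma snf_prob_no_columns:
  assumes "1 < p"
  shows "snf_prob p 0 a r n 0 w = (if r = 0 then 1 else 0)"
    and "snf_prob p (Suc s) a r n 0 w =
      (if a 1 = 0 then snf_prob p s (\<lambda>t. a (Suc t)) r n w 0 else 0)"
proof -
  have "(\<Sum>l<r. rank_prob p n 0 l) = (\<Sum>l<r. if l = 0 then 1 else 0)"
    by (intro sum.cong) (auto simp: rank_prob_0_columns[OF assms])
  then show "snf_prob p 0 a r n 0 w = (if r = 0 then 1 else 0)"
    by (cases r) (auto simp: sum.lessThan_Suc_shift simp del: sum.lessThan_Suc)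
  show "snf_prob p (Suc s) a r n 0 w =
      (if a 1 = 0 then snf_prob p s (\<lambda>t. a (Suc t)) r n w 0 else 0)"
    using rank_prob_0_columns[OF assms] by simp
qed

text \<open>The step for one uniform column. If it contains a unit, the column and a row go and
  every count drops by one; otherwise it joins the \<open>w\<close> columns carrying a factor
  \<open>p\<close>. For \<open>s > 0\<close> lowering all counts leaves the arguments of the deeper
  levels unchanged, so the claim reduces to the recurrence of \<open>rank_prob\<close>.\<close>

lemma snf_prob_recurrence:
  assumes p: "1 < p" and un: "Suc u \<le> n" and a: "\<And>t. t \<in> {1..s} \<Longrightarrow> a 1 \<le> a t" "s = 0 \<or> a 1 \<le> r"
    and r: "1 \<le> r"
  shows "snf_prob p s a r n (Suc u) w =
    (1 - 1 / real p ^ n) *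
      (if \<forall>t\<in>{1..s}. 1 \<le> a t then snf_prob p s (\<lambda>t. a t - 1) (r - 1) (n - 1) u w else 0)
    + 1 / real p ^ n * snf_prob p s a r n u (Suc w)"
proof -
  obtain n' where n: "n = Suc n'" using un by (cases n) auto
  have un': "Suc u \<le> Suc n'" using un n by simp
  show ?thesis
  proof (cases s)
    case 0
    obtain r' where r': "r = Suc r'" using r by (cases r) auto
    have "(\<Sum>l<r. rank_prob p n (Suc u) l) =
       rank_prob p n (Suc u) 0 + (\<Sum>l<r'. rank_prob p n (Suc u) (Suc l))"
      unfolding r' by (rule sum.lessThan_Suc_shift)
    also have "\<dots> = 1 / real p ^ n * rank_prob p n u 0 + (\<Sum>l<r'. (1 - 1 / real p ^ n) * rank_prob p n' u l
       + 1 / real p ^ n * rank_prob p n u (Suc l))"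
      unfolding rank_prob_recurrence_0[OF p un] by (simp only: rank_prob_recurrence_Suc[OF p un'] n)
    also have "\<dots> = (1 - 1 / real p ^ n) * (\<Sum>l<r'. rank_prob p n' u l)
        + 1 / real p ^ n * (rank_prob p n u 0 + (\<Sum>l<r'. rank_prob p n u (Suc l)))"
      by (simp only: sum.distrib sum_distrib_left distrib_left)
    also have "rank_prob p n u 0 + (\<Sum>l<r'. rank_prob p n u (Suc l)) = (\<Sum>l<r. rank_prob p n u l)"
      unfolding r' by (rule sum.lessThan_Suc_shift[symmetric])
    finally have S: "(\<Sum>l<r. rank_prob p n (Suc u) l) = (1 - 1 / real p ^ n) * (\<Sum>l<r - 1. rank_prob p (n - 1) u l)
       + 1 / real p ^ n * (\<Sum>l<r. rank_prob p n u l)" using r' n by (simp del: sum.lessThan_Suc)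
    have all: "\<forall>t\<in>{1..0::nat}. 1 \<le> a t" by simp
    show ?thesis unfolding 0 snf_prob.simps S if_P[OF all] by (simp add: algebra_simps)
  next
    case (Suc s')
    show ?thesis
    proof (cases "a 1")
      case 0
      \<comment> \<open>With \<open>a 1 = 0\<close> no unit may occur, so only the second summand
        survives.\<close>
      have "\<not> (\<forall>t\<in>{1..s}. 1 \<le> a t)" using 0 Suc by force
      then show ?thesis unfolding Suc using 0 rank_prob_recurrence_0[OF p un] by auto
    next
      case (Suc b)
      have all: "\<forall>t\<in>{1..s}. 1 \<le> a t"
      proof
        fix t assume "t \<in> {1..s}"
        then show "1 \<le> a t" using a(1)[of t] Suc by simp
      qed
      have br: "r - 1 - b = r - Suc b" "n - 1 - b = n - Suc b" "u + w - b = Suc u + w - Suc b" by simp_all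
      have sh: "(\<lambda>t. a (Suc t) - 1 - (a 1 - 1)) = (\<lambda>t. a (Suc t) - a 1)" using Suc by auto
      have "snf_prob p s (\<lambda>t. a t - 1) (r - 1) (n - 1) u w = rank_prob p n' u b *
         snf_prob p s' (\<lambda>t. a (Suc t) - a 1) (r - a 1) (n - a 1) (Suc u + w - a 1) 0"
        unfolding \<open>s = Suc s'\<close> snf_prob.simps sh using Suc n by simp
      moreover have "snf_prob p s a r n u (Suc w) = rank_prob p n u (Suc b) *
         snf_prob p s' (\<lambda>t. a (Suc t) - a 1) (r - a 1) (n - a 1) (Suc u + w - a 1) 0"
        unfolding \<open>s = Suc s'\<close> snf_prob.simps using Suc by simp
      moreover have "snf_prob p s a r n (Suc u) w = rank_prob p n (Suc u) (Suc b) *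
         snf_prob p s' (\<lambda>t. a (Suc t) - a 1) (r - a 1) (n - a 1) (Suc u + w - a 1) 0"
        unfolding \<open>s = Suc s'\<close> snf_prob.simps using Suc by simp
      ultimately show ?thesis
        using all rank_prob_recurrence_Suc[OF p un', of b] n by (simp add: algebra_simps)
    qed
  qed
qed

text \<open>The entries in \<open>B\<close> carry an additional factor \<open>p\<close>: they are the entries already conditioned to be non-units.\<close>

definition masked :: "nat \<Rightarrow> (nat \<times> nat) set \<Rightarrow> (nat \<times> nat \<Rightarrow> int) \<Rightarrow> nat \<Rightarrow> nat \<Rightarrow> int" where
  "masked p B f a b = (if (a, b) \<in> B then int p * f (a, b) else f (a, b))"

lemma kernel_event_coordinate_indep:
  assumes "\<not> (fst c \<in> I \<and> snd c \<in> J)"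
  shows "kernel_event q p s a r I J (masked p B (f(c := x))) = kernel_event q p s a r I J (masked p B f)"
proof -
  have "kcount q k I J (masked p B (f(c := x))) = kcount q k I J (masked p B f)" for k
    by (rule kcount_cong) (use assms in \<open>auto simp: masked_def\<close>)
  then show ?thesis unfolding kernel_event_def by simp
qed

lemma card_nonmultiples:
  assumes "0 < p" "0 < q'"
  shows "real (card {x \<in> {0..<int (p * q')}. \<not> int p dvd x}) / real (card {0..<int (p * q')}) = 1 - 1 / real p"
proof -
  let ?V = "{0..<int (p * q')}"
  have eq: "{x \<in> ?V. \<not> int p dvd x} = ?V - {x \<in> ?V. [x = 0] (mod int p)}" by (auto simp: cong_0_iff)
  have fin: "finite {x \<in> ?V. [x = 0] (mod int p)}" by (rule finite_subset[of _ ?V]) auto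
  have "card {x \<in> ?V. \<not> int p dvd x} = card ?V - card {x \<in> ?V. [x = 0] (mod int p)}"
    unfolding eq by (rule card_Diff_subset[OF fin]) blast
  also have "\<dots> = p * q' - q'" using card_residue_class[OF assms(1), of q' 0] by (simp del: of_nat_mult)
  finally have "real (card {x \<in> ?V. \<not> int p dvd x}) = real p * real q' - real q'"
    using assms by (simp add: of_nat_diff)
  moreover have "real (card ?V) = real p * real q'" by (simp del: of_nat_mult) simp
  ultimately show ?thesis using assms by (simp only:) (simp add: field_simps)
qed

lemma kernel_event_r_0:
  "finite J \<Longrightarrow> kernel_event q p 0 a 0 I J M"
  unfolding kernel_event_def using kcount_antimono[of J "p ^ 0" "p ^ Suc 0" q I M] by simp

text \<open>\<open>I0\<close>, \<open>J0\<close> and \<open>q\<close> give a sample space that is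
  kept while the event moves to smaller \<open>I\<close> and \<open>J\<close>. Entries outside
  \<open>I \<times> J\<close> are not looked at, so elimination requires no change of
  measure.\<close>

definition masked_prob :: "nat set \<Rightarrow> nat set \<Rightarrow> nat \<Rightarrow> nat \<Rightarrow> nat set \<Rightarrow> nat set \<Rightarrow> (nat \<times> nat) set \<Rightarrow>
    nat \<Rightarrow> (nat \<Rightarrow> nat) \<Rightarrow> nat \<Rightarrow> real" where
  "masked_prob I0 J0 q p I J B s a r =
     uprob (I0 \<times> J0) {0..<int q} (\<lambda>f. kernel_event q p s a r I J (masked p B f))"

lemma kernel_event_eq:
  assumes "\<And>a b. a \<in> I \<Longrightarrow> b \<in> J \<Longrightarrow> M a b = N a b"
  shows "kernel_event q p s a r I J M = kernel_event q p s a r I J N"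
proof -
  have "kcount q k I J M = kcount q k I J N" for k
    by (rule kcount_cong) (use assms in auto)
  then show ?thesis unfolding kernel_event_def by simp
qed

lemma masked_prob_mask_cong:
  assumes "\<And>a b. a \<in> I \<Longrightarrow> b \<in> J \<Longrightarrow> (a, b) \<in> B \<longleftrightarrow> (a, b) \<in> B'"
  shows "masked_prob I0 J0 q p I J B s a r = masked_prob I0 J0 q p I J B' s a r"
  unfolding masked_prob_def
  by (intro uprob_cong kernel_event_eq) (use assms in \<open>auto simp: masked_def\<close>)

text \<open>When the entry at \<open>(i, j)\<close> is a unit, eliminating with it replaces the other rows by their Schur complement. For a
  fixed pivot row and column this is a translation, so it preserves the uniform distribution.\<close>

lemma masked_prob_step:
  assumes p: "prime p" and q: "q = p ^ e" and s: "s < e" and fin: "finite I0" "finite J0"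
    and I: "i \<in> I" "I \<subseteq> I0" and J: "j \<in> J" "J \<subseteq> J0" and ij: "(i, j) \<notin> B" and r: "1 \<le> r"
    and B: "\<And>a b. a \<in> I - {i} \<Longrightarrow> b \<in> J - {j} \<Longrightarrow> (a, b) \<in> B \<longleftrightarrow> (i, b) \<in> B"
  shows "masked_prob I0 J0 q p I J B s a r =
    (1 - 1 / real p) * (if \<forall>t\<in>{1..s}. 1 \<le> a t
       then masked_prob I0 J0 q p (I - {i}) (J - {j}) B s (\<lambda>t. a t - 1) (r - 1) else 0)
    + 1 / real p * masked_prob I0 J0 q p I J (insert (i, j) B) s a r"
proof -
  let ?A = "I0 \<times> J0" and ?V = "{0..<int q}"
  let ?Om = "funs ?A ?V"
  let ?c = "(i, j)"
  have p0: "0 < p" using prime_gt_0_nat[OF p] .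
  obtain e' where e': "e = Suc e'" using s by (cases e) auto
  define q' where "q' = p ^ e'"
  have qq: "q = p * q'" "0 < q'" "0 < q" unfolding q q'_def e' using p0 by auto
  have finA: "finite ?A" and cA: "?c \<in> ?A" using fin I J by auto
  have finJ: "finite J" using J fin finite_subset by blast
  define E where "E f \<longleftrightarrow> kernel_event q p s a r I J (masked p B f)" for f
  define E' where "E' f \<longleftrightarrow> kernel_event q p s (\<lambda>t. a t - 1) (r - 1) (I - {i}) (J - {j}) (masked p B f)" for f
  define C where "C \<longleftrightarrow> (\<forall>t\<in>{1..s}. 1 \<le> a t)"
  define \<kappa> where "\<kappa> x = (SOME k. [k * x = 1] (mod int q))" for x
  have \<kappa>: "[\<kappa> x * x = 1] (mod int q)" if "\<not> int p dvd x" for x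
  proof -
    have "prime (int p)" using p by simp
    then have "coprime (int p) x" using that by (rule prime_imp_coprime)
    then have "coprime x (int q)" unfolding q by (simp add: coprime_commute)
    then obtain k where "[x * k = 1] (mod int q)" using cong_solve_coprime_int by blast
    then have "[k * x = 1] (mod int q)" by (simp add: mult.commute)
    then show ?thesis unfolding \<kappa>_def by (rule someI)
  qed
  \<comment> \<open>\<open>T\<close> reads row \<open>i\<close> and column \<open>j\<close>, which
    it leaves alone, so for fixed values there it is a translation of the rest. The row entry is
    taken without its mask: by the hypothesis on \<open>B\<close>, \<open>(a, b)\<close> and
    \<open>(i, b)\<close> carry the same factor \<open>p\<close>, which can be taken out of the
    Schur complement.\<close>
  define T where "T f = (\<lambda>(a, b). if a \<in> I - {i} \<and> b \<in> J - {j}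
     then (f (a, b) - \<kappa> (f ?c) * masked p B f a j * f (i, b)) mod int q else f (a, b))" for f
  have T_mem: "T f \<in> ?Om" if "f \<in> ?Om" for f
    using that I J qq unfolding T_def PiE_dflt_def by auto
  have T_row: "T f (i, b) = f (i, b)" "T f (b, j) = f (b, j)" for f b
    unfolding T_def by auto
  have T_inj: "inj_on T ?Om"
  proof (rule inj_onI)
    fix f g assume f: "f \<in> ?Om" and g: "g \<in> ?Om" and eq: "T f = T g"
    have row: "f (i, b) = g (i, b)" "f (b, j) = g (b, j)" for b
      using T_row[of f b] T_row[of g b] eq by auto
    show "f = g"
    proof
      fix x :: "nat \<times> nat"
      obtain a b where x: "x = (a, b)" by (cases x)
      show "f x = g x"
      proof (cases "a \<in> I - {i} \<and> b \<in> J - {j}")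
        case True
        have m: "masked p B f a j = masked p B g a j" unfolding masked_def row by simp
        have "T f x = T g x" using eq by simp
        then have "[f x - \<kappa> (f ?c) * masked p B f a j * f (i, b) = g x - \<kappa> (f ?c) * masked p B f a j * f (i, b)] (mod int q)"
          unfolding T_def x using True by (simp add: row m cong_def)
        then have "[f x = g x] (mod int q)" by (simp add: cong_diff_iff_cong_0 cong_iff_dvd_diff)
        moreover have "x \<in> ?A" using True I J unfolding x by auto
        then have "f x \<in> ?V" "g x \<in> ?V" using f g unfolding PiE_dflt_def by blast+
        ultimately show ?thesis by (simp add: cong_def)
      next
        case False
        then show ?thesis using fun_cong[OF eq, of x] unfolding T_def x by auto
      qed
    qed
  qed
  have T_E: "E f \<longleftrightarrow> C \<and> E' (T f)" if "\<not> int p dvd f ?c" for f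
  proof -
    have inv: "[\<kappa> (f ?c) * masked p B f i j = 1] (mod int q)"
      using \<kappa>[OF that] ij by (simp add: masked_def)
    have "E f \<longleftrightarrow> C \<and> kernel_event q p s (\<lambda>t. a t - 1) (r - 1) (I - {i}) (J - {j})
        (\<lambda>a b. masked p B f a b - \<kappa> (f ?c) * masked p B f a j * masked p B f i b)"
      unfolding E_def C_def
      by (rule kernel_event_pivot[where M = "masked p B f" and c = "\<kappa> (f ?c)", OF p q s finJ I(1) J(1) inv r])
    also have "kernel_event q p s (\<lambda>t. a t - 1) (r - 1) (I - {i}) (J - {j})
        (\<lambda>a b. masked p B f a b - \<kappa> (f ?c) * masked p B f a j * masked p B f i b) \<longleftrightarrow> E' (T f)"
      unfolding E'_def
    proof (rule kernel_event_cong[OF q s])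
      fix a b assume ab: "a \<in> I - {i}" "b \<in> J - {j}"
      let ?k = "\<kappa> (f ?c) * masked p B f a j"
      have Tab: "[T f (a, b) = f (a, b) - ?k * f (i, b)] (mod int q)"
        unfolding T_def using ab by (simp add: cong_def)
      show "[masked p B f a b - ?k * masked p B f i b = masked p B (T f) a b] (mod int q)"
      proof (cases "(a, b) \<in> B")
        case True
        then have "masked p B f a b - ?k * masked p B f i b = int p * (f (a, b) - ?k * f (i, b))"
          using B[OF ab] by (simp add: masked_def algebra_simps)
        moreover have "masked p B (T f) a b = int p * T f (a, b)" using True by (simp add: masked_def)
        ultimately show ?thesis using cong_mult[OF cong_refl Tab] cong_sym by metis
      next
        case False
        then have "masked p B f a b - ?k * masked p B f i b = f (a, b) - ?k * f (i, b)"
          using B[OF ab] by (simp add: masked_def)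
        moreover have "masked p B (T f) a b = T f (a, b)" using False by (simp add: masked_def)
        ultimately show ?thesis using Tab cong_sym by metis
      qed
    qed
    finally show ?thesis .
  qed
  \<comment> \<open>\<open>T\<close> keeps the pivot, so the test for a unit commutes with the
    change of variables. Afterwards the event ignores row \<open>i\<close> and column
    \<open>j\<close>, hence is independent of the pivot.\<close>
  have "uprob ?A ?V (\<lambda>f. \<not> int p dvd f ?c \<and> E f) = uprob ?A ?V (\<lambda>f. \<not> int p dvd f ?c \<and> (C \<and> E' f))"
    by (rule uprob_bij[OF finA _ T_mem T_inj]) (use T_E T_row in auto)
  also have "\<dots> = (1 - 1 / real p) * uprob ?A ?V (\<lambda>f. C \<and> E' f)"
    unfolding card_nonmultiples[OF p0 qq(2), folded qq(1), symmetric]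
  proof (rule uprob_indep_coordinate[OF finA _ cA])
    show "(C \<and> E' (f(?c := x))) = (C \<and> E' f)" for f x
      unfolding E'_def using kernel_event_coordinate_indep[of ?c "I - {i}" "J - {j}"] by simp
  qed (use qq in auto)
  also have "uprob ?A ?V (\<lambda>f. C \<and> E' f) = (if C then masked_prob I0 J0 q p (I - {i}) (J - {j}) B s (\<lambda>t. a t - 1) (r - 1) else 0)"
    unfolding masked_prob_def E'_def by (simp add: uprob_False)
  finally have part1: "uprob ?A ?V (\<lambda>f. \<not> int p dvd f ?c \<and> E f) =
     (1 - 1 / real p) * (if C then masked_prob I0 J0 q p (I - {i}) (J - {j}) B s (\<lambda>t. a t - 1) (r - 1) else 0)" .
  have "uprob ?A ?V (\<lambda>f. int p dvd f ?c \<and> E f) = 1 / real p * uprob ?A ?V (\<lambda>f. E (f(?c := int p * f ?c mod int q)))"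
    by (rule uprob_scale_coordinate[OF finA cA qq(1) p0 qq(2)])
  also have "uprob ?A ?V (\<lambda>f. E (f(?c := int p * f ?c mod int q))) = masked_prob I0 J0 q p I J (insert ?c B) s a r"
    unfolding masked_prob_def E_def
    by (intro uprob_cong kernel_event_cong[OF q s]) (use ij in \<open>auto simp: masked_def cong_def\<close>)
  finally have part2: "uprob ?A ?V (\<lambda>f. int p dvd f ?c \<and> E f) = 1 / real p * masked_prob I0 J0 q p I J (insert ?c B) s a r" .
  have "masked_prob I0 J0 q p I J B s a r = uprob ?A ?V (\<lambda>f. int p dvd f ?c \<and> E f) + uprob ?A ?V (\<lambda>f. \<not> int p dvd f ?c \<and> E f)"
    unfolding masked_prob_def E_def by (rule uprob_split[OF finA]) simp
  then show ?thesis unfolding part1 part2 C_def by simp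
qed

text \<open>When the entries of column \<open>j\<close> are tested one by one, the first unit found
  leads to the same value \<open>x\<close> whichever row it lies in. Only the absence of units, of
  probability \<open>1 / p ^ card I\<close>, has to be separated.\<close>

lemma masked_prob_column:
  assumes p: "prime p" and q: "q = p ^ e" and s: "s < e" and fin: "finite I0" "finite J0"
    and I: "I \<subseteq> I0" and J: "j \<in> J" "J \<subseteq> J0" and W: "j \<notin> W" and r: "1 \<le> r"
    and x: "\<And>i. i \<in> I \<Longrightarrow> (if \<forall>t\<in>{1..s}. 1 \<le> a t
       then masked_prob I0 J0 q p (I - {i}) (J - {j}) ((I - {i}) \<times> W) s (\<lambda>t. a t - 1) (r - 1) else 0) = x"
  shows "masked_prob I0 J0 q p I J (I \<times> W) s a r =
    (1 - 1 / real p ^ card I) * x + 1 / real p ^ card I * masked_prob I0 J0 q p I J (I \<times> insert j W) s a r"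
proof -
  have finI: "finite I" using I fin finite_subset by blast
  have p0: "real p \<noteq> 0" using prime_gt_0_nat[OF p] by simp
  \<comment> \<open>\<open>A\<close> holds the rows not yet tested; the entries of column
    \<open>j\<close> in the other rows are known non-units and carry the factor
    \<open>p\<close>.\<close>
  have "masked_prob I0 J0 q p I J (I \<times> W \<union> (I - A) \<times> {j}) s a r =
    (1 - 1 / real p ^ card A) * x + 1 / real p ^ card A * masked_prob I0 J0 q p I J (I \<times> insert j W) s a r"
    if "A \<subseteq> I" for A
    using finite_subset[OF that finI] that
  proof (induction A rule: finite_induct)
    case empty
    have "I \<times> W \<union> (I - {}) \<times> {j} = I \<times> insert j W" by auto
    then show ?case by simp
  next
    case (insert i A)
    let ?B = "I \<times> W \<union> (I - insert i A) \<times> {j}"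
    let ?M = "masked_prob I0 J0 q p I J (I \<times> insert j W) s a r"
    have i: "i \<in> I" using insert by simp
    have "masked_prob I0 J0 q p I J ?B s a r =
      (1 - 1 / real p) * (if \<forall>t\<in>{1..s}. 1 \<le> a t
       then masked_prob I0 J0 q p (I - {i}) (J - {j}) ?B s (\<lambda>t. a t - 1) (r - 1) else 0)
       + 1 / real p * masked_prob I0 J0 q p I J (Set.insert (i, j) ?B) s a r"
      by (rule masked_prob_step[OF p q s fin i I J _ r]) (use W i in auto)
    also have "masked_prob I0 J0 q p (I - {i}) (J - {j}) ?B s (\<lambda>t. a t - 1) (r - 1)
       = masked_prob I0 J0 q p (I - {i}) (J - {j}) ((I - {i}) \<times> W) s (\<lambda>t. a t - 1) (r - 1)"
      by (rule masked_prob_mask_cong) auto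
    also have "Set.insert (i, j) ?B = I \<times> W \<union> (I - A) \<times> {j}" using i insert by auto
    also note insert.IH
    also note x[OF i]
    finally have "masked_prob I0 J0 q p I J ?B s a r = (1 - 1 / real p) * x +
       1 / real p * ((1 - 1 / real p ^ card A) * x + 1 / real p ^ card A * ?M)"
      using insert.prems by simp
    also have "\<dots> = (1 - 1 / real p ^ Suc (card A)) * x + 1 / real p ^ Suc (card A) * ?M"
      using p0 by (simp add: field_simps)
    finally show ?case unfolding card_insert_disjoint[OF insert.hyps] .
  qed
  from this[of I] show ?thesis by simp
qed

text \<open>The uniform columns \<open>U\<close> are used up one by one while \<open>W\<close>
  collects the finished ones. What happens once \<open>U\<close> is empty is left to
  \<open>base\<close>, so that one induction serves both \<open>s = 0\<close> and positive
  \<open>s\<close>.\<close>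

lemma masked_prob_columns_induct:
  assumes p: "prime p" and q: "q = p ^ e" and s: "s < e" and fin: "finite I0" "finite J0"
    and base: "\<And>I W a r. \<lbrakk>I \<subseteq> I0; W \<subseteq> J0; card W \<le> card I; \<And>t t'. 1 \<le> t \<Longrightarrow> t \<le> t' \<Longrightarrow> t' \<le> s \<Longrightarrow> a t \<le> a t';
      s = 0 \<or> a s < r\<rbrakk> \<Longrightarrow> masked_prob I0 J0 q p I W (I \<times> W) s a r = snf_prob p s a r (card I) 0 (card W)"
    and I: "I \<subseteq> I0" and J: "U \<union> W \<subseteq> J0" "U \<inter> W = {}" and le: "card U + card W \<le> card I"
    and a: "\<And>t t'. 1 \<le> t \<Longrightarrow> t \<le> t' \<Longrightarrow> t' \<le> s \<Longrightarrow> a t \<le> a t'" "s = 0 \<or> a s < r"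
  shows "masked_prob I0 J0 q p I (U \<union> W) (I \<times> W) s a r = snf_prob p s a r (card I) (card U) (card W)"
  using I J le a
proof (induction "card U" arbitrary: r I U W a)
  case (0 U r I W a)
  then have U: "U = {}" using fin finite_subset by (metis Un_subset_iff card_eq_0_iff)
  have "masked_prob I0 J0 q p I W (I \<times> W) s a r = snf_prob p s a r (card I) 0 (card W)"
    by (rule base) (use 0 U in auto)
  then show ?case unfolding U by simp
next
  case (Suc u U r I W a)
  have finU: "finite U" "finite W" "finite I" using Suc.prems fin finite_subset by auto
  obtain j where j: "j \<in> U" using Suc(2) by fastforce
  have cU: "card (U - {j}) = u" using Suc(2) j by simp
  have j': "j \<notin> W" using j Suc.prems by auto
  have Uj: "U \<union> W = (U - {j}) \<union> insert j W" using j by auto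
  have a1: "a 1 \<le> a t" if "t \<in> {1..s}" for t using Suc.prems(5)[of 1 t] that by auto
  have ar: "s = 0 \<or> a 1 \<le> r" using a1[of s] Suc.prems(6) by (cases "s = 0") auto
  let ?C = "\<forall>t\<in>{1..s}. 1 \<le> a t"
  show ?case
  \<comment> \<open>The pivot step requires \<open>1 \<le> r\<close>. For \<open>r = 0\<close> the
    bound \<open>a s < r\<close> leaves only \<open>s = 0\<close>, where the event is
    certain.\<close>
  proof (cases "r = 0")
    case True
    then have "s = 0" using Suc.prems(6) by auto
    moreover have "finite (U \<union> W)" using finU by simp
    ultimately have "masked_prob I0 J0 q p I (U \<union> W) (I \<times> W) s a r = 1"
      unfolding masked_prob_def True using fin q prime_gt_0_nat[OF p]
      by (simp add: kernel_event_r_0 uprob_True)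
    then show ?thesis using True \<open>s = 0\<close> by simp
  next
    case r: False
    have x: "(if ?C
       then masked_prob I0 J0 q p (I - {i}) (U \<union> W - {j}) ((I - {i}) \<times> W) s (\<lambda>t. a t - 1) (r - 1) else 0) =
       (if ?C then snf_prob p s (\<lambda>t. a t - 1) (r - 1) (card I - 1) u (card W) else 0)" if i: "i \<in> I" for i
    proof (cases ?C)
      case C: True
      have dec: "s = 0 \<or> a s - 1 < r - 1" using C Suc.prems(6) by (cases "s = 0") (auto simp: diff_less_mono)
      have "masked_prob I0 J0 q p (I - {i}) ((U - {j}) \<union> W) ((I - {i}) \<times> W) s (\<lambda>t. a t - 1) (r - 1) =
         snf_prob p s (\<lambda>t. a t - 1) (r - 1) (card (I - {i})) (card (U - {j})) (card W)"
        by (rule Suc(1)) (use cU Suc.prems i Suc(2) dec in \<open>auto intro: diff_le_mono\<close>)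
      moreover have "U \<union> W - {j} = (U - {j}) \<union> W" using j' by auto
      moreover have "card (I - {i}) = card I - 1" using i by simp
      ultimately show ?thesis unfolding cU by (simp only:)
    next
      case False
      then show ?thesis by (simp only: if_False)
    qed
    have "masked_prob I0 J0 q p I (U \<union> W) (I \<times> W) s a r =
       (1 - 1 / real p ^ card I) * (if ?C then snf_prob p s (\<lambda>t. a t - 1) (r - 1) (card I - 1) u (card W) else 0) +
       1 / real p ^ card I * masked_prob I0 J0 q p I (U \<union> W) (I \<times> insert j W) s a r"
      by (rule masked_prob_column[OF p q s fin Suc.prems(1) _ Suc.prems(2) j' _ x]) (use j r in auto)
    also have "masked_prob I0 J0 q p I (U \<union> W) (I \<times> insert j W) s a r =
       masked_prob I0 J0 q p I ((U - {j}) \<union> insert j W) (I \<times> insert j W) s a r"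
      by (subst Uj) (rule refl)
    also have "\<dots> = snf_prob p s a r (card I) (card (U - {j})) (card (insert j W))"
      by (rule Suc(1)) (use cU Suc.prems j j' Suc(2) finU in auto)
    finally show ?thesis
      using snf_prob_recurrence[OF prime_gt_1_nat[OF p], of u "card I" s a r "card W", OF _ a1 ar]
        Suc.prems(4) Suc(2) r cU finU j' by (simp del: snf_prob.simps)
  qed
qed

text \<open>Induction on \<open>s\<close> with \<open>q\<close> fixed. Once all columns are masked,
  their common factor \<open>p\<close> is divided out. For positive \<open>s\<close> this demands
  \<open>a 1 = 0\<close>, shifts \<open>a\<close> and makes all columns uniform again; for
  \<open>s = 0\<close> the rank modulo \<open>p\<close> is 0.\<close>

lemma masked_prob_eq_snf_prob:
  assumes p: "prime p" and q: "q = p ^ e" and s: "s < e" and fin: "finite I0" "finite J0"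
    and I: "I \<subseteq> I0" and J: "U \<union> W \<subseteq> J0" "U \<inter> W = {}" and le: "card U + card W \<le> card I"
    and a: "\<And>t t'. 1 \<le> t \<Longrightarrow> t \<le> t' \<Longrightarrow> t' \<le> s \<Longrightarrow> a t \<le> a t'" "s = 0 \<or> a s < r"
  shows "masked_prob I0 J0 q p I (U \<union> W) (I \<times> W) s a r = snf_prob p s a r (card I) (card U) (card W)"
  using s I J le a
proof (induction s arbitrary: a r I U W)
  have q0: "0 < q" using q prime_gt_0_nat[OF p] by simp
  have scaled: "kernel_event q p s a r I W (masked p (I \<times> W) f) \<longleftrightarrow>
      kernel_event q p s a r I W (\<lambda>i j. int p * masked p {} f i j)" for s a r I W f
    by (rule kernel_event_eq) (auto simp: masked_def)
  {
    case (0 a r I U W)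
    show ?case
    proof (rule masked_prob_columns_induct[where a = a, OF p q 0(1) fin _ 0(2-7)])
      fix I W :: "nat set" and a :: "nat \<Rightarrow> nat" and r assume "W \<subseteq> J0"
      then have finW: "finite W" using fin finite_subset by auto
      show "masked_prob I0 J0 q p I W (I \<times> W) 0 a r = snf_prob p 0 a r (card I) 0 (card W)"
        unfolding masked_prob_def scaled kernel_event_scale(2)[OF p q0 finW] snf_prob_no_columns[OF prime_gt_1_nat[OF p]]
        using fin q0 by (simp add: uprob_True uprob_False)
    qed
  next
    case (Suc s a r I U W)
    show ?case
    proof (rule masked_prob_columns_induct[where a = a, OF p q Suc.prems(1) fin _ Suc.prems(2-7)])
      fix I W :: "nat set" and a :: "nat \<Rightarrow> nat" and r
      assume I: "I \<subseteq> I0" and W: "W \<subseteq> J0" "card W \<le> card I"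
        and a: "\<And>t t'. 1 \<le> t \<Longrightarrow> t \<le> t' \<Longrightarrow> t' \<le> Suc s \<Longrightarrow> a t \<le> a t'" "Suc s = 0 \<or> a (Suc s) < r"
      have finW: "finite W" using W fin finite_subset by auto
      have "masked_prob I0 J0 q p I W (I \<times> W) (Suc s) a r =
        (if a 1 = 0 then masked_prob I0 J0 q p I (W \<union> {}) (I \<times> {}) s (\<lambda>t. a (Suc t)) r else 0)"
        unfolding masked_prob_def scaled kernel_event_scale(1)[OF p q0 finW] by (simp add: uprob_False)
      also have "masked_prob I0 J0 q p I (W \<union> {}) (I \<times> {}) s (\<lambda>t. a (Suc t)) r =
         snf_prob p s (\<lambda>t. a (Suc t)) r (card I) (card W) (card ({} :: nat set))"
        by (rule Suc.IH) (use I W a Suc.prems(1) in auto)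
      finally show "masked_prob I0 J0 q p I W (I \<times> W) (Suc s) a r = snf_prob p (Suc s) a r (card I) 0 (card W)"
        unfolding snf_prob_no_columns[OF prime_gt_1_nat[OF p]] by simp
    qed
  }
qed

section \<open>Closed form of the recursion\<close>

lemma prod_from_1_Suc:
  fixes f :: "nat \<Rightarrow> 'a :: comm_monoid_mult"
  shows "(\<Prod>i=1..Suc s. f i) = f 1 * (\<Prod>i=1..s. f (Suc i))"
  by (subst prod.atLeast_Suc_atMost) (auto simp: prod.shift_bounds_cl_Suc_ivl simp del: prod.cl_ivl_Suc)

lemma sum_from_1_Suc:
  fixes f :: "nat \<Rightarrow> 'a :: comm_monoid_add"
  shows "(\<Sum>i=1..Suc s. f i) = f 1 + (\<Sum>i=1..s. f (Suc i))"
  by (subst sum.atLeast_Suc_atMost) (auto simp: sum.shift_bounds_cl_Suc_ivl simp del: sum.cl_ivl_Suc)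

text \<open>Level \<open>t\<close> contributes \<open>rank_prob p (n - a (t - 1)) (m - a (t - 1)) (a
  t - a (t - 1))\<close>, and the brackets of sizes \<open>n - a t\<close> and
  \<open>m - a t\<close> cancel between neighbouring levels. The last factor stands for rank at
  least \<open>r - a s\<close> in what remains.\<close>

lemma snf_prob_telescope:
  assumes p: "1 < p" and a0: "a 0 = 0" and mono: "\<And>t t'. t \<le> t' \<Longrightarrow> t' \<le> s \<Longrightarrow> a t \<le> a t'"
    and am: "a s \<le> m" and mn: "m \<le> n"
  shows "snf_prob p s a r n m 0 =
    1 / real p ^ (\<Sum>i=1..s. (n - a i) * (m - a i)) *
    (pbracket p n * pbracket p m / (pbracket p (n - a s) * pbracket p (m - a s) * (\<Prod>i=1..s. pbracket p (a i - a (i - 1))))) *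
    (1 - (\<Sum>l<r - a s. rank_prob p (n - a s) (m - a s) l))"
  using a0 mono am mn
proof (induction s arbitrary: a r n m)
  case 0
  then show ?case using pbracket_pos[OF p, of n] pbracket_pos[OF p, of m] by simp
next
  case (Suc s a r n m)
  let ?b = "\<lambda>t. a (Suc t) - a 1"
  have a1: "a 1 \<le> a t" if "1 \<le> t" "t \<le> Suc s" for t using Suc.prems(2)[of 1 t] that by simp
  have am1: "a 1 \<le> m" using a1[of "Suc s"] Suc.prems(3) by simp
  have b: "n - a 1 - ?b t = n - a (Suc t)" "m - a 1 - ?b t = m - a (Suc t)" "r - a 1 - ?b t = r - a (Suc t)"
    if "t \<le> s" for t using a1[of "Suc t"] that by auto
  have IH: "snf_prob p s ?b (r - a 1) (n - a 1) (m - a 1) 0 =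
    1 / real p ^ (\<Sum>i=1..s. (n - a 1 - ?b i) * (m - a 1 - ?b i)) *
    (pbracket p (n - a 1) * pbracket p (m - a 1) / (pbracket p (n - a 1 - ?b s) * pbracket p (m - a 1 - ?b s) * (\<Prod>i=1..s. pbracket p (?b i - ?b (i - 1))))) *
    (1 - (\<Sum>l<r - a 1 - ?b s. rank_prob p (n - a 1 - ?b s) (m - a 1 - ?b s) l))"
  proof (rule Suc.IH)
    show "?b s \<le> m - a 1" using Suc.prems(3) a1[of "Suc s"] by simp
    show "n - a 1 \<ge> m - a 1" using Suc.prems(4) by simp
    show "?b t \<le> ?b t'" if "t \<le> t'" "t' \<le> s" for t t'
      using Suc.prems(2)[of "Suc t" "Suc t'"] that by (intro diff_le_mono) auto
  qed simp
  have s1: "(\<Sum>i=1..s. (n - a 1 - ?b i) * (m - a 1 - ?b i)) = (\<Sum>i=1..s. (n - a (Suc i)) * (m - a (Suc i)))"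
    by (rule sum.cong) (simp_all only: b atLeastAtMost_iff)
  have s2: "(\<Prod>i=1..s. pbracket p (?b i - ?b (i - 1))) = (\<Prod>i=1..s. pbracket p (a (Suc i) - a (Suc i - 1)))"
  proof (rule prod.cong)
    fix i assume i: "i \<in> {1..s}"
    have "?b i - ?b (i - 1) = a (Suc i) - a (Suc i - 1)"
      using a1[of i] a1[of "Suc i"] i by auto
    then show "pbracket p (?b i - ?b (i - 1)) = pbracket p (a (Suc i) - a (Suc i - 1))" by simp
  qed simp
  have pos: "pbracket p k \<noteq> 0" for k using pbracket_pos[OF p, of k] by simp
  define X where "X = (\<Sum>i=1..s. (n - a (Suc i)) * (m - a (Suc i)))"
  define Y where "Y = (\<Prod>i=1..s. pbracket p (a (Suc i) - a (Suc i - 1)))"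
  define Z where "Z = 1 - (\<Sum>l<r - a (Suc s). rank_prob p (n - a (Suc s)) (m - a (Suc s)) l)"
  have R: "rank_prob p n m (a 1) = 1 / real p ^ ((n - a 1) * (m - a 1)) *
     (pbracket p n * pbracket p m / (pbracket p (n - a 1) * pbracket p (m - a 1) * pbracket p (a 1)))"
    unfolding rank_prob_def using am1 by simp
  have "snf_prob p (Suc s) a r n m 0 = rank_prob p n m (a 1) *
     (1 / real p ^ X * (pbracket p (n - a 1) * pbracket p (m - a 1) / (pbracket p (n - a (Suc s)) * pbracket p (m - a (Suc s)) * Y)) * Z)"
    unfolding snf_prob.simps add_0_right IH s1 s2 X_def Y_def Z_def b[OF order_refl] ..
  also have "\<dots> = 1 / real p ^ ((n - a 1) * (m - a 1) + X) *
    (pbracket p n * pbracket p m / (pbracket p (n - a (Suc s)) * pbracket p (m - a (Suc s)) * (pbracket p (a 1 - a 0) * Y))) * Z"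
    unfolding R power_add Suc.prems(1) using pos by (simp add: divide_simps)
  finally show ?case
    unfolding prod_from_1_Suc sum_from_1_Suc X_def Y_def Z_def by simp
qed

text \<open>Multiplying \<open>rank_prob p (n - a s) (m - a s) (l - a s)\<close> by the common
  prefactor cancels the brackets of sizes \<open>n - a s\<close> and \<open>m - a s\<close>; the sum
  is the telescoped one with the index shifted by \<open>a s\<close>.\<close>

lemma snf_prob_formula:
  assumes p: "1 < p" and a0: "a 0 = 0" and mono: "\<And>t t'. t \<le> t' \<Longrightarrow> t' \<le> s \<Longrightarrow> a t \<le> a t'"
    and ar: "a s < r" and rm: "r \<le> m" and mn: "m \<le> n"
  shows "snf_prob p s a r n m 0 =
     1 / real p ^ (\<Sum>i=1..s. (n - a i) * (m - a i))
        * (pbracket p n * pbracket p m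
           / (pbracket p (n - a s) * pbracket p (m - a s)
              * (\<Prod>i=1..s. pbracket p (a i - a (i - 1)))))
      - (\<Sum>l=a s..r - 1.
          1 / real p ^ ((n - l) * (m - l) + (\<Sum>i=1..s. (n - a i) * (m - a i)))
            * (pbracket p n * pbracket p m
               / (pbracket p (n - l) * pbracket p (m - l) * pbracket p (l - a s)
                  * (\<Prod>i=1..s. pbracket p (a i - a (i - 1))))))"
proof -
  define X where "X = (\<Sum>i=1..s. (n - a i) * (m - a i))"
  define Y where "Y = (\<Prod>i=1..s. pbracket p (a i - a (i - 1)))"
  define A where "A = a s"
  define K where "K = 1 / real p ^ X * (pbracket p n * pbracket p m / (pbracket p (n - A) * pbracket p (m - A) * Y))"
  have pos: "pbracket p k \<noteq> 0" for k using pbracket_pos[OF p, of k] by simp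
  have Am: "A < r" "A \<le> m" unfolding A_def using ar rm by auto
  have "(\<Sum>l=A..r - 1. 1 / real p ^ ((n - l) * (m - l) + X)
     * (pbracket p n * pbracket p m / (pbracket p (n - l) * pbracket p (m - l) * pbracket p (l - A) * Y)))
    = (\<Sum>l<r - A. K * rank_prob p (n - A) (m - A) l)"
  proof (rule sum.reindex_bij_witness[of _ "\<lambda>l. l + A" "\<lambda>l. l - A"])
    fix l assume l: "l \<in> {A..r - 1}"
    then have l': "l - A \<le> m - A" using rm Am by auto
    have e: "n - A - (l - A) = n - l" "m - A - (l - A) = m - l" using l by auto
    show "K * rank_prob p (n - A) (m - A) (l - A) = 1 / real p ^ ((n - l) * (m - l) + X)
     * (pbracket p n * pbracket p m / (pbracket p (n - l) * pbracket p (m - l) * pbracket p (l - A) * Y))"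
      unfolding rank_prob_def if_P[OF l'] e K_def power_add using pos by (simp add: divide_simps)
  qed (use Am in auto)
  then have "K - (\<Sum>l=A..r - 1. 1 / real p ^ ((n - l) * (m - l) + X)
     * (pbracket p n * pbracket p m / (pbracket p (n - l) * pbracket p (m - l) * pbracket p (l - A) * Y)))
    = K * (1 - (\<Sum>l<r - A. rank_prob p (n - A) (m - A) l))"
    by (simp add: right_diff_distrib sum_distrib_left)
  moreover have "snf_prob p s a r n m 0 = K * (1 - (\<Sum>l<r - A. rank_prob p (n - A) (m - A) l))"
    unfolding K_def A_def X_def Y_def
    by (rule snf_prob_telescope[where a = a, OF p a0 mono Am(2)[unfolded A_def] mn])
  ultimately show ?thesis
    unfolding K_def A_def X_def Y_def by (simp only:)
qed

section \<open>Random residue matrices and uniform counts\<close>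

lemma prob_Pi_pmf_eq_uprob: "finite I \<Longrightarrow> finite V \<Longrightarrow> V \<noteq> {} \<Longrightarrow>
    measure_pmf.prob (Pi_pmf I 0 (\<lambda>_. pmf_of_set V)) {f. E f} = uprob I V E"
proof -
  assume fin: "finite I" "finite V" and V: "V \<noteq> {}"
  have ne: "funs I V \<noteq> {}"
  proof -
    obtain v where "v \<in> V" using V by blast
    then have "(\<lambda>x. if x \<in> I then v else 0) \<in> funs I V" unfolding PiE_dflt_def by auto
    then show ?thesis by blast
  qed
  have "Pi_pmf I 0 (\<lambda>_. pmf_of_set V) = pmf_of_set (funs I V)"
    by (rule Pi_pmf_of_set) (use fin V in auto)
  then show ?thesis
    unfolding uprob_def using measure_pmf_of_set[OF ne finite_dflt[OF fin], of "{f. E f}"]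
    by (simp add: Int_def)
qed

lemma random_mat_prob:
  assumes "finite V" "V \<noteq> {}"
    and E: "\<And>M. M \<in> carrier_mat n m \<Longrightarrow> E M \<longleftrightarrow> E' (\<lambda>i j. M $$ (i, j))"
    and E': "\<And>M N. (\<And>i j. i < n \<Longrightarrow> j < m \<Longrightarrow> M i j = N i j) \<Longrightarrow> E' M = E' N"
  shows "measure_pmf.prob (random_mat n m V) {M. E M} =
    uprob ({..<n} \<times> {..<m}) V (\<lambda>f. E' (\<lambda>i j. f (i, j)))"
proof -
  have "E (mat n m f) \<longleftrightarrow> E' (\<lambda>i j. f (i, j))" for f
    by (subst E) (auto intro!: E')
  then have "(mat n m) -` {M. E M} = {f. E' (\<lambda>i j. f (i, j))}" by auto
  then show ?thesis
    unfolding random_mat_def measure_map_pmf by (simp add: prob_Pi_pmf_eq_uprob assms(1,2))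
qed

lemma a_tilde_mono:
  assumes "t \<le> t'"
  shows "a_tilde r d p t \<le> a_tilde r d p t'"
  unfolding a_tilde_def
  by (rule card_mono) (use assms in \<open>auto intro: dvd_trans le_imp_power_dvd\<close>)

lemma a_tilde_0: "a_tilde r d p 0 = 0"
  unfolding a_tilde_def by simp

lemma a_tilde_less:
  assumes "1 \<le> r" "p ^ t dvd d r"
  shows "a_tilde r d p t < r"
proof -
  have "{t' \<in> {1..r}. \<not> p ^ t dvd d t'} \<subseteq> {1..<r}" using assms by (auto simp: le_less)
  then have "a_tilde r d p t \<le> card {1..<r}" unfolding a_tilde_def by (intro card_mono) auto
  then show ?thesis using assms(1) by simp
qed

lemma mu_mod_eq_uprob:
  assumes p: "prime p" and q: "q = p ^ Suc s" and rmn: "1 \<le> r" "r \<le> m" "m \<le> n"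
    and dpos: "\<And>i. i \<in> {1..r} \<Longrightarrow> 0 < d i"
    and d: "\<And>i. i \<in> {1..<r} \<Longrightarrow> d i dvd d (Suc i)" and dr: "p ^ s dvd d r" "\<not> p ^ Suc s dvd d r"
  shows "mu_mod q n m (prescribed n m r d) = uprob ({..<n} \<times> {..<m}) {0..<int q}
    (\<lambda>f. kernel_event q p s (a_tilde r d p) r {..<n} {..<m} (\<lambda>i j. f (i, j)))"
  unfolding mu_mod_def
proof (rule random_mat_prob)
  show "{0..<int q} \<noteq> {}" using q prime_gt_0_nat[OF p] by simp
  show "kernel_event q p s (a_tilde r d p) r {..<n} {..<m} M = kernel_event q p s (a_tilde r d p) r {..<n} {..<m} N"
    if "\<And>i j. i < n \<Longrightarrow> j < m \<Longrightarrow> M i j = N i j" for M N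
    by (rule kernel_event_eq) (use that in auto)
  show "(\<exists>D\<in>prescribed n m r d. \<exists>E. is_SNF_mod q n m M E \<and>
          (\<forall>i<m. \<exists>u. coprime u (int q) \<and> [D $$ (i, i) = u * E $$ (i, i)] (mod int q)))
     \<longleftrightarrow> kernel_event q p s (a_tilde r d p) r {..<n} {..<m} (\<lambda>i j. M $$ (i,j))"
    if "M \<in> carrier_mat n m" for M
    using mod_event_iff[OF p q rmn dpos d dr that] by blast
qed simp

lemma mu_mod_eq_snf_prob:
  assumes p: "prime p" and rmn: "1 \<le> r" "r \<le> m" "m \<le> n"
    and dpos: "\<And>i. i \<in> {1..r} \<Longrightarrow> 0 < d i"
    and d: "\<And>i. i \<in> {1..<r} \<Longrightarrow> d i dvd d (Suc i)" and dr: "p ^ s dvd d r" "\<not> p ^ Suc s dvd d r"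
  shows "mu_mod (p ^ Suc s) n m (prescribed n m r d) = snf_prob p s (a_tilde r d p) r n m 0"
proof -
  define a where "a = a_tilde r d p"
  have "mu_mod (p ^ Suc s) n m (prescribed n m r d) =
     masked_prob {..<n} {..<m} (p ^ Suc s) p {..<n} ({..<m} \<union> {}) ({..<n} \<times> {}) s a r"
    using mu_mod_eq_uprob[OF p refl rmn dpos d dr]
    unfolding masked_prob_def a_def masked_def by simp
  also have "\<dots> = snf_prob p s a r (card {..<n}) (card {..<m}) (card ({} :: nat set))"
  proof (rule masked_prob_eq_snf_prob[OF p refl])
    show "s = 0 \<or> a s < r" unfolding a_def using a_tilde_less[of r p s d] rmn(1) dr(1) by blast
  qed (use rmn a_tilde_mono in \<open>auto simp: a_def\<close>)
  finally show ?thesis unfolding a_def by simp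
qed

section \<open>Large primes\<close>

text \<open>The minors of the rows \<open>0, \<dots>, r\<close> except \<open>i\<close> and the columns \<open>0, \<dots>, r - 1\<close>.\<close>

definition minor :: "(nat \<times> nat \<Rightarrow> int) \<Rightarrow> nat \<Rightarrow> nat \<Rightarrow> int" where
  "minor f r i = det (mat r r (\<lambda>(a, b). f (if a < i then a else Suc a, b)))"

text \<open>The prime is not bounded from above, so it may exceed the size of the entries. For
  \<open>r > 0\<close> there are at least two minors, the source of a second factor
  \<open>1 / p\<close>.\<close>

definition bad_prime :: "nat \<Rightarrow> nat \<Rightarrow> (nat \<times> nat \<Rightarrow> int) \<Rightarrow> bool" where
  "bad_prime r N f \<longleftrightarrow> (\<exists>p. prime p \<and> N < p \<and> (\<forall>i\<le>r. int p dvd minor f r i))"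

section \<open>Minors as affine functions of a single entry\<close>

lemma det_update_entry:
  fixes A :: "int mat"
  assumes A: "A \<in> carrier_mat n n" and ij: "i < n" "j < n"
  shows "det (mat n n (\<lambda>(a, b). if (a, b) = (i, j) then x else A $$ (a, b))) =
    x * cofactor A i j + det (mat n n (\<lambda>(a, b). if (a, b) = (i, j) then 0 else A $$ (a, b)))"
proof -
  define B where "B y = mat n n (\<lambda>(a, b). if (a, b) = (i, j) then y else A $$ (a, b))" for y
  have B: "B y \<in> carrier_mat n n" for y unfolding B_def by simp
  have "mat_delete (B y) i b = mat_delete A i b" for y b
    unfolding mat_delete_def B_def using A by (intro cong_mat) auto
  then have cof: "cofactor (B y) i b = cofactor A i b" for y b unfolding cofactor_def by simp
  have ent: "B y $$ (i, b) = (if b = j then y else A $$ (i, b))" if "b < n" for y b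
    unfolding B_def using that ij by simp
  have "det (B y) = y * cofactor A i j + (\<Sum>b\<in>{..<n}-{j}. A $$ (i, b) * cofactor A i b)" for y
  proof -
    have "det (B y) = (\<Sum>b<n. B y $$ (i, b) * cofactor A i b)"
      unfolding laplace_expansion_row[OF B ij(1)] cof ..
    also have "\<dots> = B y $$ (i, j) * cofactor A i j + (\<Sum>b\<in>{..<n}-{j}. B y $$ (i, b) * cofactor A i b)"
      using ij by (subst sum.remove[of _ j]) auto
    also have "(\<Sum>b\<in>{..<n}-{j}. B y $$ (i, b) * cofactor A i b) = (\<Sum>b\<in>{..<n}-{j}. A $$ (i, b) * cofactor A i b)"
      by (intro sum.cong) (auto simp: ent)
    finally show ?thesis using ent[OF ij(2)] by simp
  qed
  from this[of x] this[of 0] show ?thesis unfolding B_def by simp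
qed

lemma minor_cong:
  assumes "\<And>a b. a \<le> r \<Longrightarrow> b < r \<Longrightarrow> a \<noteq> i \<Longrightarrow> f (a, b) = g (a, b)"
  shows "minor f r i = minor g r i"
proof -
  have "mat r r (\<lambda>(a, b). f (if a < i then a else Suc a, b)) = mat r r (\<lambda>(a, b). g (if a < i then a else Suc a, b))"
    by (intro cong_mat) (use assms in auto)
  then show ?thesis unfolding minor_def by simp
qed

lemma minor_0: "minor f 0 i = 1"
  unfolding minor_def by (simp add: det_def)

text \<open>The entry \<open>(Suc r, r)\<close> is the lower right corner of this minor, because the
  omitted row \<open>i\<close> lies above it; its cofactor is the smaller minor with positive
  sign.\<close>

lemma minor_update_last_row:
  assumes "i \<le> r"
  shows "minor (f((Suc r, r) := x)) (Suc r) i = minor f r i * x + minor (f((Suc r, r) := 0)) (Suc r) i"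
proof -
  define A where "A = mat (Suc r) (Suc r) (\<lambda>(a, b). f (if a < i then a else Suc a, b))"
  have A: "A \<in> carrier_mat (Suc r) (Suc r)" unfolding A_def by simp
  have upd: "minor (f((Suc r, r) := y)) (Suc r) i =
    det (mat (Suc r) (Suc r) (\<lambda>(a, b). if (a, b) = (r, r) then y else A $$ (a, b)))" for y
    unfolding minor_def A_def by (intro arg_cong[of _ _ det] cong_mat) (use assms in auto)
  have "mat_delete A r r = mat r r (\<lambda>(a, b). f (if a < i then a else Suc a, b))"
    unfolding mat_delete_def A_def by (auto intro!: cong_mat)
  then have "cofactor A r r = minor f r i"
    unfolding cofactor_def minor_def by (simp flip: mult_2)
  then show ?thesis unfolding upd using det_update_entry[OF A, of r r x] by simp
qed

text \<open>Here row \<open>Suc r\<close> is omitted and row \<open>i\<close> is present; the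
  cofactor of the last entry of row \<open>i\<close> is again the smaller minor without that row.
  Thus two minors have the same slope up to sign, in two different entries.\<close>

lemma minor_update_last_column:
  assumes "i \<le> r"
  shows "minor (f((i, r) := x)) (Suc r) (Suc r) =
    ((- 1) ^ (i + r) * minor f r i) * x + minor (f((i, r) := 0)) (Suc r) (Suc r)"
proof -
  define A where "A = mat (Suc r) (Suc r) (\<lambda>(a, b). f (a, b))"
  have A: "A \<in> carrier_mat (Suc r) (Suc r)" unfolding A_def by simp
  have upd: "minor (f((i, r) := y)) (Suc r) (Suc r) =
    det (mat (Suc r) (Suc r) (\<lambda>(a, b). if (a, b) = (i, r) then y else A $$ (a, b)))" for y
    unfolding minor_def A_def by (intro arg_cong[of _ _ det] cong_mat) auto
  have "mat_delete A i r = mat r r (\<lambda>(a, b). f (if a < i then a else Suc a, b))"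
    unfolding mat_delete_def A_def by (auto intro!: cong_mat)
  then have "cofactor A i r = (- 1) ^ (i + r) * minor f r i"
    unfolding cofactor_def minor_def by simp
  then show ?thesis unfolding upd using det_update_entry[OF A, of i r x] assms by simp
qed

lemma abs_minor_le:
  assumes "\<And>a b. a \<le> r \<Longrightarrow> b < r \<Longrightarrow> \<bar>f (a, b)\<bar> \<le> int k"
  shows "\<bar>minor f r i\<bar> \<le> int (fact r * k ^ r)"
proof -
  let ?A = "mat r r (\<lambda>(a, b). f (if a < i then a else Suc a, b))"
  have "\<bar>minor f r i\<bar> = \<bar>\<Sum>\<pi> | \<pi> permutes {0..<r}. of_int (sign \<pi>) * (\<Prod>a = 0..<r. ?A $$ (a, \<pi> a))\<bar>"
    unfolding minor_def det_def by simp
  also have "\<dots> \<le> (\<Sum>\<pi> | \<pi> permutes {0..<r}. \<bar>of_int (sign \<pi>) * (\<Prod>a = 0..<r. ?A $$ (a, \<pi> a))\<bar>)"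
    by (rule sum_abs)
  also have "\<dots> \<le> (\<Sum>\<pi> | \<pi> permutes {0..<r}. int k ^ r)"
  proof (rule sum_mono)
    fix \<pi> assume "\<pi> \<in> {\<pi>. \<pi> permutes {0..<r}}"
    then have \<pi>: "\<pi> a < r" if "a < r" for a using that permutes_in_image[of \<pi> "{0..<r}" a] by auto
    have "\<bar>of_int (sign \<pi>) * (\<Prod>a = 0..<r. ?A $$ (a, \<pi> a))\<bar> = (\<Prod>a = 0..<r. \<bar>?A $$ (a, \<pi> a)\<bar>)"
      by (simp add: abs_mult abs_prod sign_def)
    also have "\<dots> \<le> (\<Prod>a = 0..<r. int k)"
      by (rule prod_mono) (use \<pi> assms in \<open>auto\<close>)
    finally show "\<bar>of_int (sign \<pi>) * (\<Prod>a = 0..<r. ?A $$ (a, \<pi> a))\<bar> \<le> int k ^ r" by simp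
  qed
  also have "\<dots> = int (fact r * k ^ r)"
    by (simp add: card_permutations[of _ r])
  finally show ?thesis .
qed

lemma prod_primes_dvd_nat:
  fixes n :: nat
  assumes "finite S" "\<And>p. p \<in> S \<Longrightarrow> prime p" "\<And>p. p \<in> S \<Longrightarrow> p dvd n"
  shows "(\<Prod>p\<in>S. p) dvd n"
  using assms
proof (induction S rule: finite_induct)
  case (insert p S)
  have "coprime p (\<Prod>p\<in>S. p)"
    using insert by (intro prod_coprime_right primes_coprime) auto
  then show ?case using insert by (simp add: divides_mult)
qed simp

text \<open>The product of these primes divides \<open>D\<close>, and each factor exceeds
  \<open>k\<close>.\<close>

lemma card_large_prime_divisors:
  fixes D :: int and k t :: nat
  assumes "D \<noteq> 0" "\<bar>D\<bar> \<le> int (k ^ t)" "1 \<le> k"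
  shows "finite {p. prime p \<and> k < p \<and> int p dvd D}" "card {p. prime p \<and> k < p \<and> int p dvd D} \<le> t"
proof -
  let ?S = "{p. prime p \<and> k < p \<and> int p dvd D}"
  have D: "nat \<bar>D\<bar> \<noteq> 0" using assms by simp
  have sub: "?S \<subseteq> prime_factors (nat \<bar>D\<bar>)"
    using D by (auto simp: prime_factors_dvd nat_dvd_iff abs_dvd_iff)
  then show fin: "finite ?S" by (rule finite_subset) simp
  have "(\<Prod>p\<in>?S. p) dvd nat \<bar>D\<bar>"
    by (rule prod_primes_dvd_nat[OF fin]) (simp_all add: nat_dvd_iff abs_dvd_iff flip: int_dvd_int_iff)
  then have "(\<Prod>p\<in>?S. p) \<le> nat \<bar>D\<bar>" using D by (intro dvd_imp_le) auto
  moreover have "(\<Prod>p\<in>?S. Suc k) \<le> (\<Prod>p\<in>?S. p)" by (rule prod_mono) auto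
  ultimately have "Suc k ^ card ?S \<le> nat \<bar>D\<bar>" by simp
  also have "\<dots> \<le> k ^ t" using assms by (simp add: nat_le_iff)
  also have "\<dots> \<le> Suc k ^ t" by (rule power_mono) auto
  finally show "card ?S \<le> t" using assms(3) power_le_imp_le_exp[of "Suc k" "card ?S" t] by simp
qed

text \<open>The solutions lie in a single class modulo \<open>p\<close>, so each block of
  \<open>p\<close> consecutive integers holds at most one, and the interval meets
  \<open>2 * k div p + 1\<close> blocks.\<close>

lemma card_linear_congruence:
  fixes v c :: int and p k :: nat
  assumes p: "prime p" and v: "\<not> int p dvd v"
  shows "card {x \<in> {- int k..int k}. int p dvd v * x + c} \<le> 2 * k div p + 1"
proof -
  let ?S = "{x \<in> {- int k..int k}. int p dvd v * x + c}"
  have p0: "0 < p" using prime_gt_0_nat[OF p] .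
  have "inj_on (\<lambda>x. (x + int k) div int p) ?S"
  proof (rule inj_onI)
    fix x y assume x: "x \<in> ?S" and y: "y \<in> ?S" and eq: "(x + int k) div int p = (y + int k) div int p"
    have "int p dvd (v * x + c) - (v * y + c)" using x y by (intro dvd_diff) auto
    then have "int p dvd v * (x - y)" by (simp add: algebra_simps)
    then have "int p dvd x - y" using p v by (auto simp: prime_dvd_mult_iff)
    then have "int p dvd (x + int k) - (y + int k)" by simp
    then have "(x + int k) mod int p = (y + int k) mod int p" by (simp add: mod_eq_dvd_iff)
    then have "x + int k = y + int k" using eq by (metis div_mult_mod_eq)
    then show "x = y" by simp
  qed
  moreover have "(\<lambda>x. (x + int k) div int p) ` ?S \<subseteq> {0..int (2 * k div p)}"
  proof (rule image_subsetI)
    fix x assume x: "x \<in> ?S"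
    have "(x + int k) div int p \<le> int (2 * k) div int p" using x p0 by (intro zdiv_mono1) auto
    then show "(x + int k) div int p \<in> {0..int (2 * k div p)}"
      using x p0 by (simp add: pos_imp_zdiv_nonneg_iff zdiv_int)
  qed
  ultimately have "card ?S \<le> card {0..int (2 * k div p)}" by (intro card_inj_on_le) auto
  then show ?thesis by simp
qed


section \<open>Probability bounds in the box\<close>

lemma uprob_mono:
  assumes "finite A" "finite V" "\<And>f. f \<in> funs A V \<Longrightarrow> E f \<Longrightarrow> F f"
  shows "uprob A V E \<le> uprob A V F"
  unfolding uprob_def
  by (intro divide_right_mono of_nat_mono card_mono) (use assms finite_dflt[OF assms(1,2)] in auto)

lemma uprob_disj:
  assumes "finite A" "finite V"
  shows "uprob A V (\<lambda>f. E f \<or> F f) \<le> uprob A V E + uprob A V F"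
proof -
  have "{f \<in> funs A V. E f \<or> F f} = {f \<in> funs A V. E f} \<union> {f \<in> funs A V. F f}"
    by blast
  then have "card {f \<in> funs A V. E f \<or> F f} \<le>
     card {f \<in> funs A V. E f} + card {f \<in> funs A V. F f}"
    by (simp add: card_Un_le)
  then have "real (card {f \<in> funs A V. E f \<or> F f}) \<le>
     real (card {f \<in> funs A V. E f}) + real (card {f \<in> funs A V. F f})"
    by linarith
  then show ?thesis unfolding uprob_def by (simp add: divide_right_mono flip: add_divide_distrib)
qed

lemma uprob_Bex:
  assumes "finite A" "finite V" "finite S"
  shows "uprob A V (\<lambda>f. \<exists>x\<in>S. E x f) \<le> (\<Sum>x\<in>S. uprob A V (E x))"
  using assms(3)
proof (induction S rule: finite_induct)
  case (insert x S)
  have "uprob A V (\<lambda>f. \<exists>y\<in>insert x S. E y f) = uprob A V (\<lambda>f. E x f \<or> (\<exists>y\<in>S. E y f))" by simp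
  also have "\<dots> \<le> uprob A V (E x) + uprob A V (\<lambda>f. \<exists>y\<in>S. E y f)" by (rule uprob_disj[OF assms(1,2)])
  finally show ?case using insert by simp
qed (simp add: uprob_False)

text \<open>\<open>F\<close> retains a condition that can be bounded through another coordinate
  next, so such estimates can be chained over several entries.\<close>

lemma uprob_fibre_le:
  assumes "finite A" "finite V" "c \<in> A" "V \<noteq> {}"
    and bound: "\<And>f. f \<in> funs A V \<Longrightarrow> card {x \<in> V. E (f(c := x))} \<le> (if F f then h else 0)"
  shows "uprob A V E \<le> real h / real (card V) * uprob A V F"
proof -
  let ?Om = "funs A V"
  have "card {f \<in> ?Om. E f} * card V = (\<Sum>f\<in>?Om. card {x \<in> V. E (f(c := x))})"
    by (rule card_fibre[OF assms(1-3)])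
  also have "\<dots> \<le> (\<Sum>f\<in>?Om. if F f then h else 0)" by (rule sum_mono) (rule bound)
  also have "\<dots> = h * card {f \<in> ?Om. F f}"
    using finite_dflt[OF assms(1,2)] by (simp add: sum.If_cases Int_def)
  finally have le: "card {f \<in> ?Om. E f} * card V \<le> h * card {f \<in> ?Om. F f}" .
  have "real (card {f \<in> ?Om. E f}) * real (card V) \<le> real h * real (card {f \<in> ?Om. F f})"
    using of_nat_mono[OF le, where 'a = real] by (simp only: of_nat_mult)
  moreover have "0 < real (card V)" using assms by (simp add: card_gt_0_iff)
  ultimately have "real (card {f \<in> ?Om. E f}) \<le> real h / real (card V) * real (card {f \<in> ?Om. F f})"
    by (simp add: field_simps)
  from divide_right_mono[OF this, of "real (card ?Om)"] show ?thesis unfolding uprob_def by simp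
qed

abbreviation sym_interval :: "nat \<Rightarrow> int set" where "sym_interval k \<equiv> {- int k..int k}"

text \<open>Telescoping with \<open>1 / p ^ 2 \<le> 1 / (p - 1) - 1 / p\<close>.\<close>

lemma sum_inverse_squares_le:
  assumes "1 \<le> N" "N \<le> k"
  shows "(\<Sum>p\<in>{N<..k}. 1 / real p ^ 2) \<le> 1 / real N - 1 / real k"
  using assms(2)
proof (induction k rule: dec_induct)
  case (step k)
  have k: "0 < real k" using assms step by simp
  have "1 / real (Suc k) ^ 2 \<le> 1 / real k - 1 / real (Suc k)"
    using k by (simp add: divide_simps power2_eq_square)
  moreover have "{N<..Suc k} = insert (Suc k) {N<..k}" using step by auto
  ultimately show ?case using step by simp
qed simp

definition bad_step :: "nat \<Rightarrow> nat \<Rightarrow> nat \<Rightarrow> (nat \<times> nat \<Rightarrow> int) \<Rightarrow> bool" where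
  "bad_step p r i f \<longleftrightarrow> \<not> int p dvd minor f r i \<and> int p dvd minor f (Suc r) (Suc r) \<and> int p dvd minor f (Suc r) i"

text \<open>The entry \<open>(Suc r, r)\<close> enters the minor without row \<open>i\<close> but
  not the one without row \<open>Suc r\<close>, so it is integrated out first and
  \<open>(i, r)\<close> afterwards. Both times the slope is, up to sign, the minor prime to
  \<open>p\<close>, and each congruence gives a factor \<open>2 / p\<close>.\<close>

lemma uprob_two_congruences:
  assumes r: "Suc r < n" "r < m" and i: "i \<le> r" and p: "prime p" "p \<le> k"
  shows "uprob ({..<n} \<times> {..<m}) (sym_interval k) (bad_step p r i) \<le> 4 * (1 / real p ^ 2)"
proof -
  let ?A = "{..<n} \<times> {..<m}" and ?V = "sym_interval k"
  define h where "h = 2 * k div p + 1"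
  have fin: "finite ?A" "finite ?V" and V: "?V \<noteq> {}" by auto
  have p0: "0 < p" using p prime_gt_0_nat by blast
  \<comment> \<open>\<open>p \<le> k\<close> absorbs the additive 1 in \<open>h\<close>:
    \<open>h * p \<le> 2 * k + p \<le> 2 * (2 * k + 1)\<close>.\<close>
  have h: "real h / real (card ?V) \<le> 2 / real p"
  proof -
    have "2 * k div p * p \<le> 2 * k" by (rule div_times_less_eq_dividend)
    then have "real (2 * k div p * p) \<le> real (2 * k)" by (rule of_nat_mono)
    then have "real (2 * k div p) * real p \<le> real (2 * k)" by (simp only: of_nat_mult)
    then have "real h * real p \<le> real (2 * k) + real p"
      unfolding h_def of_nat_add distrib_right by simp
    also have "\<dots> \<le> 2 * real (2 * k + 1)" using p(2) by simp
    finally have "real h * real p \<le> 2 * real (card ?V)" by simp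
    then show ?thesis using p0 by (simp add: field_simps)
  qed
  have 1: "uprob ?A ?V (bad_step p r i)
    \<le> real h / real (card ?V) * uprob ?A ?V (\<lambda>f. \<not> int p dvd minor f r i \<and> int p dvd minor f (Suc r) (Suc r))"
    unfolding bad_step_def[abs_def]
  proof (rule uprob_fibre_le[OF fin, where c = "(Suc r, r)"])
    fix f :: "nat \<times> nat \<Rightarrow> int"
    let ?f = "\<lambda>x. f((Suc r, r) := x)"
    have m1: "minor (?f x) r i = minor f r i" for x by (rule minor_cong) auto
    have m2: "minor (?f x) (Suc r) (Suc r) = minor f (Suc r) (Suc r)" for x by (rule minor_cong) auto
    define c0 where "c0 = minor (?f 0) (Suc r) i"
    have m3: "minor (?f x) (Suc r) i = minor f r i * x + c0" for x
      unfolding c0_def by (rule minor_update_last_row[OF i])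
    show "card {x \<in> ?V. \<not> int p dvd minor (?f x) r i \<and>
       int p dvd minor (?f x) (Suc r) (Suc r) \<and> int p dvd minor (?f x) (Suc r) i}
       \<le> (if \<not> int p dvd minor f r i \<and> int p dvd minor f (Suc r) (Suc r) then h else 0)"
    proof (cases "\<not> int p dvd minor f r i \<and> int p dvd minor f (Suc r) (Suc r)")
      case True
      have "{x \<in> ?V. \<not> int p dvd minor (?f x) r i \<and> int p dvd minor (?f x) (Suc r) (Suc r) \<and> int p dvd minor (?f x) (Suc r) i}
        = {x \<in> ?V. int p dvd minor f r i * x + c0}"
        unfolding m1 m2 m3 using True by auto
      then show ?thesis using True card_linear_congruence[OF p(1), of "minor f r i" k] unfolding h_def by simp
    qed (auto simp: m1 m2)
  qed (use r V in auto)
  have 2: "uprob ?A ?V (\<lambda>f. \<not> int p dvd minor f r i \<and> int p dvd minor f (Suc r) (Suc r))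
    \<le> real h / real (card ?V) * uprob ?A ?V (\<lambda>f. True)"
  proof (rule uprob_fibre_le[OF fin, of "(i, r)"])
    fix f :: "nat \<times> nat \<Rightarrow> int"
    let ?f = "\<lambda>x. f((i, r) := x)"
    have m1: "minor (?f x) r i = minor f r i" for x by (rule minor_cong) auto
    define c0 where "c0 = minor (?f 0) (Suc r) (Suc r)"
    have m3: "minor (?f x) (Suc r) (Suc r) = (- 1) ^ (i + r) * minor f r i * x + c0" for x
      unfolding c0_def by (rule minor_update_last_column[OF i])
    show "card {x \<in> ?V. \<not> int p dvd minor (?f x) r i \<and> int p dvd minor (?f x) (Suc r) (Suc r)}
       \<le> (if True then h else 0)"
    proof (cases "int p dvd minor f r i")
      case False
      then have "\<not> int p dvd (- 1) ^ (i + r) * minor f r i"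
        by (cases "even (i + r)") auto
      from card_linear_congruence[OF p(1) this, of k c0]
      show ?thesis unfolding m1 m3 h_def using False by simp
    qed (simp add: m1)
  qed (use r V i in auto)
  have "uprob ?A ?V (bad_step p r i)
    \<le> real h / real (card ?V) * (real h / real (card ?V) * 1)"
    by (rule order_trans[OF 1], rule mult_left_mono, rule 2[unfolded uprob_True[OF fin V]]) simp
  also have "\<dots> \<le> 2 / real p * (2 / real p * 1)"
    using h by (intro mult_mono) auto
  finally show ?thesis by (simp add: power2_eq_square)
qed

text \<open>As a function of the entry \<open>(i, r)\<close> the larger minor is affine with nonzero
  slope, so it has at most one zero.\<close>

lemma uprob_minor_zero:
  assumes r: "r < n" "r < m" and i: "i \<le> r"
  shows "uprob ({..<n} \<times> {..<m}) (sym_interval k) (\<lambda>f. minor f r i \<noteq> 0 \<and> minor f (Suc r) (Suc r) = 0)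
    \<le> 1 / real (2 * k + 1)"
proof -
  let ?A = "{..<n} \<times> {..<m}" and ?V = "sym_interval k"
  have fin: "finite ?A" "finite ?V" and V: "?V \<noteq> {}" by auto
  have "uprob ?A ?V (\<lambda>f. minor f r i \<noteq> 0 \<and> minor f (Suc r) (Suc r) = 0)
    \<le> real 1 / real (card ?V) * uprob ?A ?V (\<lambda>f. True)"
  proof (rule uprob_fibre_le[OF fin, of "(i, r)"])
    fix f :: "nat \<times> nat \<Rightarrow> int"
    let ?f = "\<lambda>x. f((i, r) := x)"
    have m1: "minor (?f x) r i = minor f r i" for x by (rule minor_cong) auto
    define c0 where "c0 = minor (?f 0) (Suc r) (Suc r)"
    have m3: "minor (?f x) (Suc r) (Suc r) = (- 1) ^ (i + r) * minor f r i * x + c0" for x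
      unfolding c0_def by (rule minor_update_last_column[OF i])
    let ?S = "{x \<in> ?V. minor (?f x) r i \<noteq> 0 \<and> minor (?f x) (Suc r) (Suc r) = 0}"
    have "x = y" if "x \<in> ?S" "y \<in> ?S" for x y
    proof -
      have nz: "(- 1) ^ (i + r) * minor f r i \<noteq> 0" using that by (simp add: m1)
      have "(- 1) ^ (i + r) * minor f r i * x + c0 = 0" "(- 1) ^ (i + r) * minor f r i * y + c0 = 0"
        using that unfolding m3 by blast+
      then have "((- 1) ^ (i + r) * minor f r i) * x = ((- 1) ^ (i + r) * minor f r i) * y" by linarith
      then show ?thesis using nz by simp
    qed
    then have uniq: "\<forall>x\<in>?S. \<forall>y\<in>?S. x = y" by blast
    have finS: "finite ?S" by (rule finite_subset[of _ ?V]) auto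
    have "card ?S \<le> 1"
      unfolding One_nat_def card_le_Suc0_iff_eq[OF finS] by (rule uniq)
    then show "card ?S \<le> (if True then 1 else 0)" by simp
  qed (use r V i in auto)
  moreover have "card ?V = 2 * k + 1" by simp
  ultimately show ?thesis unfolding uprob_True[OF fin V] by (simp only: of_nat_1 mult_1_right)
qed

text \<open>\<open>minor f (Suc r) (Suc r)\<close> does not involve the entry
  \<open>(Suc r, r)\<close>, so it fixes a short list of candidate primes before that entry is
  drawn.\<close>

lemma uprob_large_prime:
  assumes r: "Suc r < n" "r < m" and i: "i \<le> r" and k: "fact (Suc r) \<le> k"
  shows "uprob ({..<n} \<times> {..<m}) (sym_interval k) (\<lambda>f. minor f (Suc r) (Suc r) \<noteq> 0 \<and>
     (\<exists>p. prime p \<and> k < p \<and> bad_step p r i f))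
    \<le> real (2 * (r + 2)) / real (2 * k + 1)"
proof -
  let ?A = "{..<n} \<times> {..<m}" and ?V = "sym_interval k"
  have fin: "finite ?A" "finite ?V" and V: "?V \<noteq> {}" by auto
  have k1: "1 \<le> k" using k fact_ge_1[of "Suc r"] by (meson le_trans)
  have "uprob ?A ?V (\<lambda>f. minor f (Suc r) (Suc r) \<noteq> 0 \<and>
     (\<exists>p. prime p \<and> k < p \<and> bad_step p r i f))
     \<le> real (2 * (r + 2)) / real (card ?V) * uprob ?A ?V (\<lambda>f. True)"
    unfolding bad_step_def
  proof (rule uprob_fibre_le[OF fin, of "(Suc r, r)"])
    fix f :: "nat \<times> nat \<Rightarrow> int" assume f: "f \<in> funs ?A ?V"
    let ?f = "\<lambda>x. f((Suc r, r) := x)"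
    let ?D = "minor f (Suc r) (Suc r)"
    have m1: "minor (?f x) r i = minor f r i" for x by (rule minor_cong) auto
    have m2: "minor (?f x) (Suc r) (Suc r) = ?D" for x by (rule minor_cong) auto
    define c0 where "c0 = minor (?f 0) (Suc r) i"
    have m3: "minor (?f x) (Suc r) i = minor f r i * x + c0" for x
      unfolding c0_def by (rule minor_update_last_row[OF i])
    let ?S = "{x \<in> ?V. minor (?f x) (Suc r) (Suc r) \<noteq> 0 \<and> (\<exists>p. prime p \<and> k < p \<and>
       \<not> int p dvd minor (?f x) r i \<and> int p dvd minor (?f x) (Suc r) (Suc r) \<and> int p dvd minor (?f x) (Suc r) i)}"
    show "card ?S \<le> (if True then 2 * (r + 2) else 0)"
    proof (cases "?D = 0")
      case False
      let ?P = "{p. prime p \<and> k < p \<and> int p dvd ?D}"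
      have "\<bar>?D\<bar> \<le> int (fact (Suc r) * k ^ Suc r)"
      proof (rule abs_minor_le)
        fix a b assume "a \<le> Suc r" "b < Suc r"
        then have "f (a, b) \<in> ?V" using f r unfolding PiE_dflt_def by auto
        then show "\<bar>f (a, b)\<bar> \<le> int k" by auto
      qed
      also have "\<dots> \<le> int (k * k ^ Suc r)"
        by (intro of_nat_mono mult_right_mono k) simp
      finally have "\<bar>?D\<bar> \<le> int (k ^ (r + 2))" by (simp add: power_add)
      \<comment> \<open>\<open>fact (Suc r) \<le> k\<close> turns the determinant estimate into
        \<open>k ^ (r + 2)\<close>, so at most \<open>r + 2\<close> primes above \<open>k\<close>
        divide \<open>?D\<close>. Each admits at most 2 values of the entry, whence
        \<open>2 * (r + 2)\<close>.\<close>
      note P = card_large_prime_divisors[OF False this k1]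
      define Sp where "Sp p = {x \<in> ?V. \<not> int p dvd minor f r i \<and> int p dvd minor f r i * x + c0}" for p
      have finSp: "finite (Sp p)" for p unfolding Sp_def by (rule finite_subset[of _ ?V]) auto
      have Sp: "card (Sp p) \<le> 2" if "p \<in> ?P" for p
      proof (cases "int p dvd minor f r i")
        case False
        have "2 * k div p < 2" using that by (intro less_mult_imp_div_less) auto
        then show ?thesis using card_linear_congruence[of p "minor f r i" k c0] that False
          unfolding Sp_def by simp
      qed (simp add: Sp_def)
      have "?S \<subseteq> (\<Union>p\<in>?P. Sp p)"
        unfolding m1 m2 m3 Sp_def by blast
      then have "card ?S \<le> card (\<Union>p\<in>?P. Sp p)"
        by (rule card_mono[rotated]) (rule finite_UN_I[OF P(1) finSp])
      also have "\<dots> \<le> (\<Sum>p\<in>?P. card (Sp p))" by (rule card_UN_le[OF P(1)])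
      also have "\<dots> \<le> (\<Sum>p\<in>?P. 2)" by (rule sum_mono) (rule Sp)
      also have "\<dots> \<le> 2 * (r + 2)" using P(2) by simp
      finally show ?thesis by simp
    qed (simp add: m2)
  qed (use r V in auto)
  moreover have "card ?V = 2 * k + 1" by simp
  ultimately show ?thesis unfolding uprob_True[OF fin V] by (simp only: mult_1_right)
qed

text \<open>A large prime dividing all minors of size \<open>r + 1\<close> but not all those of size \<open>r\<close> imposes two independent linear
  congruences with invertible coefficients. For primes up to \<open>k\<close> this has probability $O(1/p^2)$; beyond \<open>k\<close> the prime
  must be one of the boundedly many large divisors of a single nonzero minor, and the second congruence alone
  has probability $O(1/k)$.\<close>

lemma bad_prime_Suc_cases:
  assumes "bad_prime (Suc r) N f"
  shows "bad_prime r N f \<or> (\<exists>i\<in>{..r}. minor f r i \<noteq> 0 \<and> minor f (Suc r) (Suc r) = 0)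
    \<or> (\<exists>p\<in>{p. prime p \<and> N < p \<and> p \<le> k}. \<exists>i\<in>{..r}. bad_step p r i f)
    \<or> (\<exists>i\<in>{..r}. minor f (Suc r) (Suc r) \<noteq> 0 \<and> (\<exists>p. prime p \<and> k < p \<and> bad_step p r i f))"
proof (cases "bad_prime r N f")
  case False
  obtain p where p: "prime p" "N < p" "\<And>i. i \<le> Suc r \<Longrightarrow> int p dvd minor f (Suc r) i"
    using assms unfolding bad_prime_def by blast
  obtain i where i: "i \<le> r" "\<not> int p dvd minor f r i"
    using False p(1,2) unfolding bad_prime_def by blast
  have d: "bad_step p r i f" using p(3) i unfolding bad_step_def by auto
  have nz: "minor f r i \<noteq> 0" using i by auto
  show ?thesis
  proof (cases "p \<le> k")
    case True
    then show ?thesis using p(1,2) i d by blast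
  next
    case False
    then show ?thesis using p(1) i d nz by (cases "minor f (Suc r) (Suc r) = 0") (auto simp: not_le)
  qed
qed simp

text \<open>Induction on \<open>r\<close>, starting from the empty minor 1, which no prime divides.
  \<open>C\<close> and \<open>k0\<close> do not depend on \<open>N\<close>, which later allows
  \<open>N\<close> to be chosen before \<open>k\<close>.\<close>

lemma bad_prime_tail:
  assumes "r < n" "r \<le> m"
  shows "\<exists>C\<ge>0. \<exists>k0\<ge>1. \<forall>N\<ge>1. \<forall>k\<ge>k0. uprob ({..<n} \<times> {..<m}) (sym_interval k) (bad_prime r N) \<le> C / real N + C / real k"
  using assms
proof (induction r)
  case 0
  have "bad_prime 0 N = (\<lambda>_. False)" for N
    unfolding bad_prime_def minor_0 by (auto dest: not_prime_unit)
  then show ?case by (intro exI[of _ 0] conjI exI[of _ 1]) (auto simp: uprob_False)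
next
  case (Suc r)
  then obtain C k0 where C: "0 \<le> C" "1 \<le> k0" and
    IH: "\<And>N k. 1 \<le> N \<Longrightarrow> k0 \<le> k \<Longrightarrow> uprob ({..<n} \<times> {..<m}) (sym_interval k) (bad_prime r N) \<le> C / real N + C / real k"
    by auto
  \<comment> \<open>Besides the inherited \<open>C\<close>: \<open>4 * Suc r\<close> from primes up
    to \<open>k\<close>, \<open>Suc r\<close> from a vanishing minor, and
    \<open>Suc r * (2 * (r + 2))\<close> from primes beyond \<open>k\<close>, each by a union bound
    over the \<open>Suc r\<close> rows \<open>i\<close>.\<close>
  define C' where "C' = C + 4 * real (Suc r) + real (Suc r) + real (Suc r) * real (2 * (r + 2))"
  define k1 where "k1 = max k0 (fact (Suc r))"
  show ?case
  proof (intro exI[of _ C'] conjI exI[of _ k1] allI impI)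
    show "0 \<le> C'" unfolding C'_def using C by simp
    show "1 \<le> k1" unfolding k1_def using C by simp
    fix N k :: nat assume N: "1 \<le> N" and k: "k1 \<le> k"
    let ?A = "{..<n} \<times> {..<m}" and ?V = "sym_interval k"
    have fin: "finite ?A" "finite ?V" by auto
    have kk: "k0 \<le> k" "fact (Suc r) \<le> k" "0 < real k" using k C unfolding k1_def by auto
    define B1 where "B1 = (\<lambda>f. \<exists>i\<in>{..r}. minor f r i \<noteq> 0 \<and> minor f (Suc r) (Suc r) = 0)"
    define B2 where "B2 = (\<lambda>f. \<exists>p\<in>{p. prime p \<and> N < p \<and> p \<le> k}. \<exists>i\<in>{..r}. bad_step p r i f)"
    define B3 where "B3 = (\<lambda>f. \<exists>i\<in>{..r}. minor f (Suc r) (Suc r) \<noteq> 0 \<and> (\<exists>p. prime p \<and> k < p \<and> bad_step p r i f))"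
    have u1: "uprob ?A ?V (bad_prime (Suc r) N) \<le> uprob ?A ?V (\<lambda>f. bad_prime r N f \<or> B1 f \<or> B2 f \<or> B3 f)"
      unfolding B1_def B2_def B3_def by (rule uprob_mono[OF fin]) (rule bad_prime_Suc_cases)
    have tot: "uprob ?A ?V (bad_prime (Suc r) N) \<le> uprob ?A ?V (bad_prime r N) + (uprob ?A ?V B1 + (uprob ?A ?V B2 + uprob ?A ?V B3))"
      using u1 uprob_disj[OF fin, of "bad_prime r N" "\<lambda>f. B1 f \<or> B2 f \<or> B3 f"]
        uprob_disj[OF fin, of B1 "\<lambda>f. B2 f \<or> B3 f"] uprob_disj[OF fin, of B2 B3] by linarith
    have le1: "1 / real (2 * k + 1) \<le> 1 / real k" using kk by (intro divide_left_mono) auto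
    have "uprob ?A ?V B1 \<le> (\<Sum>i\<in>{..r}. uprob ?A ?V (\<lambda>f. minor f r i \<noteq> 0 \<and> minor f (Suc r) (Suc r) = 0))"
      unfolding B1_def by (rule uprob_Bex[OF fin]) simp
    also have "\<dots> \<le> (\<Sum>i\<in>{..r}. 1 / real k)"
      by (intro sum_mono order_trans[OF uprob_minor_zero le1]) (use Suc.prems in auto)
    finally have b1: "uprob ?A ?V B1 \<le> real (Suc r) / real k" by simp
    have "uprob ?A ?V B3 \<le> (\<Sum>i\<in>{..r}. uprob ?A ?V (\<lambda>f. minor f (Suc r) (Suc r) \<noteq> 0 \<and> (\<exists>p. prime p \<and> k < p \<and> bad_step p r i f)))"
      unfolding B3_def by (rule uprob_Bex[OF fin]) simp
    also have "\<dots> \<le> (\<Sum>i\<in>{..r}. real (2 * (r + 2)) / real (2 * k + 1))"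
      by (intro sum_mono uprob_large_prime) (use Suc.prems kk in auto)
    also have "\<dots> = real (Suc r) * real (2 * (r + 2)) * (1 / real (2 * k + 1))" by simp
    also have "\<dots> \<le> real (Suc r) * real (2 * (r + 2)) * (1 / real k)"
      by (intro mult_left_mono le1) simp
    finally have b3: "uprob ?A ?V B3 \<le> real (Suc r) * real (2 * (r + 2)) / real k" by simp
    have "uprob ?A ?V B2 \<le> (\<Sum>p\<in>{p. prime p \<and> N < p \<and> p \<le> k}. uprob ?A ?V (\<lambda>f. \<exists>i\<in>{..r}. bad_step p r i f))"
      unfolding B2_def by (rule uprob_Bex[OF fin]) simp
    also have "\<dots> \<le> (\<Sum>p\<in>{p. prime p \<and> N < p \<and> p \<le> k}. 4 * real (Suc r) * (1 / real p ^ 2))"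
    proof (rule sum_mono)
      fix p assume p: "p \<in> {p. prime p \<and> N < p \<and> p \<le> k}"
      have "uprob ?A ?V (\<lambda>f. \<exists>i\<in>{..r}. bad_step p r i f) \<le> (\<Sum>i\<in>{..r}. uprob ?A ?V (bad_step p r i))"
        by (rule uprob_Bex[OF fin]) simp
      also have "\<dots> \<le> (\<Sum>i\<in>{..r}. 4 * (1 / real p ^ 2))"
        by (intro sum_mono uprob_two_congruences) (use Suc.prems p in auto)
      finally show "uprob ?A ?V (\<lambda>f. \<exists>i\<in>{..r}. bad_step p r i f) \<le> 4 * real (Suc r) * (1 / real p ^ 2)" by (simp add: mult.commute)
    qed
    also have "\<dots> \<le> (\<Sum>p\<in>{N<..k}. 4 * real (Suc r) * (1 / real p ^ 2))"
      by (rule sum_mono2) auto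
    also have "\<dots> = 4 * real (Suc r) * (\<Sum>p\<in>{N<..k}. 1 / real p ^ 2)"
      by (simp only: sum_distrib_left)
    also have "\<dots> \<le> 4 * real (Suc r) * (1 / real N)"
    proof (rule mult_left_mono)
      show "(\<Sum>p\<in>{N<..k}. 1 / real p ^ 2) \<le> 1 / real N"
      proof (cases "N \<le> k")
        case True
        have "0 \<le> 1 / real k" by simp
        then show ?thesis using sum_inverse_squares_le[OF N True] by linarith
      qed simp
    qed simp
    finally have b2: "uprob ?A ?V B2 \<le> 4 * real (Suc r) / real N" by simp
    have "uprob ?A ?V (bad_prime (Suc r) N) \<le> (C / real N + 4 * real (Suc r) / real N) +
       (C / real k + real (Suc r) / real k + real (Suc r) * real (2 * (r + 2)) / real k)"
      using tot IH[OF N kk(1)] b1 b2 b3 by linarith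
    also have "\<dots> = (C + 4 * real (Suc r)) / real N + (C + real (Suc r) + real (Suc r) * real (2 * (r + 2))) / real k"
      by (simp only: add_divide_distrib)
    also have "\<dots> \<le> C' / real N + C' / real k"
    proof (intro add_mono divide_right_mono)
      have "0 \<le> real (Suc r)" "0 \<le> real (Suc r) * real (2 * (r + 2))" by (rule of_nat_0_le_iff mult_nonneg_nonneg)+
      then show "C + 4 * real (Suc r) \<le> C'" "C + real (Suc r) + real (Suc r) * real (2 * (r + 2)) \<le> C'"
        unfolding C'_def by linarith+
    qed auto
    finally show "uprob ?A ?V (bad_prime (Suc r) N) \<le> C' / real N + C' / real k" .
  qed
qed

text \<open>If one of these minors is a unit modulo \<open>p\<close>, a kernel vector is determined
  by its coordinates from \<open>r\<close> on. The kernel then has at most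
  \<open>p ^ (m - r)\<close> elements, which is the event for \<open>s = 0\<close>.\<close>

lemma not_kernel_event_imp_dvd_minor:
  assumes p: "prime p" and rm: "r \<le> m" "r < n" and i: "i \<le> r"
    and ev: "\<not> kernel_event p p 0 a r {..<n} {..<m} (\<lambda>i j. f (i, j))"
  shows "int p dvd minor f r i"
proof (rule ccontr)
  assume nd: "\<not> int p dvd minor f r i"
  have p0: "0 < p" using prime_gt_0_nat[OF p] .
  define \<rho> where "\<rho> a = (if a < i then a else Suc a)" for a
  define B where "B = mat r r (\<lambda>(a, b). f (\<rho> a, b))"
  have B: "B \<in> carrier_mat r r" unfolding B_def by simp
  have detB: "det B = minor f r i" unfolding B_def minor_def \<rho>_def ..
  have \<rho>: "\<rho> a < n" if "a < r" for a unfolding \<rho>_def using that rm by auto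
  let ?K1 = "{x \<in> res_vecs p {..<m}. \<forall>a\<in>{..<n}. int p dvd (\<Sum>b<m. f (a, b) * x b)}"
  let ?R = "funs {r..<m} {0..<int p}"
  define g where "g x = (\<lambda>b. if b \<in> {r..<m} then x b else 0 :: int)" for x :: "nat \<Rightarrow> int"
  have "inj_on g ?K1"
  proof (rule inj_onI)
    fix x y assume x: "x \<in> ?K1" and y: "y \<in> ?K1" and eq: "g x = g y"
    have same: "x b = y b" if "\<not> b < r" for b
    proof (cases "b < m")
      case True
      then show ?thesis using fun_cong[OF eq, of b] that unfolding g_def by simp
    next
      case False
      then show ?thesis using x y unfolding res_vecs_def PiE_dflt_def by auto
    qed
    define z where "z b = x b - y b" for b
    have row: "int p dvd (\<Sum>c<r. B $$ (a, c) * z c)" if a: "a < r" for a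
    proof -
      have "int p dvd (\<Sum>b<m. f (\<rho> a, b) * x b) - (\<Sum>b<m. f (\<rho> a, b) * y b)"
        using x y \<rho>[OF a] by (intro dvd_diff) auto
      also have "\<dots> = (\<Sum>b<m. f (\<rho> a, b) * z b)"
        unfolding z_def by (simp add: sum_subtractf algebra_simps)
      also have "\<dots> = (\<Sum>b<r. f (\<rho> a, b) * z b)"
        by (rule sum.mono_neutral_right) (use rm same in \<open>auto simp: z_def\<close>)
      also have "\<dots> = (\<Sum>c<r. B $$ (a, c) * z c)"
        using a unfolding B_def by simp
      finally show ?thesis .
    qed
    have low: "x b = y b" if b: "b < r" for b
    proof -
      \<comment> \<open>The adjugate turns \<open>B z = 0\<close> modulo \<open>p\<close> into
        \<open>det B * z = 0\<close>, and \<open>det B\<close> is prime to \<open>p\<close>.\<close>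
      have adj: "(\<Sum>a<r. adj_mat B $$ (b, a) * B $$ (a, c)) = (if b = c then det B else 0)" if "c < r" for c
      proof -
        have "(adj_mat B * B) $$ (b, c) = (det B \<cdot>\<^sub>m 1\<^sub>m r) $$ (b, c)"
          unfolding adj_mat(3)[OF B] ..
        then show ?thesis using b that B adj_mat(1)[OF B] by (simp add: scalar_prod_def atLeast0LessThan)
      qed
      have "det B * z b = (\<Sum>c<r. (if b = c then det B else 0) * z c)"
        using b by (subst sum.remove[of _ b]) auto
      also have "\<dots> = (\<Sum>c<r. (\<Sum>a<r. adj_mat B $$ (b, a) * B $$ (a, c)) * z c)"
        by (intro sum.cong) (auto simp: adj)
      also have "\<dots> = (\<Sum>a<r. adj_mat B $$ (b, a) * (\<Sum>c<r. B $$ (a, c) * z c))"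
        by (rule sum_mat_assoc)
      also have "int p dvd \<dots>" by (rule dvd_sum, rule dvd_mult) (use row in auto)
      finally have "int p dvd z b" using nd p unfolding detB by (simp add: prime_dvd_mult_iff)
      then have "x b mod int p = y b mod int p" unfolding z_def by (simp add: mod_eq_dvd_iff)
      moreover have "x b \<in> {0..<int p}" "y b \<in> {0..<int p}"
        using x y b rm unfolding res_vecs_def PiE_dflt_def by auto
      ultimately show ?thesis by simp
    qed
    show "x = y" using same low by (metis ext)
  qed
  moreover have "g ` ?K1 \<subseteq> ?R" unfolding g_def res_vecs_def PiE_dflt_def by auto
  ultimately have "card ?K1 \<le> card ?R" by (intro card_inj_on_le) (auto intro!: finite_dflt)
  also have "\<dots> = p ^ (m - r)" by (subst card_dflt) auto
  finally have "p ^ r * card ?K1 \<le> p ^ r * p ^ (m - r)" by simp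
  also have "\<dots> = p ^ m" using rm by (simp flip: power_add)
  also have "\<dots> = card (res_vecs p {..<m})" unfolding res_vecs_def by (subst card_dflt) auto
  finally have "p ^ r * kcount p (p ^ Suc 0) {..<n} {..<m} (\<lambda>i j. f (i, j)) \<le> kcount p (p ^ 0) {..<n} {..<m} (\<lambda>i j. f (i, j))"
    unfolding kcount_def by simp
  then show False using ev unfolding kernel_event_def by simp
qed

section \<open>From local to global densities\<close>

text \<open>Entrywise reduction modulo \<open>q1\<close> and \<open>q2\<close> is injective between
  sets of equal size, hence bijective, and carries the joint event to a product of sets.\<close>

lemma uprob_CRT:
  fixes q1 q2 :: nat
  assumes A: "finite A" and q: "0 < q1" "0 < q2" "coprime q1 q2"
    and E1: "\<And>f g. (\<And>x. x \<in> A \<Longrightarrow> [f x = g x] (mod int q1)) \<Longrightarrow> E1 f = E1 g"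
    and E2: "\<And>f g. (\<And>x. x \<in> A \<Longrightarrow> [f x = g x] (mod int q2)) \<Longrightarrow> E2 f = E2 g"
  shows "uprob A {0..<int (q1 * q2)} (\<lambda>f. E1 f \<and> E2 f) = uprob A {0..<int q1} E1 * uprob A {0..<int q2} E2"
proof -
  let ?Om = "\<lambda>q. funs A {0..<int q}"
  define h where "h f = ((\<lambda>x. f x mod int q1), (\<lambda>x. f x mod int q2))" for f :: "'a \<Rightarrow> int"
  have h_mem: "h f \<in> ?Om q1 \<times> ?Om q2" if "f \<in> ?Om (q1 * q2)" for f
    using that q unfolding h_def PiE_dflt_def by auto
  have inj: "inj_on h (?Om (q1 * q2))"
  proof (rule inj_onI)
    fix f g assume f: "f \<in> ?Om (q1 * q2)" and g: "g \<in> ?Om (q1 * q2)" and eq: "h f = h g"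
    show "f = g"
    proof
      fix x
      show "f x = g x"
      proof (cases "x \<in> A")
        case True
        have "[f x = g x] (mod int q1)" "[f x = g x] (mod int q2)"
          using eq unfolding h_def cong_def by (auto dest: fun_cong)
        moreover have "coprime (int q1) (int q2)" using q by simp
        ultimately have "[f x = g x] (mod int q1 * int q2)" by (rule coprime_cong_mult)
        moreover have "f x \<in> {0..<int (q1 * q2)}" "g x \<in> {0..<int (q1 * q2)}"
          using f g True unfolding PiE_dflt_def by blast+
        ultimately show ?thesis by (simp add: cong_def)
      next
        case False
        then show ?thesis using f g unfolding PiE_dflt_def by auto
      qed
    qed
  qed
  have fin: "finite (?Om q)" for q using A by (intro finite_dflt) auto
  have card: "card (?Om q) = q ^ card A" for q using A by (subst card_dflt) auto
  have surj: "h ` ?Om (q1 * q2) = ?Om q1 \<times> ?Om q2"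
  proof (rule card_subset_eq)
    show "finite (?Om q1 \<times> ?Om q2)" using fin by simp
    show "h ` ?Om (q1 * q2) \<subseteq> ?Om q1 \<times> ?Om q2" using h_mem by blast
    show "card (h ` ?Om (q1 * q2)) = card (?Om q1 \<times> ?Om q2)"
      unfolding card_image[OF inj] card card_cartesian_product by (rule power_mult_distrib)
  qed
  have E: "E1 f \<longleftrightarrow> E1 (fst (h f))" "E2 f \<longleftrightarrow> E2 (snd (h f))" for f
    unfolding h_def by (auto intro!: E1 E2 simp: cong_def)
  have img: "h ` {f \<in> ?Om (q1 * q2). E1 f \<and> E2 f} = {f \<in> ?Om q1. E1 f} \<times> {f \<in> ?Om q2. E2 f}"
  proof (intro equalityI subsetI)
    fix y assume "y \<in> h ` {f \<in> ?Om (q1 * q2). E1 f \<and> E2 f}"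
    then obtain f where f: "y = h f" "f \<in> ?Om (q1 * q2)" "E1 f" "E2 f" by blast
    then show "y \<in> {f \<in> ?Om q1. E1 f} \<times> {f \<in> ?Om q2. E2 f}"
      using h_mem[of f] E[of f] by (auto simp: mem_Times_iff)
  next
    fix y assume y: "y \<in> {f \<in> ?Om q1. E1 f} \<times> {f \<in> ?Om q2. E2 f}"
    then have "y \<in> h ` ?Om (q1 * q2)" unfolding surj by auto
    then obtain f where f: "y = h f" "f \<in> ?Om (q1 * q2)" by blast
    then show "y \<in> h ` {f \<in> ?Om (q1 * q2). E1 f \<and> E2 f}" using y E[of f] by (auto simp: mem_Times_iff)
  qed
  have "inj_on h {f \<in> ?Om (q1 * q2). E1 f \<and> E2 f}" by (rule inj_on_subset[OF inj]) auto
  from card_image[OF this] have "card {f \<in> ?Om (q1 * q2). E1 f \<and> E2 f} = card {f \<in> ?Om q1. E1 f} * card {f \<in> ?Om q2. E2 f}"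
    unfolding img card_cartesian_product by (rule sym)
  then show ?thesis unfolding uprob_def card by (simp add: power_mult_distrib)
qed

lemma uprob_CRT_prod:
  fixes q :: "nat \<Rightarrow> nat"
  assumes A: "finite A" and q: "\<And>j. 0 < q j" "\<And>i j. i \<noteq> j \<Longrightarrow> coprime (q i) (q j)"
    and E: "\<And>j f g. (\<And>x. x \<in> A \<Longrightarrow> [f x = g x] (mod int (q j))) \<Longrightarrow> E j f = E j g"
  shows "uprob A {0..<int (\<Prod>j<N. q j)} (\<lambda>f. \<forall>j<N. E j f) = (\<Prod>j<N. uprob A {0..<int (q j)} (E j))"
proof (induction N)
  case 0
  show ?case using A by (simp add: uprob_True)
next
  case (Suc N)
  have "uprob A {0..<int ((\<Prod>j<N. q j) * q N)} (\<lambda>f. (\<forall>j<N. E j f) \<and> E N f) =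
    uprob A {0..<int (\<Prod>j<N. q j)} (\<lambda>f. \<forall>j<N. E j f) * uprob A {0..<int (q N)} (E N)"
  proof (rule uprob_CRT[OF A])
    show "0 < (\<Prod>j<N. q j)" using q by (simp add: prod_pos)
    show "coprime (\<Prod>j<N. q j) (q N)" using q by (intro prod_coprime_left) auto
    fix f g :: "'a \<Rightarrow> int"
    assume fg: "\<And>x. x \<in> A \<Longrightarrow> [f x = g x] (mod int (\<Prod>j<N. q j))"
    have "E j f = E j g" if j: "j < N" for j
    proof (rule E)
      fix x assume x: "x \<in> A"
      have "q j dvd (\<Prod>j<N. q j)" using j by (intro dvd_prodI) auto
      then have "int (q j) dvd int (\<Prod>j<N. q j)" by (simp only: of_nat_dvd_iff)
      then show "[f x = g x] (mod int (q j))" using cong_dvd_modulus[OF fg[OF x]] by blast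
    qed
    then show "(\<forall>j<N. E j f) = (\<forall>j<N. E j g)" by blast
  qed (use q E in auto)
  moreover have "(\<lambda>f. \<forall>j<Suc N. E j f) = (\<lambda>f. (\<forall>j<N. E j f) \<and> E N f)"
    by (auto simp: less_Suc_eq fun_eq_iff)
  ultimately show ?case using Suc.IH by (simp del: of_nat_prod of_nat_mult)
qed

text \<open>Shifted by \<open>k\<close>, the interval lies between two intervals whose lengths are
  consecutive multiples of \<open>Q\<close>, so the count is off by at most 1.\<close>

lemma card_residue_class_sym_interval:
  fixes Q k :: nat and y :: int
  assumes "0 < Q"
  shows "\<bar>real (card {v \<in> sym_interval k. [v = y] (mod int Q)}) / real (2 * k + 1) - 1 / real Q\<bar> \<le> 1 / real (2 * k + 1)"
proof -
  define L where "L = 2 * k + 1"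
  define l where "l = L div Q"
  let ?S = "{u \<in> {0..<int L}. [u = y + int k] (mod int Q)}"
  let ?C = "\<lambda>l. {u \<in> {0..<int (Q * l)}. [u = y + int k] (mod int Q)}"
  have "bij_betw (\<lambda>v. v + int k) {v \<in> sym_interval k. [v = y] (mod int Q)} ?S"
    by (rule bij_betw_byWitness[where f' = "\<lambda>u. u - int k"])
      (auto simp: L_def cong_iff_dvd_diff algebra_simps)
  then have c: "card {v \<in> sym_interval k. [v = y] (mod int Q)} = card ?S" by (rule bij_betw_same_card)
  have Ql: "Q * l \<le> L" "L \<le> Q * Suc l"
    unfolding l_def using assms by (auto simp: dividend_less_times_div less_imp_le)
  have "card (?C l) \<le> card ?S"
    by (rule card_mono) (use Ql in \<open>auto intro: finite_subset[of _ "{0..<int L}"] simp del: of_nat_mult\<close>)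
  then have lo: "l \<le> card ?S" unfolding card_residue_class[OF assms] .
  have "card ?S \<le> card (?C (Suc l))"
    by (rule card_mono) (use Ql in \<open>auto intro: finite_subset[of _ "{0..<int (Q * Suc l)}"] simp del: of_nat_mult\<close>)
  then have hi: "card ?S \<le> Suc l" unfolding card_residue_class[OF assms] .
  have Q: "0 < real Q" and L: "0 < real L" using assms unfolding L_def by auto
  have r1: "real Q * real l \<le> real L" using of_nat_mono[OF Ql(1), where 'a = real] by simp
  have r2: "real L \<le> real Q * (real l + 1)" using of_nat_mono[OF Ql(2), where 'a = real] by (simp add: algebra_simps)
  have "\<bar>real (card ?S) - real L / real Q\<bar> \<le> 1"
  proof -
    have "real l \<le> real L / real Q" using r1 Q by (simp add: field_simps)
    moreover have "real L / real Q \<le> real l + 1" using r2 Q by (simp add: field_simps)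
    moreover have "real l \<le> real (card ?S)" "real (card ?S) \<le> real l + 1" using lo hi by auto
    ultimately show ?thesis by (simp add: abs_le_iff)
  qed
  then have "\<bar>real (card ?S) - real L / real Q\<bar> / real L \<le> 1 / real L" using L by (intro divide_right_mono) auto
  moreover have "\<bar>real (card ?S) - real L / real Q\<bar> / real L = \<bar>real (card ?S) / real L - 1 / real Q\<bar>"
  proof -
    have "real (card ?S) / real L - 1 / real Q = (real (card ?S) - real L / real Q) / real L"
      using L by (simp add: diff_divide_distrib)
    then show ?thesis using L by (simp only: abs_divide abs_of_pos)
  qed
  ultimately show ?thesis unfolding c L_def by simp
qed

lemma tendsto_residue_class:
  assumes "0 < Q"
  shows "(\<lambda>k. real (card {v \<in> sym_interval k. [v = y] (mod int Q)}) / real (2 * k + 1)) \<longlonglongrightarrow> 1 / real Q"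
proof (rule Lim_null_comparison[THEN LIM_zero_cancel])
  show "\<forall>\<^sub>F k in sequentially. norm (real (card {v \<in> sym_interval k. [v = y] (mod int Q)}) / real (2 * k + 1) - 1 / real Q) \<le> 1 / real (2 * k + 1)"
    using card_residue_class_sym_interval[OF assms] by simp
  show "(\<lambda>k. 1 / real (2 * k + 1)) \<longlonglongrightarrow> 0" by real_asymp
qed

text \<open>The event is a finite disjoint union of residue patterns \<open>g\<close> modulo
  \<open>Q\<close>. The density of a pattern is a product over the entries, with factors tending to
  \<open>1 / Q\<close>.\<close>

lemma uprob_sym_interval_tendsto:
  fixes Q :: nat
  assumes A: "finite A" and Q: "0 < Q"
    and E: "\<And>f g. (\<And>x. x \<in> A \<Longrightarrow> [f x = g x] (mod int Q)) \<Longrightarrow> E f = E g"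
  shows "(\<lambda>k. uprob A (sym_interval k) E) \<longlonglongrightarrow> uprob A {0..<int Q} E"
proof -
  let ?G = "{g \<in> funs A {0..<int Q}. E g}"
  have finG: "finite ?G" using finite_dflt[OF A, of "{0..<int Q}"] by auto
  let ?F = "\<lambda>k g. PiE_dflt A 0 (\<lambda>x. {v \<in> sym_interval k. [v = g x] (mod int Q)})"
  have finV: "finite {v \<in> sym_interval k. [v = y] (mod int Q)}" for k y
    by (rule finite_subset[of _ "sym_interval k"]) auto
  have form: "uprob A (sym_interval k) E = (\<Sum>g\<in>?G. \<Prod>x\<in>A. real (card {v \<in> sym_interval k. [v = g x] (mod int Q)}) / real (2 * k + 1))" for k
  proof -
    have "{f \<in> funs A (sym_interval k). E f} = (\<Union>g\<in>?G. ?F k g)"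
    proof (intro equalityI subsetI)
      fix f assume f: "f \<in> {f \<in> funs A (sym_interval k). E f}"
      define g where "g = (\<lambda>x. f x mod int Q)"
      have "E g" using f E[of f g] unfolding g_def by (simp add: cong_def)
      moreover have "g \<in> funs A {0..<int Q}"
        using f Q unfolding g_def PiE_dflt_def by auto
      moreover have "f \<in> ?F k g" using f unfolding g_def PiE_dflt_def by (auto simp: cong_def)
      ultimately show "f \<in> (\<Union>g\<in>?G. ?F k g)" by blast
    next
      fix f assume "f \<in> (\<Union>g\<in>?G. ?F k g)"
      then obtain g where g: "E g" "f \<in> ?F k g" by blast
      have "E f = E g" by (rule E) (use g(2) in \<open>auto simp: PiE_dflt_def\<close>)
      then show "f \<in> {f \<in> funs A (sym_interval k). E f}"
        using g unfolding PiE_dflt_def by auto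
    qed
    moreover have "card (\<Union>g\<in>?G. ?F k g) = (\<Sum>g\<in>?G. card (?F k g))"
    proof (rule card_UN_disjoint[OF finG])
      show "\<forall>g\<in>?G. finite (?F k g)" using A finV by (auto intro!: finite_PiE_dflt)
      show "\<forall>g\<in>?G. \<forall>g'\<in>?G. g \<noteq> g' \<longrightarrow> ?F k g \<inter> ?F k g' = {}"
      proof (intro ballI impI)
        fix g g' assume g: "g \<in> ?G" and g': "g' \<in> ?G" and ne: "g \<noteq> g'"
        show "?F k g \<inter> ?F k g' = {}"
        proof (rule ccontr)
          assume "?F k g \<inter> ?F k g' \<noteq> {}"
          then obtain f where f: "f \<in> ?F k g" "f \<in> ?F k g'" by blast
          have "g x = g' x" for x
          proof (cases "x \<in> A")
            case True
            then have "[f x = g x] (mod int Q)" "[f x = g' x] (mod int Q)" using f unfolding PiE_dflt_def by auto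
            then have "[g x = g' x] (mod int Q)" by (meson cong_sym cong_trans)
            moreover have "g x \<in> {0..<int Q}" "g' x \<in> {0..<int Q}" using g g' True unfolding PiE_dflt_def by blast+
            ultimately show ?thesis by (simp add: cong_def)
          next
            case False
            then show ?thesis using g g' unfolding PiE_dflt_def by auto
          qed
          then show False using ne by blast
        qed
      qed
    qed
    moreover have "card (?F k g) = (\<Prod>x\<in>A. card {v \<in> sym_interval k. [v = g x] (mod int Q)})" for g
      using A finV by (subst card_PiE_dflt) auto
    moreover have "card (funs A (sym_interval k)) = (2 * k + 1) ^ card A"
      by (subst card_dflt[OF A]) (auto simp: nat_add_distrib nat_mult_distrib)
    ultimately show ?thesis
      unfolding uprob_def by (simp add: prod_dividef sum_divide_distrib)
  qed
  have "(\<lambda>k. \<Sum>g\<in>?G. \<Prod>x\<in>A. real (card {v \<in> sym_interval k. [v = g x] (mod int Q)}) / real (2 * k + 1)) \<longlonglongrightarrow> (\<Sum>g\<in>?G. \<Prod>x\<in>A. 1 / real Q)"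
    by (intro tendsto_sum tendsto_prod tendsto_residue_class[OF Q])
  moreover have "(\<Sum>g\<in>?G. \<Prod>x\<in>A. 1 / real Q) = uprob A {0..<int Q} E"
    unfolding uprob_def by (simp add: card_dflt[OF A] power_divide)
  ultimately show ?thesis unfolding form by simp
qed

section \<open>The sequence of primes and the exponents of the last divisor\<close>

lemma bij_nth_prime: "bij_betw nth_prime UNIV {p. prime p}"
  using bij_enumerate[OF primes_infinite] unfolding nth_prime_def[abs_def] .

lemma prime_nth_prime: "prime (nth_prime j)"
  using bij_nth_prime unfolding bij_betw_def by blast

lemma nth_prime_inj: "nth_prime i = nth_prime j \<longleftrightarrow> i = j"
  using bij_nth_prime unfolding bij_betw_def by (simp add: inj_eq)

text \<open>A crude bound that suffices to compare with \<open>1 / (j + 1) ^ 2\<close> and to place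
  all primes of index at least \<open>N\<close> above \<open>N\<close>.\<close>

lemma nth_prime_gt: "Suc j < nth_prime j"
proof (induction j)
  case 0
  show ?case using prime_gt_1_nat[OF prime_nth_prime] by simp
next
  case (Suc j)
  have "nth_prime j < nth_prime (Suc j)"
    unfolding nth_prime_def by (rule enumerate_step[OF primes_infinite])
  then show ?case using Suc.IH by linarith
qed

text \<open>Convergence among natural numbers means being eventually constant, so all late factors
  are 1 and the infinite product is an ordinary factorization.\<close>

lemma prime_power_factorization_exponents:
  fixes s :: "nat \<Rightarrow> nat" and D :: nat
  assumes prod: "(\<lambda>j. nth_prime j ^ s j) has_prod D" and D: "0 < D"
  shows "finite {j. s j \<noteq> 0}" "nth_prime j ^ s j dvd D" "\<not> nth_prime j ^ Suc (s j) dvd D"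
proof -
  let ?f = "\<lambda>j. nth_prime j ^ s j"
  \<comment> \<open>\<open>has_prod\<close> also admits a limit 0 caused by a zero factor;
    \<open>0 < D\<close> excludes this.\<close>
  have "raw_has_prod ?f 0 D" using prod D unfolding has_prod_def by auto
  then have "(\<lambda>n. \<Prod>i\<le>n. ?f i) \<longlonglongrightarrow> D" unfolding raw_has_prod_def by simp
  then have "\<forall>\<^sub>F n in sequentially. (\<Prod>i\<le>n. ?f i) = D" by (simp add: tendsto_discrete)
  then obtain n0 where n0: "\<And>n. n0 \<le> n \<Longrightarrow> (\<Prod>i\<le>n. ?f i) = D" unfolding eventually_sequentially by blast
  have "s (Suc n) = 0" if "n0 \<le> n" for n
  proof -
    have "D * ?f (Suc n) = D" using n0[of n] n0[of "Suc n"] that by simp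
    then have "?f (Suc n) = 1" using D by simp
    then show ?thesis using prime_gt_1_nat[OF prime_nth_prime, of "Suc n"] by (metis nat_power_eq_Suc_0_iff One_nat_def less_irrefl)
  qed
  then have zero: "s j = 0" if "n0 < j" for j
    using that by (cases j) (auto simp: less_Suc_eq_le)
  have "{j. s j \<noteq> 0} \<subseteq> {..n0}"
  proof
    fix j assume "j \<in> {j. s j \<noteq> 0}"
    then show "j \<in> {..n0}" using zero[of j] by (cases "n0 < j") auto
  qed
  then show "finite {j. s j \<noteq> 0}" by (rule finite_subset) simp
  define N where "N = max n0 j"
  have DN: "D = ?f j * (\<Prod>i\<in>{..N} - {j}. ?f i)"
    using n0[of N] by (subst prod.remove[symmetric]) (auto simp: N_def)
  then show "nth_prime j ^ s j dvd D" by simp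
  show "\<not> nth_prime j ^ Suc (s j) dvd D"
  proof
    assume "nth_prime j ^ Suc (s j) dvd D"
    then have "?f j * nth_prime j dvd ?f j * (\<Prod>i\<in>{..N} - {j}. ?f i)" unfolding DN by (simp add: mult.commute)
    then have "nth_prime j dvd (\<Prod>i\<in>{..N} - {j}. ?f i)"
      using prime_gt_0_nat[OF prime_nth_prime, of j] by simp
    then obtain i where i: "i \<noteq> j" "nth_prime j dvd ?f i"
      using prime_dvd_prod_iff[of "{..N} - {j}" "nth_prime j" ?f] prime_nth_prime by auto
    then have "nth_prime j dvd nth_prime i" using prime_dvd_power prime_nth_prime by blast
    then have "nth_prime j = nth_prime i" using primes_dvd_imp_eq prime_nth_prime by blast
    then show False using i nth_prime_inj by simp
  qed
qed

section \<open>Convergence of the product of the local densities\<close>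

lemma pbracket_le_1: "1 < p \<Longrightarrow> pbracket p l \<le> 1"
  unfolding pbracket_def by (rule prod_le_1) (auto simp: one_less_power less_imp_le)

lemma pbracket_ge:
  assumes "1 < p"
  shows "(1 / 2) ^ l \<le> pbracket p l"
proof -
  have "(\<Prod>j=1..l. 1 / 2) \<le> pbracket p l"
    unfolding pbracket_def
  proof (rule prod_mono)
    fix j assume j: "j \<in> {1..l}"
    have "real p \<le> real p ^ j" using j assms by (intro self_le_power) auto
    then have "2 \<le> real p ^ j" using assms by linarith
    then have "1 / real p ^ j \<le> 1 / 2" using assms by (intro divide_left_mono) auto
    then show "(0 :: real) \<le> 1 / 2 \<and> 1 / 2 \<le> 1 - 1 / real p ^ j" by simp
  qed
  then show ?thesis by simp
qed

text \<open>For \<open>l < m\<close> and \<open>Suc l < n\<close> the exponent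
  \<open>(n - l) * (m - l)\<close> is at least 2; with \<open>l < r\<close> this is what
  \<open>r < n\<close> provides. All brackets are at most 1, and those in the denominator have at
  most \<open>n + m\<close> factors, each at least \<open>1 / 2\<close>.\<close>

lemma rank_prob_le:
  assumes p: "1 < p" and l: "l < m" "Suc l < n"
  shows "0 \<le> rank_prob p n m l" "rank_prob p n m l \<le> 2 ^ (n + m) / real p ^ 2"
proof -
  have pos: "0 < pbracket p k" for k by (rule pbracket_pos[OF p])
  let ?D = "pbracket p (n - l) * pbracket p (m - l) * pbracket p l"
  have R: "rank_prob p n m l = 1 / real p ^ ((n - l) * (m - l)) * (pbracket p n * pbracket p m / ?D)"
    unfolding rank_prob_def using l by simp
  show "0 \<le> rank_prob p n m l" unfolding R using pos by (simp add: less_imp_le)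
  have "(1 / 2 :: real) ^ (n + m) \<le> (1 / 2) ^ (n - l) * (1 / 2) ^ (m - l) * (1 / 2) ^ l"
    using l by (simp only: power_add[symmetric]) (intro power_decreasing, auto)
  also have "\<dots> \<le> ?D"
    by (intro mult_mono pbracket_ge[OF p] mult_nonneg_nonneg less_imp_le[OF pos]) auto
  finally have D: "(1 / 2) ^ (n + m) \<le> ?D" .
  have "pbracket p n * pbracket p m / ?D \<le> 1 / (1 / 2) ^ (n + m)"
    using D pos pbracket_le_1[OF p] by (intro frac_le mult_le_one) (auto simp: less_imp_le)
  also have "\<dots> = 2 ^ (n + m)" by (simp add: power_divide)
  finally have b: "pbracket p n * pbracket p m / ?D \<le> 2 ^ (n + m)" .
  have "2 * 1 \<le> (n - l) * (m - l)" using l by (intro mult_le_mono) auto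
  then have "real p ^ 2 \<le> real p ^ ((n - l) * (m - l))" using p by (intro power_increasing) auto
  then have "1 / real p ^ ((n - l) * (m - l)) \<le> 1 / real p ^ 2" using p by (intro divide_left_mono) auto
  then have "rank_prob p n m l \<le> 1 / real p ^ 2 * 2 ^ (n + m)"
    unfolding R using b pos by (intro mult_mono) (auto simp: less_imp_le)
  then show "rank_prob p n m l \<le> 2 ^ (n + m) / real p ^ 2" by simp
qed

text \<open>Only finitely many primes have \<open>s j \<noteq> 0\<close>. At the others
  \<open>1 - x j\<close> is a sum of \<open>r\<close> rank probabilities, each at most a constant
  over the square of the prime.\<close>

lemma convergent_prod_local_densities:
  assumes mn: "r \<le> m" "r < n" and fin: "finite {j. s j \<noteq> (0 :: nat)}"
    and x: "\<And>j. x j = snf_prob (nth_prime j) (s j) (a j) r n m 0"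
  shows "convergent_prod x"
proof (rule abs_convergent_prod_imp_convergent_prod)
  define c where "c = real r * 2 ^ (n + m)"
  obtain N where N: "\<And>j. N \<le> j \<Longrightarrow> s j = 0"
  proof -
    obtain M where M: "\<forall>j\<in>{j. s j \<noteq> 0}. j < M" using finite_nat_set_iff_bounded[THEN iffD1, OF fin] by (rule exE)
    show thesis
    proof (rule that)
      fix j assume "M \<le> j"
      then show "s j = 0" using M by (meson mem_Collect_eq not_less)
    qed
  qed
  have "summable (\<lambda>j. norm (x j - 1))"
  proof (rule summable_comparison_test')
    have "summable (\<lambda>j. inverse (real (Suc j) ^ 2))"
      using inverse_power_summable[of 2, where 'a = real] by (subst summable_Suc_iff) auto
    then show "summable (\<lambda>j. c * inverse (real (Suc j) ^ 2))" by (rule summable_mult)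
    fix j assume "N \<le> j"
    then have s: "s j = 0" by (rule N)
    let ?p = "nth_prime j"
    have p: "1 < ?p" by (rule prime_gt_1_nat[OF prime_nth_prime])
    have "norm (x j - 1) = \<bar>\<Sum>l<r. rank_prob ?p n m l\<bar>" unfolding x s by simp
    also have "\<dots> = (\<Sum>l<r. rank_prob ?p n m l)"
      by (intro abs_of_nonneg sum_nonneg rank_prob_le(1)[OF p]) (use mn in auto)
    also have "\<dots> \<le> (\<Sum>l<r. 2 ^ (n + m) / real ?p ^ 2)"
      by (intro sum_mono rank_prob_le(2)[OF p]) (use mn in auto)
    also have "\<dots> = c * (1 / real ?p ^ 2)" unfolding c_def by simp
    also have "\<dots> \<le> c * (1 / real (Suc j) ^ 2)"
    proof (intro mult_left_mono divide_left_mono power_mono)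
      show "real (Suc j) \<le> real ?p" using nth_prime_gt[of j] by (intro of_nat_mono) simp
      show "0 < real ?p ^ 2 * real (Suc j) ^ 2" using p by (intro mult_pos_pos zero_less_power) auto
    qed (auto simp: c_def)
    finally show "norm (norm (x j - 1)) \<le> c * inverse (real (Suc j) ^ 2)"
      by (simp add: inverse_eq_divide)
  qed
  then show "abs_convergent_prod x" by (simp add: abs_convergent_prod_conv_summable)
qed

section \<open>Passage from finitely many primes to all primes\<close>

lemma uprob_conj_ge:
  assumes fin: "finite A" "finite V"
    and imp: "\<And>f. \<not> F f \<Longrightarrow> G f"
  shows "uprob A V (\<lambda>f. E f) - uprob A V G \<le> uprob A V (\<lambda>f. F f \<and> E f)"
proof -
  have "uprob A V E \<le> uprob A V (\<lambda>f. (F f \<and> E f) \<or> G f)"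
    by (rule uprob_mono[OF fin]) (use imp in blast)
  also have "\<dots> \<le> uprob A V (\<lambda>f. F f \<and> E f) + uprob A V G" by (rule uprob_disj[OF fin])
  finally show ?thesis by simp
qed

lemma has_prod_imp_LIMSEQ_lessThan:
  fixes x :: "nat \<Rightarrow> real"
  assumes "x has_prod P"
  shows "(\<lambda>N. \<Prod>i<N. x i) \<longlonglongrightarrow> P"
proof (rule LIMSEQ_imp_Suc)
  show "(\<lambda>N. \<Prod>i<Suc N. x i) \<longlonglongrightarrow> P"
    using has_prod_imp_tendsto[OF assms] unfolding lessThan_Suc_atMost .
qed

text \<open>Truncating to \<open>j < N\<close> leaves an event modulo a single \<open>Q\<close>, and
  the error is bounded by the probability of \<open>G N\<close>, uniformly in large
  \<open>k\<close>. So \<open>N\<close> is fixed first and \<open>k\<close> tends to infinity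
  afterwards.\<close>

lemma uprob_local_global:
  fixes q :: "nat \<Rightarrow> nat"
  assumes A: "finite A" and q: "\<And>j. 0 < q j" "\<And>i j. i \<noteq> j \<Longrightarrow> coprime (q i) (q j)"
    and E: "\<And>j f g. (\<And>x. x \<in> A \<Longrightarrow> [f x = g x] (mod int (q j))) \<Longrightarrow> E j f = E j g"
    and tail: "\<And>f N. N0 \<le> N \<Longrightarrow> \<not> (\<forall>j\<ge>N. E j f) \<Longrightarrow> G N f"
    and G: "1 \<le> k0" "\<And>N k. 1 \<le> N \<Longrightarrow> k0 \<le> k \<Longrightarrow> uprob A (sym_interval k) (G N) \<le> C / real N + C / real k"
    and C: "0 \<le> C"
    and lim: "(\<lambda>N. \<Prod>j<N. uprob A {0..<int (q j)} (E j)) \<longlonglongrightarrow> P"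
  shows "(\<lambda>k. uprob A (sym_interval k) (\<lambda>f. \<forall>j. E j f)) \<longlonglongrightarrow> P"
proof (rule LIMSEQ_I)
  fix \<epsilon> :: real assume \<epsilon>: "0 < \<epsilon>"
  let ?\<mu> = "\<lambda>k. uprob A (sym_interval k)"
  define X where "X N = (\<Prod>j<N. uprob A {0..<int (q j)} (E j))" for N
  have small: "\<exists>N1. \<forall>N\<ge>N1. C / real N < \<epsilon> / 4"
  proof -
    have "(\<lambda>N. C / real N) \<longlonglongrightarrow> 0" by (rule lim_const_over_n)
    from order_tendstoD(2)[OF this, of "\<epsilon> / 4"] show ?thesis
      using \<epsilon> unfolding eventually_sequentially by simp
  qed
  obtain N1 where N1: "\<And>N. N1 \<le> N \<Longrightarrow> C / real N < \<epsilon> / 4" using small by blast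
  obtain N2 where N2: "\<And>N. N2 \<le> N \<Longrightarrow> norm (X N - P) < \<epsilon> / 4"
    using LIMSEQ_D[OF lim, of "\<epsilon> / 4"] \<epsilon> unfolding X_def by auto
  \<comment> \<open>The budget is four quarters of \<open>\<epsilon>\<close>: \<open>C / N\<close>
    and \<open>C / k\<close> from the tail, the box against \<open>X N\<close>, and
    \<open>X N\<close> against \<open>P\<close>.\<close>
  define N where "N = max (max N0 1) (max N1 N2)"
  have N: "N0 \<le> N" "1 \<le> N" "N1 \<le> N" "N2 \<le> N" unfolding N_def by auto
  define Q where "Q = (\<Prod>j<N. q j)"
  have "(\<lambda>k. ?\<mu> k (\<lambda>f. \<forall>j<N. E j f)) \<longlonglongrightarrow> uprob A {0..<int Q} (\<lambda>f. \<forall>j<N. E j f)"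
  proof (rule uprob_sym_interval_tendsto[OF A])
    show "0 < Q" unfolding Q_def using q by (simp add: prod_pos)
    fix f g :: "'a \<Rightarrow> int"
    assume fg: "\<And>x. x \<in> A \<Longrightarrow> [f x = g x] (mod int Q)"
    have "E j f = E j g" if j: "j < N" for j
    proof (rule E)
      fix x assume x: "x \<in> A"
      have "q j dvd Q" unfolding Q_def using j by (intro dvd_prodI) auto
      then have "int (q j) dvd int Q" by (simp only: of_nat_dvd_iff)
      then show "[f x = g x] (mod int (q j))" using cong_dvd_modulus[OF fg[OF x]] by blast
    qed
    then show "(\<forall>j<N. E j f) = (\<forall>j<N. E j g)" by blast
  qed
  also have "uprob A {0..<int Q} (\<lambda>f. \<forall>j<N. E j f) = X N"
    unfolding Q_def X_def by (rule uprob_CRT_prod[OF A q E])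
  finally have conv: "(\<lambda>k. ?\<mu> k (\<lambda>f. \<forall>j<N. E j f)) \<longlonglongrightarrow> X N" .
  obtain k1 where k1: "\<And>k. k1 \<le> k \<Longrightarrow> norm (?\<mu> k (\<lambda>f. \<forall>j<N. E j f) - X N) < \<epsilon> / 4"
    using LIMSEQ_D[OF conv, of "\<epsilon> / 4"] \<epsilon> by auto
  show "\<exists>no. \<forall>k\<ge>no. norm (?\<mu> k (\<lambda>f. \<forall>j. E j f) - P) < \<epsilon>"
  proof (intro exI[of _ "max k1 (max k0 N1)"] allI impI)
    fix k assume k: "max k1 (max k0 N1) \<le> k"
    have fin: "finite (sym_interval k)" by simp
    define u where "u = ?\<mu> k (\<lambda>f. \<forall>j<N. E j f)"
    define w where "w = ?\<mu> k (\<lambda>f. \<forall>j. E j f)"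
    have "w \<le> u" unfolding w_def u_def by (rule uprob_mono[OF A fin]) blast
    moreover have "u - ?\<mu> k (G N) \<le> w"
    proof -
      have "u - ?\<mu> k (G N) \<le> ?\<mu> k (\<lambda>f. (\<forall>j\<ge>N. E j f) \<and> (\<forall>j<N. E j f))"
        unfolding u_def by (rule uprob_conj_ge[OF A fin]) (rule tail[OF N(1)])
      also have "\<dots> \<le> w" unfolding w_def by (rule uprob_mono[OF A fin]) (meson not_le)
      finally show ?thesis .
    qed
    moreover have "?\<mu> k (G N) < \<epsilon> / 4 + \<epsilon> / 4"
    proof -
      have kk: "k0 \<le> k" "N1 \<le> k" using k by auto
      show ?thesis using G(2)[OF N(2) kk(1)] N1[OF N(3)] N1[OF kk(2)] by linarith
    qed
    moreover have "\<bar>u - X N\<bar> < \<epsilon> / 4" using k1[of k] k unfolding u_def by simp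
    moreover have "\<bar>X N - P\<bar> < \<epsilon> / 4" using N2[OF N(4)] by simp
    ultimately have "\<bar>w - P\<bar> < \<epsilon>" by linarith
    then show "norm (w - P) < \<epsilon>" by simp
  qed
qed

theorem theorem4p3:
  fixes n m r :: nat and d s :: "nat \<Rightarrow> nat"
  assumes "1 \<le> m" and "m \<le> n"
    and "1 \<le> r" and "r \<le> min m (n - 1)"
    and "\<forall>i\<in>{1..r}. 0 < d i"
    and "\<forall>i\<in>{1..<r}. d i dvd d (Suc i)"
    and "(\<lambda>j. nth_prime j ^ s j) has_prod d r"
  shows "(\<forall>j. let p = nth_prime j; t = s j; a = a_tilde r d p in
            a 0 = 0 \<and> a t \<le> r - 1 \<and>
            mu_mod (p ^ (t + 1)) n m (prescribed n m r d) =
              1 / real p ^ (\<Sum>i=1..t. (n - a i) * (m - a i))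
                * (pbracket p n * pbracket p m
                   / (pbracket p (n - a t) * pbracket p (m - a t)
                      * (\<Prod>i=1..t. pbracket p (a i - a (i - 1)))))
              - (\<Sum>l=a t..r - 1.
                  1 / real p ^ ((n - l) * (m - l) + (\<Sum>i=1..t. (n - a i) * (m - a i)))
                    * (pbracket p n * pbracket p m
                       / (pbracket p (n - l) * pbracket p (m - l) * pbracket p (l - a t)
                          * (\<Prod>i=1..t. pbracket p (a i - a (i - 1)))))))
       \<and> finite {j. s j \<noteq> 0}
       \<and> (\<forall>j. s j = 0 \<longrightarrow> (let p = nth_prime j in
            mu_mod p n m (prescribed n m r d) =
              1 - (\<Sum>l=0..r - 1.
                    1 / real p ^ ((n - l) * (m - l))
                      * (pbracket p n * pbracket p m
                         / (pbracket p (n - l) * pbracket p (m - l) * pbracket p l)))))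
       \<and> convergent (mu_box n m (prescribed n m r d))
       \<and> (\<lambda>j. mu_mod (nth_prime j ^ (s j + 1)) n m (prescribed n m r d))
           has_prod mu n m (prescribed n m r d)"
proof -
  let ?S = "prescribed n m r d"
  have rmn: "1 \<le> r" "r \<le> m" "m \<le> n" and rn: "r < n" using assms(1-4) by auto
  have dpos: "0 < d i" if "i \<in> {1..r}" for i using assms(5) that by blast
  have d: "d i dvd d (Suc i)" if "i \<in> {1..<r}" for i using assms(6) that by blast
  have drpos: "0 < d r" using dpos[of r] rmn by simp
  note fact = prime_power_factorization_exponents[OF assms(7) drpos]
  define a where "a j = a_tilde r d (nth_prime j)" for j
  define q where "q j = nth_prime j ^ Suc (s j)" for j
  define x where "x j = mu_mod (q j) n m ?S" for j
  have p1: "1 < nth_prime j" for j by (rule prime_gt_1_nat[OF prime_nth_prime])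
  have mu_snf: "mu_mod (nth_prime j ^ Suc (s j)) n m ?S = snf_prob (nth_prime j) (s j) (a j) r n m 0" for j
    unfolding a_def by (rule mu_mod_eq_snf_prob[OF prime_nth_prime rmn dpos d fact(2,3)])
  then have x_snf: "x j = snf_prob (nth_prime j) (s j) (a j) r n m 0" for j
    unfolding x_def q_def .
  have ar: "a j (s j) < r" for j
    unfolding a_def using a_tilde_less[of r "nth_prime j" "s j" d] rmn(1) fact(2) by blast
  have a0: "a j 0 = 0" for j unfolding a_def by (rule a_tilde_0)
  have a_mono: "t \<le> t' \<Longrightarrow> a j t \<le> a j t'" for j t t' unfolding a_def by (rule a_tilde_mono)
  have finite_s: "finite {j. s j \<noteq> 0}" by (rule fact(1))
  have conv: "convergent_prod x"
    by (rule convergent_prod_local_densities[OF rmn(2) rn finite_s x_snf])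
  then have hp: "x has_prod prodinf x" by (rule convergent_prod_has_prod)
  define E where "E j f = kernel_event (q j) (nth_prime j) (s j) (a j) r {..<n} {..<m} (\<lambda>u v. f (u, v))"
    for j and f :: "nat \<times> nat \<Rightarrow> int"
  have x_uprob: "x j = uprob ({..<n} \<times> {..<m}) {0..<int (q j)} (E j)" for j
    unfolding x_def E_def[abs_def] a_def
    by (rule mu_mod_eq_uprob[OF prime_nth_prime q_def rmn dpos d fact(2,3)])
  \<comment> \<open>Exponents indexed by the primes themselves instead of their positions, as the
    integer criterion expects.\<close>
  define v where "v p = s (inv_into UNIV nth_prime p)" for p
  have vp: "v (nth_prime j) = s j" for j
    unfolding v_def by (subst inv_f_f) (auto simp: inj_def nth_prime_inj)
  have prime_ex: "\<exists>j. p = nth_prime j" if "prime p" for p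
    using bij_nth_prime that unfolding bij_betw_def by blast
  have v: "p ^ v p dvd d r" "\<not> p ^ Suc (v p) dvd d r" if "prime p" for p
    using prime_ex[OF that] fact(2,3) vp by auto
  have box_eq: "mu_box n m ?S k = uprob ({..<n} \<times> {..<m}) (sym_interval k) (\<lambda>f. \<forall>j. E j f)" for k
    unfolding mu_box_def E_def
  proof (rule random_mat_prob)
    show "sym_interval k \<noteq> {}" by simp
    show "(\<forall>j. kernel_event (q j) (nth_prime j) (s j) (a j) r {..<n} {..<m} M) =
       (\<forall>j. kernel_event (q j) (nth_prime j) (s j) (a j) r {..<n} {..<m} N)"
      if "\<And>i j. i < n \<Longrightarrow> j < m \<Longrightarrow> M i j = N i j" for M N
    proof -
      have "kernel_event (q j) (nth_prime j) (s j) (a j) r {..<n} {..<m} M =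
        kernel_event (q j) (nth_prime j) (s j) (a j) r {..<n} {..<m} N" for j
        by (rule kernel_event_eq) (use that in auto)
      then show ?thesis by simp
    qed
    fix M :: "int mat" assume M: "M \<in> carrier_mat n m"
    have "(\<exists>D\<in>?S. is_SNF n m M D) \<longleftrightarrow> (\<forall>p. prime p \<longrightarrow>
        kernel_event (p ^ Suc (v p)) p (v p) (a_tilde r d p) r {..<n} {..<m} (\<lambda>i j. M $$ (i,j)))"
      by (rule int_event_iff[OF rmn dpos d v M])
    also have "\<dots> \<longleftrightarrow> (\<forall>j. kernel_event (q j) (nth_prime j) (s j) (a j) r {..<n} {..<m} (\<lambda>i j. M $$ (i,j)))"
      unfolding q_def a_def using prime_ex vp prime_nth_prime by metis
    finally show "(\<exists>D\<in>?S. is_SNF n m M D) \<longleftrightarrow>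
      (\<forall>j. kernel_event (q j) (nth_prime j) (s j) (a j) r {..<n} {..<m} (\<lambda>i j. M $$ (i,j)))" .
  qed simp
  obtain C k0 where C: "0 \<le> C" "1 \<le> k0" "\<And>N k. 1 \<le> N \<Longrightarrow> k0 \<le> k \<Longrightarrow>
      uprob ({..<n} \<times> {..<m}) (sym_interval k) (bad_prime r N) \<le> C / real N + C / real k"
    using bad_prime_tail[OF rn rmn(2)] by auto
  obtain N0 where N0: "\<And>j. N0 \<le> j \<Longrightarrow> s j = 0"
  proof -
    obtain M where M: "\<forall>j\<in>{j. s j \<noteq> 0}. j < M" using finite_nat_set_iff_bounded[THEN iffD1, OF finite_s] by (rule exE)
    show thesis
    proof (rule that)
      fix j assume "M \<le> j"
      then show "s j = 0" using M by (meson mem_Collect_eq not_less)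
    qed
  qed
  \<comment> \<open>Past \<open>N0\<close> all exponents are 0, so a failure at \<open>j\<close>
    means rank below \<open>r\<close> modulo that prime, which then divides every minor; it exceeds
    \<open>N\<close> because \<open>nth_prime j\<close> exceeds \<open>j\<close>.\<close>
  have tail: "bad_prime r N f" if N: "N0 \<le> N" and nE: "\<not> (\<forall>j\<ge>N. E j f)" for f N
  proof -
    obtain j where j: "N \<le> j" "\<not> E j f" using nE by blast
    have s0: "s j = 0" using N0 N j(1) by simp
    have ev: "\<not> kernel_event (nth_prime j) (nth_prime j) 0 (a j) r {..<n} {..<m} (\<lambda>u v. f (u, v))"
      using j(2) unfolding E_def q_def s0 by simp
    have "int (nth_prime j) dvd minor f r i" if "i \<le> r" for i
      by (rule not_kernel_event_imp_dvd_minor[where f = f, OF prime_nth_prime rmn(2) rn that ev])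
    moreover have "N < nth_prime j" using nth_prime_gt[of j] j(1) by simp
    ultimately show ?thesis
      unfolding bad_prime_def by (intro exI[of _ "nth_prime j"] conjI allI impI prime_nth_prime)
  qed
  have E_cong: "E j f = E j g" if "\<And>y. y \<in> {..<n} \<times> {..<m} \<Longrightarrow> [f y = g y] (mod int (q j))" for j f g
    unfolding E_def by (rule kernel_event_cong[OF q_def]) (use that in auto)
  have q_pos: "0 < q j" for j unfolding q_def using p1[of j] by simp
  have q_coprime: "coprime (q i) (q j)" if "i \<noteq> j" for i j
    unfolding q_def using that by (simp add: primes_coprime prime_nth_prime nth_prime_inj del: power_Suc)
  have x_lim: "(\<lambda>N. \<Prod>j<N. uprob ({..<n} \<times> {..<m}) {0..<int (q j)} (E j)) \<longlonglongrightarrow> prodinf x"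
    using has_prod_imp_LIMSEQ_lessThan[OF hp] unfolding x_uprob .
  have lim: "(\<lambda>k. uprob ({..<n} \<times> {..<m}) (sym_interval k) (\<lambda>f. \<forall>j. E j f)) \<longlonglongrightarrow> prodinf x"
    by (rule uprob_local_global[where A = "{..<n} \<times> {..<m}" and E = E and P = "prodinf x" and q = q and G = "bad_prime r"
        and ?N0.0 = N0 and ?k0.0 = k0 and C = C])
      (fact | simp)+
  have box_lim: "mu_box n m ?S \<longlonglongrightarrow> prodinf x" using lim unfolding box_eq[symmetric] .
  then have "convergent (mu_box n m ?S)" by (rule convergentI)
  moreover have "mu n m ?S = prodinf x" unfolding mu_def using box_lim by (rule limI)
  moreover have "(\<lambda>j. mu_mod (nth_prime j ^ (s j + 1)) n m ?S) = x"
    unfolding x_def q_def by simp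
  ultimately have global: "convergent (mu_box n m ?S)"
    "(\<lambda>j. mu_mod (nth_prime j ^ (s j + 1)) n m ?S) has_prod mu n m ?S" using hp by simp_all
  show ?thesis
  proof (intro conjI allI impI, goal_cases)
    case (1 j)
    show ?case
      unfolding Let_def Suc_eq_plus1[symmetric] a_def[symmetric] mu_snf
    proof (intro conjI)
      show "a j (s j) \<le> r - 1" using ar[of j] by simp
    qed (rule a0, rule snf_prob_formula[OF p1 a0 a_mono ar rmn(2,3)])
  next
    case (3 j)
    \<comment> \<open>For exponent 0 the base case of \<open>snf_prob\<close> is already the stated
      sum, and \<open>l \<le> r - 1 < m\<close> keeps \<open>rank_prob\<close> away from its default
      value 0.\<close>
    have "snf_prob (nth_prime j) 0 (a j) r n m 0 = 1 - (\<Sum>l=0..r - 1. rank_prob (nth_prime j) n m l)"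
      using rmn(1) by (simp add: atLeast0AtMost lessThan_Suc_atMost[symmetric])
    moreover have "\<dots> = 1 - (\<Sum>l=0..r - 1. 1 / real (nth_prime j) ^ ((n - l) * (m - l)) *
        (pbracket (nth_prime j) n * pbracket (nth_prime j) m /
          (pbracket (nth_prime j) (n - l) * pbracket (nth_prime j) (m - l) * pbracket (nth_prime j) l)))"
      using rmn(1,2) by (intro arg_cong2[of _ _ _ _ minus] sum.cong) (auto simp: rank_prob_def)
    ultimately show ?case using mu_snf[of j] 3 unfolding Let_def by simp
  qed (fact finite_s global)+
qed

end
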